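(* Let $a\in(0,1)$. Let $Y$ be a random variable with an absolutely continuous distribution $\eta$ on $(1-\varepsilon_1,1+\varepsilon_2)$, for small $\varepsilon_1\in(0,1)$ and $\varepsilon_2>0$, with a bounded density and such that $\mathbb{E}[\log Y]=0$. Consider the random sum $$X=1+Z_1+Z_1Z_2+\dots+Z_1Z_2\cdots Z_n+\dots,\qquad Z_i=\lambda_i y_i,$$ where the $\lambda_i$ are i.i.d., taking the values $1-a$ and $1+a$ with probabilities $(\tfrac12,\tfrac12)$, and the errors $y_1,y_2,\dots$ are i.i.d. with the distribution of $Y$, independent of $(\lambda_i)_{i\ge1}$. Let $\nu^a_{\mathbf{y}}$ be the conditional distribution of $X$ given the sequence of errors $\mathbf{y}=(y_1,y_2,\dots)$. Then: (a) If $a\in(0,\sqrt3/2)$, then $\nu^a_{\mathbf{y}}$ is absolutely continuous with respect to Lebesgue measure for a.e. $\mathbf{y}$. (b) If $a\ge\sqrt3/2$, then $\nu^a_{\mathbf{y}}$ is singular with respect to Lebesgue measure and $$\dim_H(\nu^a_{\mathbf{y}})=\frac{2\log2}{\log\frac1{1-a^2}}$$ for a.e. $\mathbf{y}$.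
   Context: "A.e. $\mathbf{y}$" refers to the product measure $\eta^{\mathbb{N}}$ (the law of the sequence of errors). The series defining $X$ converges almost surely. For fixed $\mathbf{y}$, $\nu^a_{\mathbf{y}}$ is the law of $1+\sum_{n\ge1}\lambda_1\cdots\lambda_n\,y_1\cdots y_n$ as a function of the random sequence $(\lambda_i)$. For a Borel measure $\nu$ on $\mathbb{R}$, $\dim_H(\nu)=\inf\{\dim_H(A): A\subset\mathbb{R},\ \nu(\mathbb{R}\setminus A)=0\}$, where $\dim_H(A)$ is Hausdorff dimension. *)

theory Defs
  imports "HOL-Probability.Probability"
begin

text \<open>Hausdorff dimension. Covers are countable and by arbitrary bounded sets; boundedness is
  required because \<^const>\<open>diameter\<close> is only meaningful for bounded sets. The case distinction
  implements the conventions $\mathrm{diam}(\emptyset)^s = 0$ and $0^0 = 1$ (in contrast to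
  \<^const>\<open>powr\<close>, for which $0^0 = 0$), so that the $0$-dimensional measure counts points.\<close>

definition diam_pow :: "real \<Rightarrow> 'a::metric_space set \<Rightarrow> ennreal" where
  "diam_pow s U = (if U = {} then 0 else if s = 0 then 1 else ennreal (diameter U powr s))"

definition hausdorff_premeasure :: "real \<Rightarrow> real \<Rightarrow> 'a::metric_space set \<Rightarrow> ennreal" where
  "hausdorff_premeasure s \<delta> A =
     Inf {(\<Sum>i. diam_pow s (U i)) | U :: nat \<Rightarrow> 'a set.
            A \<subseteq> (\<Union>i. U i) \<and> (\<forall>i. bounded (U i) \<and> diameter (U i) \<le> \<delta>)}"

definition hausdorff_measure :: "real \<Rightarrow> 'a::metric_space set \<Rightarrow> ennreal" where
  "hausdorff_measure s A = (SUP \<delta>\<in>{0<..}. hausdorff_premeasure s \<delta> A)"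

definition hausdorff_dim :: "'a::metric_space set \<Rightarrow> ennreal" where
  "hausdorff_dim A = Inf {ennreal s | s. 0 \<le> s \<and> hausdorff_measure s A = 0}"

text \<open>Membership in \<^const>\<open>null_sets\<close> is essential here: \<^const>\<open>emeasure\<close> is \<open>0\<close> on
  non-measurable sets.\<close>

definition hausdorff_dim_measure :: "real measure \<Rightarrow> ennreal" where
  "hausdorff_dim_measure \<nu> = Inf {hausdorff_dim A | A. UNIV - A \<in> null_sets \<nu>}"

definition mutually_singular :: "'a measure \<Rightarrow> 'a measure \<Rightarrow> bool" where
  "mutually_singular M N \<longleftrightarrow> (\<exists>A \<in> null_sets M. space N - A \<in> null_sets N)"

text \<open>Sequences are indexed from \<open>0\<close>, so \<open>l i\<close> and \<open>y i\<close> stand for $\lambda_{i+1}$ and $y_{i+1}$.\<close>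

definition random_sum :: "(nat \<Rightarrow> real) \<Rightarrow> (nat \<Rightarrow> real) \<Rightarrow> real" where
  "random_sum l y = 1 + (\<Sum>n. \<Prod>i\<le>n. l i * y i)"

definition cond_law :: "'w measure \<Rightarrow> (nat \<Rightarrow> 'w \<Rightarrow> real) \<Rightarrow> (nat \<Rightarrow> real) \<Rightarrow> real measure" where
  "cond_law M lam ys = distr M borel (\<lambda>\<omega>. random_sum (\<lambda>i. lam i \<omega>) ys)"

definition seq_law :: "'w measure \<Rightarrow> (nat \<Rightarrow> 'w \<Rightarrow> real) \<Rightarrow> (nat \<Rightarrow> real) measure" where
  "seq_law M y = distr M (\<Pi>\<^sub>M i\<in>UNIV. borel) (\<lambda>\<omega> i. y i \<omega>)"

lemma (in prob_space) seq_law_iid: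
  assumes ind: "indep_vars (\<lambda>_. borel) y UNIV"
    and id: "\<And>i. distr M borel (y i) = \<eta>"
  shows "seq_law M y = (\<Pi>\<^sub>M i\<in>UNIV. \<eta>)"
proof -
  have rv: "random_variable borel (y i)" for i
    using ind by (auto simp: indep_vars_def)
  have "distr M (\<Pi>\<^sub>M i\<in>UNIV. borel) (\<lambda>\<omega>. \<lambda>i\<in>UNIV. y i \<omega>) = (\<Pi>\<^sub>M i\<in>UNIV. distr M borel (y i))"
    by (subst indep_vars_iff_distr_eq_PiM[symmetric]) (use ind rv in auto)
  then show ?thesis
    by (simp add: seq_law_def id restrict_def)
qed

lemma measurable_random_sum:
  "(\<lambda>p. random_sum (fst p) (snd p)) \<in>
     borel_measurable ((\<Pi>\<^sub>M i\<in>UNIV. borel) \<Otimes>\<^sub>M (\<Pi>\<^sub>M i\<in>UNIV. borel))"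
  unfolding random_sum_def by measurable

text \<open>\<^const>\<open>cond_law\<close> is a version of the conditional distribution of the random sum given the
  sequence of errors.\<close>

lemma (in prob_space) cond_law_conditional_distribution:
  assumes ind: "indep_var (\<Pi>\<^sub>M i\<in>UNIV. borel) (\<lambda>\<omega> i. lam i \<omega>)
                          (\<Pi>\<^sub>M i\<in>UNIV. borel) (\<lambda>\<omega> i. y i \<omega>)"
    and B: "B \<in> sets borel" and C: "C \<in> sets (\<Pi>\<^sub>M i\<in>UNIV. borel)"
  shows "emeasure M {\<omega> \<in> space M. random_sum (\<lambda>i. lam i \<omega>) (\<lambda>i. y i \<omega>) \<in> B \<and> (\<lambda>i. y i \<omega>) \<in> C} =
         (\<integral>\<^sup>+ ys\<in>C. emeasure (cond_law M lam ys) B \<partial>seq_law M y)"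
proof -
  let ?P = "(\<Pi>\<^sub>M i\<in>UNIV. borel) :: (nat \<Rightarrow> real) measure"
  let ?L = "distr M ?P (\<lambda>\<omega> i. lam i \<omega>)" and ?Y = "distr M ?P (\<lambda>\<omega> i. y i \<omega>)"
  note [measurable] = B C measurable_random_sum
  have [measurable]: "(\<lambda>\<omega> i. lam i \<omega>) \<in> measurable M ?P" "(\<lambda>\<omega> i. y i \<omega>) \<in> measurable M ?P"
    using ind by (blast dest: indep_var_rv1 indep_var_rv2)+
  interpret L: prob_space ?L by (rule prob_space_distr) measurable
  interpret Y: prob_space ?Y by (rule prob_space_distr) measurable
  interpret LY: pair_prob_space ?L ?Y ..
  let ?S = "{p \<in> space (?P \<Otimes>\<^sub>M ?P). random_sum (fst p) (snd p) \<in> B \<and> snd p \<in> C}"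
  have "?S = ((\<lambda>p. random_sum (fst p) (snd p)) -` B \<inter> space (?P \<Otimes>\<^sub>M ?P)) \<inter>
             (snd -` C \<inter> space (?P \<Otimes>\<^sub>M ?P))"
    by auto
  also have "\<dots> \<in> sets (?P \<Otimes>\<^sub>M ?P)"
    by (intro sets.Int measurable_sets[OF measurable_random_sum B] measurable_sets[OF measurable_snd C])
  finally have S[measurable]: "?S \<in> sets (?P \<Otimes>\<^sub>M ?P)" .
  have "emeasure M {\<omega> \<in> space M. random_sum (\<lambda>i. lam i \<omega>) (\<lambda>i. y i \<omega>) \<in> B \<and> (\<lambda>i. y i \<omega>) \<in> C}
      = emeasure (distr M (?P \<Otimes>\<^sub>M ?P) (\<lambda>\<omega>. (\<lambda>i. lam i \<omega>, \<lambda>i. y i \<omega>))) ?S"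
    by (subst emeasure_distr[OF _ S]) (auto intro!: arg_cong[where f="emeasure M"] simp: space_pair_measure space_PiM)
  also have "\<dots> = emeasure (?L \<Otimes>\<^sub>M ?Y) ?S"
    using ind by (simp add: indep_var_distribution_eq)
  also have "\<dots> = (\<integral>\<^sup>+ ys. emeasure ?L ((\<lambda>l. (l, ys)) -` ?S) \<partial>?Y)"
    by (rule LY.emeasure_pair_measure_alt2) (simp cong: sets_pair_measure_cong)
  also have "\<dots> = (\<integral>\<^sup>+ ys\<in>C. emeasure (cond_law M lam ys) B \<partial>?Y)"
  proof (rule nn_integral_cong)
    fix ys
    have m: "random_sum (\<lambda>i. lam i \<omega>) ys = random_sum (fst (\<lambda>i. lam i \<omega>, ys)) (snd (\<lambda>i. lam i \<omega>, ys))" for \<omega>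
      by simp
    have [measurable]: "(\<lambda>\<omega>. random_sum (\<lambda>i. lam i \<omega>) ys) \<in> borel_measurable M"
      unfolding m by (rule measurable_compose[OF _ measurable_random_sum]) (simp add: space_PiM)
    have V: "(\<lambda>l. (l, ys)) -` ?S = (if ys \<in> C then {l. random_sum l ys \<in> B} else {})"
      by (auto simp: space_pair_measure space_PiM)
    have W: "{l. random_sum l ys \<in> B} \<in> sets ?P"
      if "ys \<in> C" using measurable_sets[of "\<lambda>l. (l, ys)" ?P "?P \<Otimes>\<^sub>M ?P", OF _ S] that V
      by (simp add: space_PiM)
    show "emeasure ?L ((\<lambda>l. (l, ys)) -` ?S) = emeasure (cond_law M lam ys) B * indicator C ys"
      unfolding V using W
      by (auto simp: cond_law_def emeasure_distr vimage_def)
  qed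
  finally show ?thesis by (simp add: seq_law_def)
qed

end

theory Submission
  imports Defs
begin

text \<open>
  Write \<chi> = ln (1 - a^2) / 2 (the constant \<open>exponent\<close>) for the mean of the logarithm of a sign \<lambda>; the errors do not change
  the exponent because their logarithm has mean 0. For a sequence y of errors, the points of the
  random sum that share their first n signs form a cylinder of length about exp (n \<chi>), and there are
  2^n cylinders, each of probability 2^-n. The threshold between the two cases is \<chi> = - ln 2.

  \<^emph>\<open>Small sets.\<close> If s exceeds ln 2 / - \<chi>, the s-th powers of the cylinder lengths at level n have a
  sum that decays geometrically, so the conditional law lives on a limsup of finite unions of
  intervals with s-dimensional measure 0 (\<open>AE_conditional_law_carried_by_small_set\<close>). This gives the
  upper bound for the dimension and, for \<chi> < - ln 2, singularity with s = 1. At \<chi> = - ln 2 the total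
  length of the typical cylinders does not decay exponentially, and one uses fluctuations
  instead: the walk \<Sum> ln (2 \<lambda> y) is centred and not constant, so by the central limit theorem and
  the zero-one law it is almost surely very negative at infinitely many times of a fixed sequence
  (\<open>centered_walk_below_io\<close>), at which 2^n intervals of summable total length suffice
  (\<open>AE_conditional_law_singular_critical\<close>).

  \<^emph>\<open>Spread.\<close> For the lower bounds one averages over the errors. Let two sign sequences first differ
  at position n. The difference of their sums is the product of the first n signs and the first n + 1
  errors, times an affine function d + y v of the next error, where d = \<plusminus> 2 a and v depends only on later
  coordinates (\<open>random_sum_diff_common_prefix\<close>). Because d is bounded away from 0 and the errors have a
  bounded density, this affine function is at most \<rho> in modulus with probability O(\<rho>), uniformly in v
  (\<open>affine_small_ball\<close>). On the events where the products grow at their typical rate up to a factor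
  exp (\<plusminus> n \<delta>), two sums are therefore within r with probability O((r exp (- n \<chi> + 2 n \<delta>))^s) for every
  s \<le> 1. Pairs that differ first at n have probability at most 2^-n, so that the expected mass of pairs within r
  is O(r^s) as soon as s (- \<chi> + 2 \<delta>) < ln 2 (\<open>expected_restricted_energy_le\<close>). If \<chi> > - ln 2, then s = 1
  is admissible and Fatou's lemma gives an energy bound along a sequence of scales, hence absolute
  continuity (\<open>liminf_energy_imp_absolutely_continuous\<close>). Otherwise every s < ln 2 / - \<chi> is admissible,
  and for t < s the law gives no mass to sets of t-dimensional measure 0
  (\<open>finite_energy_imp_hausdorff_null_is_null\<close>).
\<close>

section \<open>Hausdorff null sets, mass distribution and energy\<close>

lemma term_le_suminf_ennreal: "f n \<le> (\<Sum>n. f n :: ennreal)"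
  using sum_le_suminf[of f "{n}"] by simp

lemma hausdorff_null_cover:
  fixes A :: "'a::metric_space set"
  assumes "hausdorff_measure s A = 0" "0 < \<delta>" "0 < e"
  obtains U :: "nat \<Rightarrow> 'a set" where "A \<subseteq> (\<Union>i. U i)" "\<And>i. bounded (U i)" "\<And>i. diameter (U i) \<le> \<delta>"
    "(\<Sum>i. diam_pow s (U i)) < e"
proof -
  have "hausdorff_premeasure s \<delta> A \<le> hausdorff_measure s A"
    unfolding hausdorff_measure_def using assms by (intro SUP_upper) auto
  then have "hausdorff_premeasure s \<delta> A < e"
    using assms by auto
  then show ?thesis
    unfolding hausdorff_premeasure_def Inf_less_iff using that by auto
qed

text \<open>The easy half of Frostman's lemma. A piece of the cover that meets A lies in a ball around a point
  of A with radius its diameter, so its \<nu>-mass is at most H times its s-th power; summing over a cheap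
  cover gives arbitrarily small mass. Pieces of diameter 0 are points, and they need the limit of
  the ball bound as r tends to 0.\<close>

lemma mass_distribution_null:
  fixes A :: "'a::metric_space set" and \<nu> :: "'a measure"
  assumes \<nu>: "sets \<nu> = sets borel" and s: "0 \<le> s" and H: "0 < H"
    and ball: "\<And>x r. x \<in> A \<Longrightarrow> 0 < r \<Longrightarrow> r < 1 \<Longrightarrow> emeasure \<nu> (cball x r) \<le> ennreal (H * r powr s)"
    and null: "hausdorff_measure s A = 0"
  shows "emeasure \<nu> A = 0"
proof -
  have point: "emeasure \<nu> {x} \<le> ennreal H * diam_pow s U"
    if "x \<in> A" "U \<noteq> {}" for x and U :: "'a set"
  proof -
    have *: "emeasure \<nu> {x} \<le> ennreal (H * r powr s)" if "0 < r" "r < 1" for r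
      by (rule order_trans[OF emeasure_mono ball[OF \<open>x \<in> A\<close> that]]) (use that \<nu> in auto)
    show ?thesis
    proof (cases "s = 0")
      case True
      then show ?thesis using *[of "1/2"] that by (simp add: diam_pow_def)
    next
      case False
      have "((\<lambda>r. ennreal (H * r powr s)) \<longlongrightarrow> ennreal (H * 0 powr s)) (at_right 0)"
        using s False
        by (intro tendsto_ennrealI tendsto_mult tendsto_const tendsto_powr') (auto simp: eventually_at_right_less eventually_at_filter)
      moreover have "\<forall>\<^sub>F r in at_right 0. emeasure \<nu> {x} \<le> ennreal (H * r powr s)"
        using eventually_at_right_real[of 0 1] by (auto elim!: eventually_mono intro!: *)
      ultimately have "emeasure \<nu> {x} \<le> ennreal (H * 0 powr s)"
        by (intro tendsto_lowerbound) auto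
      then show ?thesis by simp
    qed
  qed
  have "emeasure \<nu> A \<le> ennreal H * e" if "0 < e" for e
  proof -
    obtain U :: "nat \<Rightarrow> 'a set" where U: "A \<subseteq> (\<Union>i. U i)" "\<And>i. bounded (U i)" "\<And>i. diameter (U i) \<le> 1/2"
      and sum: "(\<Sum>i. diam_pow s (U i)) < e"
      using hausdorff_null_cover[OF null, of "1/2" e] \<open>0 < e\<close> by auto
    have "\<exists>B \<in> sets \<nu>. U i \<inter> A \<subseteq> B \<and> emeasure \<nu> B \<le> ennreal H * diam_pow s (U i)" for i
    proof (cases "U i \<inter> A = {}")
      case False
      then obtain x where x: "x \<in> U i" "x \<in> A" by auto
      have sub: "U i \<subseteq> cball x (diameter (U i))"
        using diameter_bounded_bound[OF U(2)] x by auto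
      have "emeasure \<nu> (cball x (diameter (U i))) \<le> ennreal H * diam_pow s (U i)"
      proof (cases "diameter (U i) = 0")
        case True
        then show ?thesis using point[OF x(2), of "U i"] x by auto
      next
        case False
        then have d: "0 < diameter (U i)" using diameter_ge_0[OF U(2), of i] by simp
        have "ennreal (H * diameter (U i) powr s) \<le> ennreal H * diam_pow s (U i)"
          using x H d by (auto simp: diam_pow_def ennreal_mult)
        then show ?thesis
          using ball[OF x(2) d] U(3)[of i] by simp
      qed
      then show ?thesis using sub \<nu> by (intro bexI[of _ "cball x (diameter (U i))"]) auto
    qed (auto intro!: bexI[of _ "{}"])
    then obtain B where B: "\<And>i. B i \<in> sets \<nu>" "\<And>i. U i \<inter> A \<subseteq> B i"
      "\<And>i. emeasure \<nu> (B i) \<le> ennreal H * diam_pow s (U i)" by metis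
    have "emeasure \<nu> A \<le> emeasure \<nu> (\<Union>i. B i)"
      using U(1) B(1,2) by (intro emeasure_mono) (auto, blast)
    also have "\<dots> \<le> (\<Sum>i. emeasure \<nu> (B i))"
      using B by (intro emeasure_subadditive_countably) auto
    also have "\<dots> \<le> (\<Sum>i. ennreal H * diam_pow s (U i))"
      by (intro suminf_le B) auto
    also have "\<dots> = ennreal H * (\<Sum>i. diam_pow s (U i))" by simp
    also have "\<dots> \<le> ennreal H * e" using sum by (intro mult_left_mono) auto
    finally show ?thesis .
  qed
  from this[of "ennreal (e / H)" for e] H have "emeasure \<nu> A \<le> 0 + ennreal e" if "0 < e" for e
    using that by (simp add: ennreal_mult[symmetric])
  then have "emeasure \<nu> A \<le> 0" by (rule ennreal_le_epsilon) simp
  then show ?thesis by simp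
qed

lemma hausdorff_measure_mono: "hausdorff_measure s A \<le> hausdorff_measure s B" if "A \<subseteq> B"
  unfolding hausdorff_measure_def hausdorff_premeasure_def
  by (intro SUP_mono' Inf_superset_mono) (use that in auto)

text \<open>Every tail of the family covers the limsup set, and the tails of a convergent series vanish.\<close>

lemma hausdorff_measure_limsup_cballs_null:
  fixes c :: "nat \<Rightarrow> nat \<Rightarrow> real"
  assumes s: "0 < s" and \<rho>: "\<And>k. 0 \<le> \<rho> k" "\<rho> \<longlonglongrightarrow> 0"
    and sum: "summable (\<lambda>k. real (N k) * (2 * \<rho> k) powr s)"
  shows "hausdorff_measure s (\<Inter>K. \<Union>k\<in>{K..}. \<Union>j<N k. cball (c k j) (\<rho> k)) = 0"
proof -
  let ?A = "\<Inter>K. \<Union>k\<in>{K..}. \<Union>j<N k. cball (c k j) (\<rho> k)"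
  let ?f = "\<lambda>k. ennreal (real (N k) * (2 * \<rho> k) powr s)"
  have "hausdorff_premeasure s \<delta> ?A \<le> 0" if "0 < \<delta>" for \<delta>
  proof (rule ennreal_le_epsilon)
    fix e :: real assume "0 < e"
    obtain K0 where K0: "norm (\<Sum>k. real (N (k + K)) * (2 * \<rho> (k + K)) powr s) < e" if "K0 \<le> K" for K
      using suminf_exist_split[OF \<open>0 < e\<close> sum] by auto
    have "(\<Sum>k. ?f (k + K)) < ennreal e" if "K0 \<le> K" for K
      using K0[OF that] \<open>0 < e\<close> by (subst suminf_ennreal2) (auto intro!: sum summable_ignore_initial_segment ennreal_lessI)
    then have "\<forall>\<^sub>F K in sequentially. (\<Sum>k. ?f (k + K)) < ennreal e"
      by (auto simp: eventually_sequentially)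
    moreover have "\<forall>\<^sub>F K in sequentially. \<rho> K < \<delta> / 2"
      using \<rho>(2) \<open>0 < \<delta>\<close> by (intro order_tendstoD) auto
    then have "\<forall>\<^sub>F K in sequentially. \<forall>k\<ge>K. \<rho> k < \<delta> / 2"
      using eventually_all_ge_at_top by blast
    ultimately have "\<forall>\<^sub>F K in sequentially. (\<Sum>k. ?f (k + K)) < ennreal e \<and> (\<forall>k\<ge>K. \<rho> k < \<delta> / 2)"
      by eventually_elim auto
    then obtain K where K: "(\<Sum>k. ?f (k + K)) < ennreal e" "\<And>k. k \<ge> K \<Longrightarrow> \<rho> k < \<delta> / 2"
      using eventually_happens'[OF sequentially_bot] by blast
    define V where "V = (\<lambda>(k, j). if j < N (k + K) then cball (c (k + K) j) (\<rho> (k + K)) else {})"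
    define U where "U i = V (prod_decode i)" for i
    have bd: "bounded (V p)" for p by (auto simp: V_def split: prod.splits)
    have diam: "diameter (V p) \<le> \<delta>" for p
      using K(2)[of "fst p + K"] \<rho>(1) \<open>0 < \<delta>\<close> by (auto simp: V_def split: prod.splits)
    have "?A \<subseteq> (\<Union>i. U i)"
    proof
      fix x assume "x \<in> ?A"
      then have "x \<in> (\<Union>k\<in>{K..}. \<Union>j<N k. cball (c k j) (\<rho> k))" by blast
      then obtain k j where "k \<ge> K" "j < N k" "x \<in> cball (c k j) (\<rho> k)" by blast
      then have "x \<in> V (k - K, j)" by (auto simp: V_def)
      then have "x \<in> U (prod_encode (k - K, j))" by (simp add: U_def)
      then show "x \<in> (\<Union>i. U i)" by blast
    qed
    then have "hausdorff_premeasure s \<delta> ?A \<le> (\<Sum>i. diam_pow s (U i))"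
      unfolding hausdorff_premeasure_def using bd diam
      by (intro Inf_lower CollectI exI[of _ U]) (auto simp: U_def)
    also have "\<dots> = (\<Sum>k. \<Sum>j. diam_pow s (V (k, j)))"
      unfolding U_def using suminf_ennreal_2dimen[of "\<lambda>k. \<Sum>j. diam_pow s (V (k, j))" "\<lambda>p. diam_pow s (V p)"]
      by simp
    also have "\<dots> \<le> (\<Sum>k. ?f (k + K))"
    proof (intro suminf_le summableI)
      fix k
      have "(\<Sum>j. diam_pow s (V (k, j))) = (\<Sum>j<N (k + K). diam_pow s (V (k, j)))"
        by (intro suminf_finite) (auto simp: V_def diam_pow_def)
      also have "\<dots> \<le> (\<Sum>j<N (k + K). ennreal ((2 * \<rho> (k + K)) powr s))"
        using s \<rho>(1) by (intro sum_mono) (auto simp: V_def diam_pow_def)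
      also have "\<dots> = ?f (k + K)"
        by (simp add: ennreal_mult ennreal_of_nat_eq_real_of_nat)
      finally show "(\<Sum>j. diam_pow s (V (k, j))) \<le> ?f (k + K)" .
    qed
    also have "\<dots> \<le> ennreal e" using K by simp
    finally show "hausdorff_premeasure s \<delta> ?A \<le> 0 + ennreal e" by simp
  qed
  then show ?thesis by (simp add: hausdorff_measure_def SUP_eq_iff bot_ennreal)
qed

lemma borel_measurable_emeasure_cball:
  fixes \<nu> :: "real measure"
  assumes "finite_measure \<nu>" and [measurable_cong, simp]: "sets \<nu> = sets borel"
  shows "(\<lambda>x. emeasure \<nu> (cball x r)) \<in> borel_measurable borel"
proof -
  interpret finite_measure \<nu> by fact
  have "{p::real \<times> real. dist (fst p) (snd p) \<le> r} \<in> sets (borel \<Otimes>\<^sub>M borel)"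
    unfolding borel_prod by (intro borel_closed closed_Collect_le continuous_intros)
  then have "{p::real \<times> real. dist (fst p) (snd p) \<le> r} \<in> sets (borel \<Otimes>\<^sub>M \<nu>)"
    by (simp cong: sets_pair_measure_cong)
  from measurable_emeasure_Pair[OF this] show ?thesis
    by (simp add: cball_def vimage_def)
qed

lemma dyadic_scale:
  assumes "0 < r" "r < (1::real)"
  obtains m :: nat where "r \<le> 1 / 2 ^ m" "1 / 2 ^ m < 2 * r"
proof -
  define m where "m = nat \<lfloor>- log 2 r\<rfloor>"
  have "0 \<le> - log 2 r" using assms by (simp add: log_def field_simps)
  then have m: "real m \<le> - log 2 r" "- log 2 r < real m + 1"
    unfolding m_def by linarith+
  have "2 powr (log 2 r) \<le> 2 powr (- real m)" "2 powr (- real m) < 2 powr (log 2 r + 1)"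
    using m by auto
  then show ?thesis using that[of m] assms
    by (simp add: powr_add powr_minus powr_realpow field_simps)
qed

text \<open>The function h sums the normalised masses of the dyadic balls around x. Its \<nu>-integral is the
  assumed energy, so h is finite almost everywhere, and on each of its sublevel sets the mass
  distribution principle applies.\<close>

lemma finite_energy_imp_hausdorff_null_is_null:
  fixes \<nu> :: "real measure"
  assumes fin: "finite_measure \<nu>" and \<nu>[measurable_cong, simp]: "sets \<nu> = sets borel"
    and s: "0 \<le> s" "s \<le> t"
    and energy: "(\<Sum>m. ennreal (2 powr (t * real m)) * (\<integral>\<^sup>+x. emeasure \<nu> (cball x (1 / 2 ^ m)) \<partial>\<nu>)) < \<infinity>"
    and A[measurable]: "A \<in> sets borel" and null: "hausdorff_measure s A = 0"
  shows "emeasure \<nu> A = 0"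
proof -
  interpret finite_measure \<nu> by fact
  have [simp]: "space \<nu> = UNIV" using sets_eq_imp_space_eq[OF \<nu>] by simp
  note [measurable] = borel_measurable_emeasure_cball[OF fin \<nu>]
  define h where "h x = (\<Sum>m. ennreal (2 powr (t * real m)) * emeasure \<nu> (cball x (1 / 2 ^ m)))" for x
  have h[measurable]: "h \<in> borel_measurable borel" unfolding h_def by measurable
  have "(\<integral>\<^sup>+x. h x \<partial>\<nu>) < \<infinity>"
    unfolding h_def using energy by (simp add: nn_integral_suminf nn_integral_cmult)
  then have AEh: "AE x in \<nu>. h x \<noteq> \<infinity>"
    by (intro nn_integral_PInf_AE) auto
  have level: "emeasure \<nu> {x \<in> A. h x \<le> ennreal H} = 0" if H: "0 < H" for H
  proof (rule mass_distribution_null[OF \<nu> s(1), of "H * 2 powr t"])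
    fix x r :: real assume x: "x \<in> {x \<in> A. h x \<le> ennreal H}" and r: "0 < r" "r < 1"
    obtain m where m: "r \<le> 1 / 2 ^ m" "1 / 2 ^ m < 2 * r" using dyadic_scale[OF r] .
    have "ennreal (2 powr (t * real m)) * emeasure \<nu> (cball x (1 / 2 ^ m)) \<le> h x"
      unfolding h_def by (rule term_le_suminf_ennreal)
    also have "\<dots> \<le> ennreal H" using x by simp
    finally have "2 powr (t * real m) * measure \<nu> (cball x (1 / 2 ^ m)) \<le> H"
      using H by (simp add: emeasure_eq_measure ennreal_mult[symmetric])
    then have "measure \<nu> (cball x (1 / 2 ^ m)) \<le> H * (1 / 2 ^ m) powr t"
      by (simp add: powr_divide powr_realpow[symmetric] powr_powr field_simps)
    moreover have "measure \<nu> (cball x r) \<le> measure \<nu> (cball x (1 / 2 ^ m))"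
      using m by (intro finite_measure_mono) auto
    moreover have "(1 / 2 ^ m) powr t \<le> (2 * r) powr t"
      using m s by (intro powr_mono2) auto
    moreover have "(2 * r) powr t \<le> 2 powr t * r powr s"
      using r s by (simp add: powr_mult powr_mono')
    ultimately have "measure \<nu> (cball x r) \<le> H * (2 powr t * r powr s)"
      using H by (meson mult_left_mono order.trans less_imp_le)
    then show "emeasure \<nu> (cball x r) \<le> ennreal (H * 2 powr t * r powr s)"
      by (simp add: emeasure_eq_measure mult.assoc ennreal_leI)
  next
    show "hausdorff_measure s {x \<in> A. h x \<le> ennreal H} = 0"
      using hausdorff_measure_mono[of "{x \<in> A. h x \<le> ennreal H}" A s] null by auto
  qed (use H in auto)
  have "AE x in \<nu>. \<not> (x \<in> A \<and> h x \<le> ennreal (real (Suc n)))" for n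
    using level[of "real (Suc n)"] by (subst AE_iff_measurable[OF _ refl]) (auto simp: conj_commute)
  then have "AE x in \<nu>. \<forall>n. \<not> (x \<in> A \<and> h x \<le> ennreal (real (Suc n)))"
    by (rule AE_all_countable[THEN iffD2, OF allI])
  with AEh have "AE x in \<nu>. x \<notin> A"
  proof eventually_elim
    case (elim x)
    then obtain n :: nat where "h x < of_nat n"
      using ennreal_Ex_less_of_nat[of "h x"] by (auto simp: less_top)
    then have "h x \<le> ennreal (real (Suc n))"
      unfolding ennreal_of_nat_eq_real_of_nat[symmetric]
      by (rule order_trans[OF less_imp_le]) simp
    then show ?case using elim by auto
  qed
  then show ?thesis by (simp add: AE_iff_measurable[OF _ refl])
qed

text \<open>A covering lemma proved by integration: each point of G sees an interval of length r around it, so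
  r \<nu>(G) is the area of the pairs (x, z) with x in G within r / 2 of z. Integrating over x first, every z
  lies in U and is paired with a subset of one ball of radius r around a point of G.\<close>

lemma emeasure_le_of_ball_bound:
  fixes \<nu> :: "real measure"
  assumes fin: "finite_measure \<nu>" and \<nu>[measurable_cong, simp]: "sets \<nu> = sets borel"
    and r: "0 < r" and H: "0 \<le> H"
    and G[measurable]: "G \<in> sets borel" and U[measurable]: "U \<in> sets borel"
    and sub: "\<And>x. x \<in> G \<Longrightarrow> cball x r \<subseteq> U"
    and bound: "\<And>x. x \<in> G \<Longrightarrow> emeasure \<nu> (cball x r) \<le> ennreal (H * r)"
  shows "emeasure \<nu> G \<le> ennreal H * emeasure lborel U"
proof -
  interpret finite_measure \<nu> by fact
  have [simp]: "space \<nu> = UNIV" using sets_eq_imp_space_eq[OF \<nu>] by simp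
  interpret pair_sigma_finite \<nu> lborel ..
  define S where "S = {p :: real \<times> real. dist (fst p) (snd p) \<le> r / 2} \<inter> G \<times> UNIV"
  have "{p :: real \<times> real. dist (fst p) (snd p) \<le> r / 2} \<in> sets (borel \<Otimes>\<^sub>M borel)"
    unfolding borel_prod by (intro borel_closed closed_Collect_le continuous_intros)
  moreover have eq: "sets (\<nu> \<Otimes>\<^sub>M lborel) = sets (borel \<Otimes>\<^sub>M (borel :: real measure))"
    by (intro sets_pair_measure_cong \<nu>) simp
  ultimately have S: "S \<in> sets (\<nu> \<Otimes>\<^sub>M lborel)"
    unfolding S_def eq by (intro sets.Int pair_measureI G) auto
  have "ennreal r * emeasure \<nu> G = (\<integral>\<^sup>+x. ennreal r * indicator G x \<partial>\<nu>)"
    by (simp add: nn_integral_cmult)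
  also have "\<dots> = (\<integral>\<^sup>+x. emeasure lborel (Pair x -` S) \<partial>\<nu>)"
  proof (intro nn_integral_cong)
    fix x
    have "z \<in> {x - r/2 .. x + r/2}" if "\<bar>x - z\<bar> \<le> r / 2" for z
      unfolding atLeastAtMost_iff using that by linarith
    moreover have "\<bar>x - z\<bar> \<le> r / 2" if "z \<in> {x - r/2 .. x + r/2}" for z
      using that unfolding atLeastAtMost_iff by linarith
    ultimately have "{z. \<bar>x - z\<bar> \<le> r / 2} = {x - r/2 .. x + r/2}" by blast
    moreover have "Pair x -` S = (if x \<in> G then {z. \<bar>x - z\<bar> \<le> r / 2} else {})"
      by (simp add: S_def dist_real_def vimage_def)
    ultimately have "Pair x -` S = (if x \<in> G then {x - r/2 .. x + r/2} else {})" by simp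
    then show "ennreal r * indicator G x = emeasure lborel (Pair x -` S)"
      using r by simp
  qed
  also have "\<dots> = emeasure (\<nu> \<Otimes>\<^sub>M lborel) S"
    by (rule lborel.emeasure_pair_measure_alt[OF S, symmetric])
  also have "\<dots> = (\<integral>\<^sup>+z. emeasure \<nu> ((\<lambda>x. (x, z)) -` S) \<partial>lborel)"
    by (rule emeasure_pair_measure_alt2[OF S])
  also have "\<dots> \<le> (\<integral>\<^sup>+z. ennreal (H * r) * indicator U z \<partial>lborel)"
  proof (intro nn_integral_mono)
    fix z
    show "emeasure \<nu> ((\<lambda>x. (x, z)) -` S) \<le> ennreal (H * r) * indicator U z"
    proof (cases "(\<lambda>x. (x, z)) -` S = {}")
      case False
      then obtain x where x: "x \<in> G" "dist x z \<le> r / 2" by (auto simp: S_def)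
      have "z \<in> U" using sub[OF x(1)] x r by auto
      moreover have "(\<lambda>x. (x, z)) -` S \<subseteq> cball x r"
      proof
        fix x' assume "x' \<in> (\<lambda>x. (x, z)) -` S"
        then have "dist x' z \<le> r / 2" by (auto simp: S_def)
        with x(2) show "x' \<in> cball x r" using dist_triangle2[of x x' z] by simp
      qed
      then have "emeasure \<nu> ((\<lambda>x. (x, z)) -` S) \<le> emeasure \<nu> (cball x r)"
        by (intro emeasure_mono) auto
      ultimately show ?thesis using bound[OF x(1)] by (auto intro: order_trans)
    qed simp
  qed
  also have "\<dots> = ennreal r * (ennreal H * emeasure lborel U)"
    using r H by (simp add: nn_integral_cmult ennreal_mult ac_simps)
  finally show ?thesis
    using r by (subst (asm) ennreal_mult_le_mult_iff) auto
qed

text \<open>By Markov's inequality, at a scale where the energy is at most K, all but mass K / H of \<nu> sits at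
  points whose ball has mass at most H times its radius, and the part of U with room for
  such balls has mass at most H times the length of U. As the scale tends to 0 these parts exhaust
  an open U, so \<nu>(U) \<le> H |U| + K / H for every H. For U of small length, choose H large.\<close>

lemma liminf_energy_imp_absolutely_continuous:
  fixes \<nu> :: "real measure"
  assumes fin: "finite_measure \<nu>" and \<nu>[measurable_cong, simp]: "sets \<nu> = sets borel"
    and energy: "liminf (\<lambda>m. ennreal (2 ^ m) * (\<integral>\<^sup>+x. emeasure \<nu> (cball x (1 / 2 ^ m)) \<partial>\<nu>)) < \<infinity>"
  shows "absolutely_continuous lborel \<nu>"
proof -
  interpret finite_measure \<nu> by fact
  have [simp]: "space \<nu> = UNIV" using sets_eq_imp_space_eq[OF \<nu>] by simp
  note [measurable] = borel_measurable_emeasure_cball[OF fin \<nu>]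
  define q where "q m = (\<integral>\<^sup>+x. emeasure \<nu> (cball x (1 / 2 ^ m)) \<partial>\<nu>)" for m :: nat
  obtain K :: nat where K_def: "liminf (\<lambda>m. ennreal (2 ^ m) * q m) < of_nat K"
    using ennreal_Ex_less_of_nat energy by (auto simp: q_def)
  have K: "\<exists>m\<ge>m0. ennreal (2 ^ m) * q m \<le> of_nat K" for m0
  proof (rule ccontr)
    assume "\<not> (\<exists>m\<ge>m0. ennreal (2 ^ m) * q m \<le> of_nat K)"
    then have "\<forall>\<^sub>F m in sequentially. of_nat K \<le> ennreal (2 ^ m) * q m"
      unfolding eventually_sequentially by (metis linear)
    then have "of_nat K \<le> liminf (\<lambda>m. ennreal (2 ^ m) * q m)"
      by (rule Liminf_bounded)
    with K_def show False by simp
  qed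
  have open_bound: "emeasure \<nu> U \<le> ennreal H * emeasure lborel U + ennreal (real K / H)"
    if U: "open U" and H: "0 < H" for U H
  proof -
    \<comment> \<open>Open balls of twice the radius make this set closed, hence Borel.\<close>
    define V where "V m = {x. ball x (2 / 2 ^ m) \<subseteq> U}" for m :: nat
    have V_eq: "- V m = (\<Union>z\<in>-U. ball z (2 / 2 ^ m))" for m
      by (auto simp: V_def dist_commute)
    have "closed (V m)" for m
      using V_eq[of m] by (metis closed_open open_UN open_ball)
    then have V[measurable]: "V m \<in> sets borel" for m by simp
    have V_cball: "cball x (1 / 2 ^ m) \<subseteq> U" if "x \<in> V m" for x m
    proof -
      have "cball x (1 / 2 ^ m) \<subseteq> ball x (2 / 2 ^ m)" by (auto simp: field_simps)
      then show ?thesis using that by (auto simp: V_def)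
    qed
    have inc: "incseq V"
    proof (rule incseq_SucI)
      fix m
      have "ball x (2 / 2 ^ Suc m) \<subseteq> ball x (2 / 2 ^ m)" for x :: real
        by (rule subset_ball) (simp add: field_simps)
      then show "V m \<le> V (Suc m)" by (auto simp: V_def)
    qed
    have UV: "U = (\<Union>m. V m)"
    proof safe
      fix x assume "x \<in> U"
      then obtain e where e: "0 < e" "cball x e \<subseteq> U" using U open_contains_cball by blast
      obtain m where "(1/2) ^ m < e / 2" using real_arch_pow_inv[of "e / 2" "1/2"] e by auto
      then have "2 / 2 ^ m \<le> e" by (simp add: power_one_over)
      then have "ball x (2 / 2 ^ m) \<subseteq> cball x e" by auto
      then show "x \<in> (\<Union>m. V m)" using e by (auto simp: V_def)
    next
      fix x m assume "x \<in> V m" then show "x \<in> U" by (auto simp: V_def subset_iff)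
    qed
    have bd: "emeasure \<nu> (V m) \<le> ennreal H * emeasure lborel U + ennreal (real K / H)"
      if m: "ennreal (2 ^ m) * q m \<le> of_nat K" for m
    proof -
      define G where "G = {x. emeasure \<nu> (cball x (1 / 2 ^ m)) \<le> ennreal (H * (1 / 2 ^ m))}"
      have [measurable]: "G \<in> sets borel" unfolding G_def by measurable
      have "emeasure \<nu> (V m \<inter> G) \<le> ennreal H * emeasure lborel U"
        by (rule emeasure_le_of_ball_bound[OF fin \<nu>, of "1 / 2 ^ m"]) (use H U V_cball in \<open>auto simp: G_def\<close>)
      moreover have "emeasure \<nu> (- G) \<le> ennreal (real K / H)"
      proof -
        have "- G \<subseteq> {x \<in> UNIV. 1 \<le> ennreal (2 ^ m / H) * emeasure \<nu> (cball x (1 / 2 ^ m))}"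
          using H by (auto simp: G_def emeasure_eq_measure ennreal_mult[symmetric] ennreal_1[symmetric] field_simps
              simp del: ennreal_1)
        then have "emeasure \<nu> (- G) \<le> emeasure \<nu> {x \<in> UNIV. 1 \<le> ennreal (2 ^ m / H) * emeasure \<nu> (cball x (1 / 2 ^ m))}"
          by (intro emeasure_mono) auto
        also have "\<dots> \<le> ennreal (2 ^ m / H) * (\<integral>\<^sup>+x. emeasure \<nu> (cball x (1 / 2 ^ m)) * indicator UNIV x \<partial>\<nu>)"
          by (rule nn_integral_Markov_inequality) auto
        also have "\<dots> = ennreal (1 / H) * (ennreal (2 ^ m) * q m)"
          using H by (simp add: q_def ennreal_mult[symmetric] mult.assoc[symmetric])
        also have "\<dots> \<le> ennreal (1 / H) * of_nat K" using m by (intro mult_left_mono) auto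
        also have "\<dots> = ennreal (real K / H)" using H by (simp add: ennreal_of_nat_eq_real_of_nat ennreal_mult[symmetric])
        finally show ?thesis .
      qed
      moreover have "emeasure \<nu> (V m) \<le> emeasure \<nu> (V m \<inter> G \<union> - G)"
        by (intro emeasure_mono) auto
      moreover have "\<dots> \<le> emeasure \<nu> (V m \<inter> G) + emeasure \<nu> (- G)"
        by (intro emeasure_subadditive) auto
      ultimately show ?thesis by (meson add_mono order_trans)
    qed
    have "emeasure \<nu> U = (SUP m. emeasure \<nu> (V m))"
      unfolding UV using inc by (intro SUP_emeasure_incseq[symmetric]) auto
    also have "\<dots> \<le> ennreal H * emeasure lborel U + ennreal (real K / H)"
    proof (rule SUP_least)
      fix m0
      obtain m where "m0 \<le> m" "ennreal (2 ^ m) * q m \<le> of_nat K" using K by blast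
      moreover from this have "emeasure \<nu> (V m0) \<le> emeasure \<nu> (V m)"
        using inc by (intro emeasure_mono) (auto simp: incseq_def)
      ultimately show "emeasure \<nu> (V m0) \<le> ennreal H * emeasure lborel U + ennreal (real K / H)"
        using bd by (blast intro: order_trans)
    qed
    finally show ?thesis .
  qed
  have "emeasure \<nu> N \<le> 0" if N: "N \<in> null_sets lborel" for N
  proof (rule ennreal_le_epsilon)
    fix e :: real assume e: "0 < e"
    define H where "H = 2 * (real K + 1) / e"
    have H: "0 < H" using e by (simp add: H_def)
    have [measurable]: "N \<in> sets borel" using N by auto
    obtain U where U: "open U" "N \<subseteq> U" "emeasure lborel (U - N) < ennreal (e / (2 * H))"
      using outer_regular_lborel[of N "e / (2 * H)"] e H by auto
    have "emeasure lborel U \<le> emeasure lborel (U - N)"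
      using emeasure_Diff_null_set[OF N, of U] U(1) by simp
    with U have L: "emeasure lborel U \<le> ennreal (e / (2 * H))" by simp
    have "emeasure \<nu> N \<le> emeasure \<nu> U" using U by (intro emeasure_mono) auto
    also have "\<dots> \<le> ennreal H * emeasure lborel U + ennreal (real K / H)" by (rule open_bound[OF U(1) H])
    also have "\<dots> \<le> ennreal H * ennreal (e / (2 * H)) + ennreal (e / 2)"
      using L e by (intro add_mono mult_left_mono ennreal_leI) (auto simp: H_def field_simps)
    also have "\<dots> = ennreal e"
    proof -
      have "ennreal H * ennreal (e / (2 * H)) = ennreal (e / 2)"
        using H e by (simp add: ennreal_mult[symmetric])
      moreover have "ennreal (e / 2) + ennreal (e / 2) = ennreal e"
        using e ennreal_plus[of "e / 2" "e / 2"] by simp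
      ultimately show ?thesis by simp
    qed
    finally show "emeasure \<nu> N \<le> 0 + ennreal e" by simp
  qed
  then have "emeasure \<nu> N = 0" "N \<in> sets \<nu>" if "N \<in> null_sets lborel" for N
    using that null_setsD2[OF that] by simp_all
  then show ?thesis
    unfolding absolutely_continuous_def by (intro subsetI null_setsI)
qed

section \<open>Independent identically distributed coordinates\<close>

lemma indep_vars_PiM_coordinates':
  assumes "prob_space \<mu>"
  shows "prob_space.indep_vars (\<Pi>\<^sub>M i\<in>UNIV. \<mu>) (\<lambda>_. \<mu>) (\<lambda>(i::nat) \<omega>. \<omega> i) UNIV"
proof -
  interpret product_prob_space "\<lambda>_. \<mu>" "UNIV :: nat set"
    using assms by (intro product_prob_spaceI)
  have "distr (\<Pi>\<^sub>M i\<in>UNIV. \<mu>) (\<Pi>\<^sub>M i\<in>UNIV. \<mu>) (\<lambda>\<omega>. \<lambda>i\<in>(UNIV :: nat set). \<omega> i) = (\<Pi>\<^sub>M i\<in>UNIV. \<mu>)"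
    by (simp add: restrict_UNIV distr_id2)
  also have "\<dots> = (\<Pi>\<^sub>M i\<in>(UNIV :: nat set). distr (\<Pi>\<^sub>M i\<in>UNIV. \<mu>) \<mu> (\<lambda>\<omega>. \<omega> i))"
    using PiM_component by (intro PiM_cong refl) simp
  finally show ?thesis
    by (subst P.indep_vars_iff_distr_eq_PiM) auto
qed

lemma indep_vars_PiM_coordinates:
  assumes "prob_space \<mu>" and g: "g \<in> borel_measurable \<mu>"
  shows "prob_space.indep_vars (\<Pi>\<^sub>M i\<in>UNIV. \<mu>) (\<lambda>_. borel) (\<lambda>(i::nat) \<omega>. g (\<omega> i)) UNIV"
proof -
  interpret P: prob_space "\<Pi>\<^sub>M i\<in>(UNIV::nat set). \<mu>"
    using assms by (intro prob_space_PiM)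
  show ?thesis
    by (rule P.indep_vars_compose2[OF indep_vars_PiM_coordinates'[OF assms(1)]]) (use g in auto)
qed

lemma distr_PiM_coordinate:
  assumes "prob_space \<mu>" and g: "g \<in> borel_measurable \<mu>"
  shows "distr (\<Pi>\<^sub>M i\<in>UNIV. \<mu>) borel (\<lambda>\<omega>. g (\<omega> (i::nat))) = distr \<mu> borel g"
proof -
  interpret product_prob_space "\<lambda>_. \<mu>" "UNIV :: nat set"
    using assms by (intro product_prob_spaceI)
  show ?thesis
    using g by (subst PiM_component[symmetric, of i], simp, subst distr_distr) (auto simp: comp_def)
qed

lemma integral_PiM_coordinate:
  assumes pr: "prob_space \<mu>" and g[measurable]: "g \<in> borel_measurable \<mu>"
  shows "(LINT \<omega>|(\<Pi>\<^sub>M i\<in>UNIV. \<mu>). g (\<omega> (i::nat))) = (LINT x|\<mu>. (g x :: real))"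
proof -
  have "(LINT \<omega>|(\<Pi>\<^sub>M i\<in>UNIV. \<mu>). g (\<omega> i)) = (LINT x|distr (\<Pi>\<^sub>M i\<in>UNIV. \<mu>) borel (\<lambda>\<omega>. g (\<omega> i)). x)"
    by (subst integral_distr) auto
  also have "\<dots> = (LINT x|\<mu>. g x)"
    unfolding distr_PiM_coordinate[OF assms] by (subst integral_distr) auto
  finally show ?thesis .
qed

lemma AE_PiM_all_coordinates:
  assumes "prob_space \<mu>" "AE x in \<mu>. P x"
  shows "AE \<omega> in (\<Pi>\<^sub>M i\<in>UNIV. \<mu>). \<forall>i::nat. P (\<omega> i)"
  unfolding AE_all_countable using assms by (intro allI AE_PiM_component) auto

text \<open>The partial products grow like exp (n \<kappa>) up to a factor exp (n \<delta>), for all n at the price of the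
  constant N. A bound for all n, instead of eventually, makes the set of such sequences
  an increasing union over N of sets on which all later estimates are uniform.\<close>

definition controlled_growth :: "real \<Rightarrow> real \<Rightarrow> real \<Rightarrow> (nat \<Rightarrow> real) \<Rightarrow> bool" where
  "controlled_growth N \<kappa> \<delta> x \<longleftrightarrow>
     (\<forall>n. exp (real n * (\<kappa> - \<delta>)) \<le> N * (\<Prod>i<n. x i) \<and> (\<Prod>i<n. x i) \<le> N * exp (real n * (\<kappa> + \<delta>)))"

lemma eventually_bounds_imp_bounds_with_constant:
  fixes p lo hi :: "nat \<Rightarrow> real"
  assumes pos: "\<And>n. 0 < p n" "\<And>n. 0 < lo n" "\<And>n. 0 < hi n"
    and ev: "\<forall>\<^sub>F n in sequentially. lo n \<le> p n \<and> p n \<le> hi n"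
  obtains N :: nat where "0 < N" "\<And>n. lo n \<le> real N * p n" "\<And>n. p n \<le> real N * hi n"
proof -
  obtain n0 where n0: "\<And>n. n0 \<le> n \<Longrightarrow> lo n \<le> p n \<and> p n \<le> hi n"
    using ev by (auto simp: eventually_sequentially)
  define c where "c = 1 + (\<Sum>n<n0. lo n / p n + p n / hi n)"
  define N where "N = nat \<lceil>c\<rceil>"
  have terms: "0 < lo n / p n" "0 < p n / hi n" for n using pos by simp_all
  have "1 \<le> c" unfolding c_def using terms by (simp add: sum_nonneg add_nonneg_nonneg less_imp_le)
  have cN: "c \<le> real N" unfolding N_def by linarith
  have small: "lo n / p n \<le> real N" "p n / hi n \<le> real N" for n
  proof -
    have "lo n / p n + p n / hi n \<le> c" if "n < n0"
    proof -
      have "lo n / p n + p n / hi n \<le> (\<Sum>n<n0. lo n / p n + p n / hi n)"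
        using that terms by (intro member_le_sum) (auto simp: add_nonneg_nonneg less_imp_le)
      then show ?thesis by (simp add: c_def)
    qed
    moreover have "lo n / p n \<le> 1" "p n / hi n \<le> 1" if "n0 \<le> n"
      using n0[OF that] pos by simp_all
    ultimately show "lo n / p n \<le> real N" "p n / hi n \<le> real N"
      using cN \<open>1 \<le> c\<close> terms[of n] by (cases "n < n0"; fastforce)+
  qed
  show ?thesis
  proof (rule that[of N])
    show "0 < N" using cN \<open>1 \<le> c\<close> by linarith
  qed (use small pos in \<open>auto simp: field_simps\<close>)
qed

text \<open>The strong law of large numbers for the bounded variables ln x, in the exponential form that
  Hoeffding's inequality and the Borel--Cantelli lemma give.\<close>

lemma AE_controlled_growth:
  fixes \<mu> :: "real measure"
  assumes pr: "prob_space \<mu>" and \<mu>: "sets \<mu> = sets borel" and lo: "0 < lo" "lo < hi"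
    and bd: "AE x in \<mu>. x \<in> {lo..hi}" and \<delta>: "0 < \<delta>"
  shows "AE x in (\<Pi>\<^sub>M i\<in>UNIV. \<mu>). \<exists>N::nat. 0 < N \<and> controlled_growth (real N) (LINT x|\<mu>. ln x) \<delta> x"
proof -
  interpret product_prob_space "\<lambda>_. \<mu>" "UNIV :: nat set"
    using pr by (intro product_prob_spaceI)
  define \<kappa> where "\<kappa> = (LINT x|\<mu>. ln x)"
  have ln_meas: "(\<lambda>x. ln x) \<in> borel_measurable \<mu>" using \<mu> by (simp cong: measurable_cong_sets)
  define A where "A n = {\<omega> \<in> space (\<Pi>\<^sub>M i\<in>UNIV. \<mu>). \<delta> * real n \<le> \<bar>(\<Sum>i<n. ln (\<omega> i)) - real n * \<kappa>\<bar>}" for n :: nat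
  have lnm[measurable]: "(\<lambda>\<omega>. ln (\<omega> i)) \<in> borel_measurable (\<Pi>\<^sub>M i\<in>UNIV. \<mu>)" for i :: nat
    using ln_meas by simp
  have A[measurable]: "A n \<in> sets (\<Pi>\<^sub>M i\<in>UNIV. \<mu>)" for n unfolding A_def by measurable
  define q where "q = exp (- 2 * \<delta>\<^sup>2 / (ln hi - ln lo)\<^sup>2)"
  have d: "ln lo < ln hi" using lo by simp
  have bound: "P.prob (A n) \<le> 2 * q ^ n" for n
  proof (cases "n = 0")
    case True then show ?thesis using P.prob_le_1[of "A 0"] by (auto intro: order_trans)
  next
    case False
    interpret H: Hoeffding_ineq_iid "\<Pi>\<^sub>M i\<in>UNIV. \<mu>" "{..<n}" "\<lambda>(i::nat) \<omega>. ln (\<omega> i)" "\<lambda>\<omega>. ln (\<omega> 0)"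
      "ln lo" "ln hi" \<kappa>
    proof unfold_locales
      show "P.indep_vars (\<lambda>_. borel) (\<lambda>i \<omega>. ln (\<omega> i)) {..<n}"
        by (rule P.indep_vars_subset[OF indep_vars_PiM_coordinates[OF pr ln_meas]]) auto
      show "AE x in (\<Pi>\<^sub>M i\<in>(UNIV::nat set). \<mu>). ln (x 0) \<in> {ln lo..ln hi}"
        using AE_PiM_component[where I="UNIV :: nat set" and i=0, OF pr _ bd] by (rule eventually_mono) (use lo in auto)
      show "\<kappa> \<equiv> P.expectation (\<lambda>\<omega>. ln (\<omega> 0))"
        by (simp add: \<kappa>_def integral_PiM_coordinate[OF pr ln_meas])
    qed (simp_all add: distr_PiM_coordinate[OF pr ln_meas])
    have "P.prob (A n) \<le> 2 * exp (- 2 * (\<delta> * real n)\<^sup>2 / (real n * (ln hi - ln lo)\<^sup>2))"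
      using H.Hoeffding_ineq_abs_ge[of "\<delta> * real n"] False \<delta> d by (simp add: A_def lessThan_empty_iff)
    also have "- 2 * (\<delta> * real n)\<^sup>2 / (real n * (ln hi - ln lo)\<^sup>2) = real n * (- 2 * \<delta>\<^sup>2 / (ln hi - ln lo)\<^sup>2)"
      using False by (simp add: power2_eq_square)
    finally show ?thesis unfolding q_def exp_of_nat_mult .
  qed
  have "q < 1" "0 < q" using \<delta> d by (simp_all add: q_def divide_neg_pos)
  then have "summable (\<lambda>n. 2 * q ^ n)" by (intro summable_mult summable_geometric) simp
  then have "summable (\<lambda>n. P.prob (A n))"
    by (rule summable_comparison_test') (use bound in auto)
  then have "AE \<omega> in (\<Pi>\<^sub>M i\<in>UNIV. \<mu>). \<forall>\<^sub>F n in sequentially. \<omega> \<in> space (\<Pi>\<^sub>M i\<in>UNIV. \<mu>) - A n"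
    by (intro borel_cantelli_AE1) (auto simp: P.emeasure_eq_measure)
  moreover have "AE \<omega> in (\<Pi>\<^sub>M i\<in>UNIV. \<mu>). \<forall>i::nat. \<omega> i \<in> {lo..hi}"
    by (rule AE_PiM_all_coordinates[OF pr bd])
  ultimately show ?thesis
  proof eventually_elim
    case (elim \<omega>)
    have pos: "0 < \<omega> i" for i using elim(2) lo by (metis atLeastAtMost_iff less_le_trans)
    have prod: "(\<Prod>i<n. \<omega> i) = exp (\<Sum>i<n. ln (\<omega> i))" for n
      by (simp add: exp_sum pos)
    have "\<forall>\<^sub>F n in sequentially. exp (real n * (\<kappa> - \<delta>)) \<le> (\<Prod>i<n. \<omega> i) \<and> (\<Prod>i<n. \<omega> i) \<le> exp (real n * (\<kappa> + \<delta>))"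
      using elim(1)
    proof eventually_elim
      case (elim n)
      then have "\<bar>(\<Sum>i<n. ln (\<omega> i)) - real n * \<kappa>\<bar> < \<delta> * real n" by (auto simp: A_def)
      then show ?case unfolding prod by (auto simp: algebra_simps)
    qed
    then obtain N :: nat where "0 < N" "\<And>n. exp (real n * (\<kappa> - \<delta>)) \<le> real N * (\<Prod>i<n. \<omega> i)"
      "\<And>n. (\<Prod>i<n. \<omega> i) \<le> real N * exp (real n * (\<kappa> + \<delta>))"
      using eventually_bounds_imp_bounds_with_constant[of "\<lambda>n. \<Prod>i<n. \<omega> i" "\<lambda>n. exp (real n * (\<kappa> - \<delta>))" "\<lambda>n. exp (real n * (\<kappa> + \<delta>))"]
      using pos by (auto simp: prod_pos)
    then show ?case by (auto simp: controlled_growth_def \<kappa>_def)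
  qed
qed


lemma measurable_shift:
  "(\<lambda>\<omega> i. \<omega> (m + i)) \<in> measurable (\<Pi>\<^sub>M i\<in>(UNIV::nat set). \<mu>) (\<Pi>\<^sub>M i\<in>UNIV. \<mu>)"
  by (intro measurable_abs_UNIV) simp

lemma distr_shift:
  assumes "prob_space \<mu>"
  shows "distr (\<Pi>\<^sub>M i\<in>(UNIV::nat set). \<mu>) (\<Pi>\<^sub>M i\<in>UNIV. \<mu>) (\<lambda>\<omega> i. \<omega> (m + i)) = (\<Pi>\<^sub>M i\<in>UNIV. \<mu>)"
  using distr_PiM_reindex[of UNIV "\<lambda>_. \<mu>" "\<lambda>i. m + i" UNIV] assms by (simp add: restrict_UNIV)

text \<open>The value -1 is arbitrary: any point at which the limit distribution function is positive turns the
  central limit theorem into a uniform lower bound for the probability of a large negative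
  fluctuation.\<close>

lemma std_normal_lower_tail_pos: "0 < measure std_normal_distribution {..- 1}"
proof -
  interpret real_distribution std_normal_distribution by (rule real_dist_normal_dist)
  have "emeasure std_normal_distribution {..- 1} \<noteq> 0"
  proof
    assume "emeasure std_normal_distribution {..- 1} = 0"
    then have "AE x in lborel. ennreal (std_normal_density x) * indicator {..- 1} x = 0"
      by (subst (asm) emeasure_density) (auto simp: nn_integral_0_iff_AE)
    then have "AE x in lborel. x \<notin> {..- 1 :: real}"
      by (rule eventually_mono)
         (use normal_density_pos[of 1 0] in \<open>force simp: less_le split: split_indicator_asm\<close>)
    then have "{..- 1 :: real} \<in> null_sets lborel"
      by (subst AE_iff_null_sets) auto
    then have "emeasure lborel {-2..- 1 :: real} \<le> 0"
      using emeasure_mono[of "{-2..-1 :: real}" "{..-1}" lborel] by auto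
    then show False by simp
  qed
  then show ?thesis by (simp add: emeasure_eq_measure less_le)
qed

lemma centered_walk_lower_tail:
  fixes g :: "'a \<Rightarrow> real"
  assumes pr: "prob_space \<mu>" and g[measurable]: "g \<in> borel_measurable \<mu>"
    and sq: "integrable \<mu> (\<lambda>x. (g x)\<^sup>2)" and mean: "(LINT x|\<mu>. g x) = 0" and var: "0 < (LINT x|\<mu>. (g x)\<^sup>2)"
  obtains c :: real where "0 < c" "\<And>K. \<forall>\<^sub>F n in sequentially.
    c \<le> measure (\<Pi>\<^sub>M i\<in>UNIV. \<mu>) {\<omega> \<in> space (\<Pi>\<^sub>M i\<in>UNIV. \<mu>). (\<Sum>i<n. g (\<omega> (i::nat))) \<le> - K}"
proof -
  interpret P: prob_space "\<Pi>\<^sub>M i\<in>(UNIV::nat set). \<mu>"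
    using assms by (intro prob_space_PiM)
  let ?P = "\<Pi>\<^sub>M i\<in>(UNIV::nat set). \<mu>"
  define \<sigma> where "\<sigma> = sqrt (LINT x|\<mu>. (g x)\<^sup>2)"
  have \<sigma>: "0 < \<sigma>" "\<sigma>\<^sup>2 = (LINT x|\<mu>. (g x)\<^sup>2)" using var by (simp_all add: \<sigma>_def)
  have gi[measurable]: "(\<lambda>\<omega>. g (\<omega> i)) \<in> borel_measurable ?P" for i by measurable
  have g2: "(\<lambda>x. (g x)\<^sup>2) \<in> borel_measurable \<mu>" by measurable
  have sqi: "integrable ?P (\<lambda>\<omega>. (g (\<omega> i))\<^sup>2)" for i
  proof -
    have "integrable (distr \<mu> borel (\<lambda>x. (g x)\<^sup>2)) (\<lambda>x. x)"
      using sq by (subst integrable_distr_eq) auto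
    then show ?thesis
      unfolding distr_PiM_coordinate[OF pr g2, of i, symmetric] by (subst (asm) integrable_distr_eq) auto
  qed
  have "weak_conv_m (\<lambda>n. distr ?P borel (\<lambda>\<omega>. (\<Sum>i<n. g (\<omega> i)) / sqrt (real n * \<sigma>\<^sup>2))) std_normal_distribution"
  proof (rule P.central_limit_theorem_zero_mean[where \<mu> = "distr \<mu> borel g"])
    show "P.indep_vars (\<lambda>i. borel) (\<lambda>i \<omega>. g (\<omega> i)) UNIV" by (rule indep_vars_PiM_coordinates[OF pr g])
    show e0: "P.expectation (\<lambda>\<omega>. g (\<omega> n)) = 0" for n
      using mean by (simp add: integral_PiM_coordinate[OF pr g])
    show "P.variance (\<lambda>\<omega>. g (\<omega> n)) = \<sigma>\<^sup>2" for n
      by (simp add: e0 \<sigma>(2) integral_PiM_coordinate[OF pr g2])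
  qed (use \<sigma> sqi distr_PiM_coordinate[OF pr g] in auto)
  moreover have "isCont (cdf std_normal_distribution) (-1)"
  proof -
    interpret N: real_distribution std_normal_distribution by (rule real_dist_normal_dist)
    have "emeasure std_normal_distribution {-1} = 0"
      by (subst emeasure_density) (auto simp: nn_integral_0_iff_AE AE_lborel_singleton intro!: eventually_mono[OF AE_lborel_singleton[of "-1::real"]])
    then show ?thesis by (simp add: N.isCont_cdf N.emeasure_eq_measure)
  qed
  ultimately have lim: "(\<lambda>n. cdf (distr ?P borel (\<lambda>\<omega>. (\<Sum>i<n. g (\<omega> i)) / sqrt (real n * \<sigma>\<^sup>2))) (-1))
      \<longlonglongrightarrow> cdf std_normal_distribution (-1)"
    by (auto simp: weak_conv_m_def weak_conv_def)
  define p where "p = cdf std_normal_distribution (-1)"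
  have p: "0 < p" using std_normal_lower_tail_pos by (simp add: p_def cdf_def)
  show thesis
  proof (rule that[of "p / 2"])
    fix K :: real
    have "\<forall>\<^sub>F n in sequentially. p / 2 < cdf (distr ?P borel (\<lambda>\<omega>. (\<Sum>i<n. g (\<omega> i)) / sqrt (real n * \<sigma>\<^sup>2))) (-1)"
      using lim p unfolding p_def[symmetric] by (intro order_tendstoD) auto
    moreover have "filterlim (\<lambda>n. sqrt (real n * \<sigma>\<^sup>2)) at_top sequentially"
      using \<sigma>(1) by (intro filterlim_compose[OF sqrt_at_top] filterlim_at_top_mult_tendsto_pos[OF tendsto_const _ filterlim_real_sequentially]) auto
    then have "\<forall>\<^sub>F n in sequentially. max 1 K \<le> sqrt (real n * \<sigma>\<^sup>2)"
      unfolding filterlim_at_top by blast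
    ultimately show "\<forall>\<^sub>F n in sequentially. p / 2 \<le> P.prob {\<omega> \<in> space ?P. (\<Sum>i<n. g (\<omega> i)) \<le> - K}"
    proof eventually_elim
      case (elim n)
      define s where "s = sqrt (real n * \<sigma>\<^sup>2)"
      have s: "1 \<le> s" "K \<le> s" using elim(2) by (simp_all add: s_def)
      have "cdf (distr ?P borel (\<lambda>\<omega>. (\<Sum>i<n. g (\<omega> i)) / s)) (-1) = P.prob {\<omega> \<in> space ?P. (\<Sum>i<n. g (\<omega> i)) / s \<le> -1}"
        unfolding cdf_def by (subst measure_distr) (auto intro!: arg_cong[where f=P.prob])
      also have "\<dots> \<le> P.prob {\<omega> \<in> space ?P. (\<Sum>i<n. g (\<omega> i)) \<le> - K}"
        using s by (intro P.finite_measure_mono) (auto simp: field_simps)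
      finally show ?case using elim(1) by (simp add: s_def)
    qed
  qed (use p in simp)
qed

lemma sigma_algebra_coordinate_events:
  "sigma_algebra (space (\<Pi>\<^sub>M i\<in>(UNIV::nat set). \<mu>)) {(\<lambda>\<omega>. \<omega> i) -` B \<inter> space (\<Pi>\<^sub>M i\<in>(UNIV::nat set). \<mu>) |B. B \<in> sets \<mu>}"
proof -
  let ?V = "vimage_algebra (space (\<Pi>\<^sub>M i\<in>(UNIV::nat set). \<mu>)) (\<lambda>\<omega>. \<omega> i) \<mu>"
  have "sets ?V = {(\<lambda>\<omega>. \<omega> i) -` B \<inter> space (\<Pi>\<^sub>M i\<in>(UNIV::nat set). \<mu>) |B. B \<in> sets \<mu>}"
    by (rule sets_vimage_algebra2) (auto simp: space_PiM)
  then show ?thesis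
    using sets.sigma_algebra_axioms[of ?V] by simp
qed

text \<open>An event that can be expressed through the coordinates from m on, for every m, is a tail event of the
  independent coordinates, so Kolmogorov's zero-one law applies.\<close>

lemma shift_invariant_event_prob_0_or_1:
  assumes pr: "prob_space \<mu>"
    and T: "\<And>m. \<exists>B\<in>sets (\<Pi>\<^sub>M i\<in>(UNIV::nat set). \<mu>).
              T = (\<lambda>\<omega> i. \<omega> (m + i)) -` B \<inter> space (\<Pi>\<^sub>M i\<in>(UNIV::nat set). \<mu>)"
  shows "measure (\<Pi>\<^sub>M i\<in>(UNIV::nat set). \<mu>) T = 0 \<or> measure (\<Pi>\<^sub>M i\<in>(UNIV::nat set). \<mu>) T = 1"
proof -
  let ?P = "\<Pi>\<^sub>M i\<in>(UNIV::nat set). \<mu>"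
  interpret P: prob_space ?P using pr by (intro prob_space_PiM)
  define A where "A i = {(\<lambda>\<omega>. \<omega> i) -` B \<inter> space ?P |B. B \<in> sets \<mu>}" for i :: nat
  have sub: "A i \<subseteq> Pow (space ?P)" for i by (auto simp: A_def)
  show ?thesis
  proof (rule P.kolmogorov_0_1_law[of A])
    show "sigma_algebra (space ?P) (A i)" for i
      unfolding A_def by (rule sigma_algebra_coordinate_events)
    show "P.indep_sets A UNIV"
      using indep_vars_PiM_coordinates'[OF pr] unfolding P.indep_vars_def2 A_def by blast
    show "T \<in> P.tail_events A"
      unfolding P.tail_events_def
    proof
      fix m :: nat
      define N where "N = sigma (space ?P) (\<Union>(A ` {m..}))"
      have N: "sets N = sigma_sets (space ?P) (\<Union>(A ` {m..}))" "space N = space ?P"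
        unfolding N_def using sub by (auto intro!: sets_measure_of space_measure_of)
      have "(\<lambda>\<omega>. \<omega> (m + i)) \<in> measurable N \<mu>" for i
      proof (rule measurableI)
        fix B assume "B \<in> sets \<mu>"
        then have "(\<lambda>\<omega>. \<omega> (m + i)) -` B \<inter> space N \<in> \<Union>(A ` {m..})"
          unfolding N A_def by force
        then show "(\<lambda>\<omega>. \<omega> (m + i)) -` B \<inter> space N \<in> sets N"
          unfolding N(1) by (rule sigma_sets.Basic)
      qed (auto simp: N space_PiM)
      then have "(\<lambda>\<omega> i. \<omega> (m + i)) \<in> measurable N ?P"
        by (intro measurable_abs_UNIV)
      moreover obtain B where "B \<in> sets ?P" "T = (\<lambda>\<omega> i. \<omega> (m + i)) -` B \<inter> space ?P"
        using T by blast
      ultimately show "T \<in> sigma_sets (space ?P) (\<Union>(A ` {m..}))"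
        using measurable_sets[of "\<lambda>\<omega> i. \<omega> (m + i)" N ?P B] by (simp add: N)
    qed
  qed
qed

lemma (in prob_space) prob_infinitely_often_ge:
  assumes [measurable]: "\<And>k. B k \<in> events" and c: "\<And>k. c \<le> prob (B k)"
  shows "c \<le> prob {\<omega> \<in> space M. \<exists>\<^sub>F k in sequentially. \<omega> \<in> B k}"
proof -
  have "(\<lambda>K. prob (\<Union>k\<in>{K..}. B k)) \<longlonglongrightarrow> prob (\<Inter>K. \<Union>k\<in>{K..}. B k)"
    by (intro finite_Lim_measure_decseq) (auto simp: decseq_def intro: order_trans)
  moreover have "c \<le> prob (\<Union>k\<in>{K..}. B k)" for K
    using c[of K] by (rule order_trans) (auto intro!: finite_measure_mono)
  ultimately have "c \<le> prob (\<Inter>K. \<Union>k\<in>{K..}. B k)" by (intro LIMSEQ_le_const) auto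
  also have "(\<Inter>K. \<Union>k\<in>{K..}. B k) = {\<omega> \<in> space M. \<exists>\<^sub>F k in sequentially. \<omega> \<in> B k}"
    using sets.sets_into_space[OF assms(1)] by (auto simp: frequently_sequentially, blast)
  finally show ?thesis .
qed

text \<open>The times are chosen sparse enough that at each of them the walk is below -2k - L with probability at
  least c, where L bounds the functional h of the future with probability at least 1 - c / 2. The
  event that this happens for infinitely many k then has positive probability. Whether
  W + h + k has liminf minus infinity along these times does not depend on the first m coordinates,
  because changing them shifts W by a constant; so its probability is 1.\<close>

lemma centered_walk_below_io:
  fixes g :: "'a \<Rightarrow> real" and h :: "(nat \<Rightarrow> 'a) \<Rightarrow> real"
  assumes pr: "prob_space \<mu>" and g[measurable]: "g \<in> borel_measurable \<mu>"
    and sq: "integrable \<mu> (\<lambda>x. (g x)\<^sup>2)" and mean: "(LINT x|\<mu>. g x) = 0" and var: "0 < (LINT x|\<mu>. (g x)\<^sup>2)"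
    and h[measurable]: "h \<in> borel_measurable (\<Pi>\<^sub>M i\<in>UNIV. \<mu>)"
  obtains n :: "nat \<Rightarrow> nat" where
    "AE \<omega> in (\<Pi>\<^sub>M i\<in>UNIV. \<mu>). \<exists>\<^sub>F k in sequentially. (\<Sum>i<n k. g (\<omega> i)) + h (\<lambda>i. \<omega> (n k + i)) \<le> - real k"
proof -
  let ?P = "\<Pi>\<^sub>M i\<in>(UNIV::nat set). \<mu>"
  interpret P: prob_space ?P using pr by (intro prob_space_PiM)
  have gm[measurable]: "(\<lambda>\<omega>. g (\<omega> i)) \<in> borel_measurable ?P" for i by measurable
  have hm[measurable]: "(\<lambda>\<omega>. h (\<lambda>i. \<omega> (m + i))) \<in> borel_measurable ?P" for m
    by (rule measurable_compose[OF measurable_shift h])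
  obtain c where c: "0 < c" "\<And>K. \<forall>\<^sub>F n in sequentially. c \<le> P.prob {\<omega> \<in> space ?P. (\<Sum>i<n. g (\<omega> i)) \<le> - K}"
    using centered_walk_lower_tail[OF pr g sq mean var] by blast
  have "(\<lambda>K. P.prob {\<omega> \<in> space ?P. real K < h \<omega>}) \<longlonglongrightarrow> P.prob (\<Inter>K. {\<omega> \<in> space ?P. real K < h \<omega>})"
    by (intro P.finite_Lim_measure_decseq) (auto simp: decseq_def)
  moreover have "(\<Inter>K. {\<omega> \<in> space ?P. real K < h \<omega>}) = {}"
  proof -
    have "\<exists>K. \<not> real K < h \<omega>" for \<omega> using reals_Archimedean2[of "h \<omega>"] by (metis less_asym)
    then show ?thesis by blast
  qed
  ultimately have "(\<lambda>K. P.prob {\<omega> \<in> space ?P. real K < h \<omega>}) \<longlonglongrightarrow> 0" by simp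
  then have "\<forall>\<^sub>F K in sequentially. P.prob {\<omega> \<in> space ?P. real K < h \<omega>} < c / 2"
    using c by (intro order_tendstoD) auto
  then obtain L :: nat where L: "P.prob {\<omega> \<in> space ?P. real L < h \<omega>} < c / 2"
    using eventually_happens'[OF sequentially_bot] by blast
  have Lshift: "P.prob {\<omega> \<in> space ?P. real L < h (\<lambda>i. \<omega> (m + i))} < c / 2" for m
  proof -
    have "P.prob {\<omega> \<in> space ?P. real L < h \<omega>} = measure (distr ?P ?P (\<lambda>\<omega> i. \<omega> (m + i))) {\<omega> \<in> space ?P. real L < h \<omega>}"
      by (simp add: distr_shift[OF pr])
    also have "\<dots> = P.prob {\<omega> \<in> space ?P. real L < h (\<lambda>i. \<omega> (m + i))}"
    proof (subst measure_distr[OF measurable_shift])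
      show "{\<omega> \<in> space ?P. real L < h \<omega>} \<in> sets ?P" by measurable
    qed (auto intro!: arg_cong[where f=P.prob] simp: space_PiM)
    finally show ?thesis using L by simp
  qed
  \<comment> \<open>The margin 2k leaves -k after adding k to the walk, so that e below is at most -k.\<close>
  define R where "R k n \<longleftrightarrow> k \<le> n \<and> c \<le> P.prob {\<omega> \<in> space ?P. (\<Sum>i<n. g (\<omega> i)) \<le> - (2 * real k + real L)}"
    for k n :: nat
  have "\<forall>k. \<exists>n. R k n"
    using c(2) unfolding R_def eventually_sequentially by (meson nle_le)
  then obtain n where "\<And>k. R k (n k)" by (rule choice[THEN exE]) blast
  then have n: "\<And>k. k \<le> n k"
    "\<And>k. c \<le> P.prob {\<omega> \<in> space ?P. (\<Sum>i<n k. g (\<omega> i)) \<le> - (2 * real k + real L)}"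
    unfolding R_def by blast+
  define e where "e k \<omega> = (\<Sum>i<n k. g (\<omega> i)) + h (\<lambda>i. \<omega> (n k + i)) + real k" for k \<omega>
  define B where "B k = {\<omega> \<in> space ?P. e k \<omega> \<le> - real k}" for k
  have [measurable]: "e k \<in> borel_measurable ?P" for k unfolding e_def by measurable
  have Bm[measurable, simp]: "B k \<in> sets ?P" for k unfolding B_def by measurable
  have Bc: "c / 2 \<le> P.prob (B k)" for k
  proof -
    have "c \<le> P.prob {\<omega> \<in> space ?P. (\<Sum>i<n k. g (\<omega> i)) \<le> - (2 * real k + real L)}" by (rule n)
    also have "\<dots> \<le> P.prob (B k \<union> {\<omega> \<in> space ?P. real L < h (\<lambda>i. \<omega> (n k + i))})"
      by (intro P.finite_measure_mono) (auto simp: B_def e_def)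
    also have "\<dots> \<le> P.prob (B k) + P.prob {\<omega> \<in> space ?P. real L < h (\<lambda>i. \<omega> (n k + i))}"
      by (intro measure_Un_le) auto
    finally show ?thesis using Lshift[of "n k"] by simp
  qed
  define T where "T = {\<omega> \<in> space ?P. \<forall>j::nat. \<exists>\<^sub>F k in sequentially. e k \<omega> \<le> - real j}"
  have "{\<omega> \<in> space ?P. \<exists>\<^sub>F k in sequentially. \<omega> \<in> B k} \<subseteq> T"
  proof safe
    fix \<omega> assume w: "\<omega> \<in> space ?P" "\<exists>\<^sub>F k in sequentially. \<omega> \<in> B k"
    have "\<exists>\<^sub>F k in sequentially. e k \<omega> \<le> - real j" for j
      using frequently_eventually_frequently[OF w(2) eventually_ge_at_top[of j]]
      by (rule frequently_elim1) (auto simp: B_def)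
    then show "\<omega> \<in> T" using w by (simp add: T_def)
  qed
  moreover have T_meas[measurable]: "T \<in> sets ?P" unfolding T_def frequently_sequentially by measurable
  ultimately have "P.prob {\<omega> \<in> space ?P. \<exists>\<^sub>F k in sequentially. \<omega> \<in> B k} \<le> P.prob T"
    by (intro P.finite_measure_mono)
  moreover have "c / 2 \<le> P.prob {\<omega> \<in> space ?P. \<exists>\<^sub>F k in sequentially. \<omega> \<in> B k}"
    by (rule P.prob_infinitely_often_ge[OF Bm Bc])
  ultimately have "c / 2 \<le> P.prob T" by linarith
  moreover have "P.prob T = 0 \<or> P.prob T = 1"
  proof (rule shift_invariant_event_prob_0_or_1[OF pr])
    fix m :: nat
    define f where "f k \<omega> = (\<Sum>i<n k - m. g (\<omega> i)) + h (\<lambda>i. \<omega> (n k - m + i)) + real k" for k \<omega>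
    have [measurable]: "f k \<in> borel_measurable ?P" for k unfolding f_def by measurable
    define Tm where "Tm = {\<omega> \<in> space ?P. \<forall>j::nat. \<exists>\<^sub>F k in sequentially. f k \<omega> \<le> - real j}"
    have "Tm \<in> sets ?P" unfolding Tm_def frequently_sequentially by measurable
    moreover have "T = (\<lambda>\<omega> i. \<omega> (m + i)) -` Tm \<inter> space ?P"
    proof -
      have ef: "e k \<omega> = (\<Sum>i<m. g (\<omega> i)) + f k (\<lambda>i. \<omega> (m + i))" if "m \<le> k" for k \<omega>
      proof -
        have m: "m \<le> n k" using that n(1)[of k] by simp
        have "(\<Sum>i<n k. g (\<omega> i)) = (\<Sum>i<m. g (\<omega> i)) + (\<Sum>i<n k - m. g (\<omega> (m + i)))"
          using sum.atLeastLessThan_concat[of 0 m "n k" "\<lambda>i. g (\<omega> i)"] m sum.shift_bounds_nat_ivl[of "\<lambda>i. g (\<omega> i)" 0 m "n k - m"]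
          by (simp add: atLeast0LessThan add.commute)
        then show ?thesis using m by (simp add: e_def f_def add.assoc[symmetric])
      qed
      have "(\<forall>j::nat. \<exists>\<^sub>F k in sequentially. e k \<omega> \<le> - real j) \<longleftrightarrow>
            (\<forall>j::nat. \<exists>\<^sub>F k in sequentially. f k (\<lambda>i. \<omega> (m + i)) \<le> - real j)" (is "?l \<longleftrightarrow> ?r") for \<omega>
      proof
        assume l: ?l
        show ?r
        proof
          fix j :: nat
          obtain j' :: nat where j': "real j - (\<Sum>i<m. g (\<omega> i)) \<le> real j'" using real_arch_simple by blast
          from l have "\<exists>\<^sub>F k in sequentially. e k \<omega> \<le> - real j'" by blast
          from frequently_eventually_frequently[OF this eventually_ge_at_top[of m]]
          show "\<exists>\<^sub>F k in sequentially. f k (\<lambda>i. \<omega> (m + i)) \<le> - real j"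
            by (rule frequently_elim1) (use j' ef in force)
        qed
      next
        assume r: ?r
        show ?l
        proof
          fix j :: nat
          obtain j' :: nat where j': "real j + (\<Sum>i<m. g (\<omega> i)) \<le> real j'" using real_arch_simple by blast
          from r have "\<exists>\<^sub>F k in sequentially. f k (\<lambda>i. \<omega> (m + i)) \<le> - real j'" by blast
          from frequently_eventually_frequently[OF this eventually_ge_at_top[of m]]
          show "\<exists>\<^sub>F k in sequentially. e k \<omega> \<le> - real j"
            by (rule frequently_elim1) (use j' ef in force)
        qed
      qed
      then show ?thesis by (auto simp: T_def Tm_def space_PiM)
    qed
    ultimately show "\<exists>B\<in>sets ?P. T = (\<lambda>\<omega> i. \<omega> (m + i)) -` B \<inter> space ?P" by blast
  qed
  ultimately have "P.prob T = 1" using c by auto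
  then have "AE \<omega> in ?P. \<omega> \<in> T" using P.prob_eq_1[OF T_meas] by simp
  then have "AE \<omega> in ?P. \<exists>\<^sub>F k in sequentially. (\<Sum>i<n k. g (\<omega> i)) + h (\<lambda>i. \<omega> (n k + i)) \<le> - real k"
  proof (rule eventually_mono)
    fix \<omega> assume "\<omega> \<in> T"
    then have "\<exists>\<^sub>F k in sequentially. e k \<omega> \<le> - real 0" unfolding T_def by blast
    then show "\<exists>\<^sub>F k in sequentially. (\<Sum>i<n k. g (\<omega> i)) + h (\<lambda>i. \<omega> (n k + i)) \<le> - real k"
      by (rule frequently_elim1) (simp add: e_def)
  qed
  then show thesis by (rule that)
qed

section \<open>The random sum as a function of signs and errors\<close>

definition partial_sum :: "nat \<Rightarrow> (nat \<Rightarrow> real) \<Rightarrow> (nat \<Rightarrow> real) \<Rightarrow> real" where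
  "partial_sum n l y = 1 + (\<Sum>k<n. \<Prod>i\<le>k. l i * y i)"

lemma borel_measurable_random_sum:
  assumes f: "\<And>i. (\<lambda>x. f x i) \<in> borel_measurable M" and g: "\<And>i. (\<lambda>x. g x i) \<in> borel_measurable M"
  shows "(\<lambda>x. random_sum (f x) (g x)) \<in> borel_measurable M"
  unfolding random_sum_def using f g by measurable

lemma controlled_growth_prod_pos:
  assumes "controlled_growth N \<kappa> \<delta> x" "0 < N"
  shows "0 < (\<Prod>i<n. x i)"
proof -
  have "0 < exp (real n * (\<kappa> - \<delta>))" by simp
  also have "\<dots> \<le> N * (\<Prod>i<n. x i)" using assms by (simp add: controlled_growth_def)
  finally show ?thesis using assms by (simp add: zero_less_mult_iff)
qed

lemma controlled_growth_nonzero: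
  assumes "controlled_growth N \<kappa> \<delta> x" "0 < N"
  shows "x i \<noteq> 0"
  using controlled_growth_prod_pos[OF assms, of "Suc i"] by auto

text \<open>The rate is doubled in \<delta> because signs and errors each contribute one factor exp (n \<delta>).\<close>

lemma controlled_products_le:
  assumes l: "controlled_growth N \<kappa> \<delta> l" "0 < N" and y: "controlled_growth N 0 \<delta> y"
  shows "(\<Prod>i<n. l i * y i) \<le> N\<^sup>2 * exp (\<kappa> + 2 * \<delta>) ^ n"
proof -
  have "(\<Prod>i<n. l i * y i) = (\<Prod>i<n. l i) * (\<Prod>i<n. y i)" by (rule prod.distrib)
  also have "\<dots> \<le> (N * exp (real n * (\<kappa> + \<delta>))) * (N * exp (real n * (0 + \<delta>)))"
    using l y controlled_growth_prod_pos[OF l] controlled_growth_prod_pos[OF y l(2)]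
    by (intro mult_mono) (auto simp: controlled_growth_def less_imp_le)
  also have "\<dots> = N\<^sup>2 * exp (real n * (\<kappa> + 2 * \<delta>))"
    by (simp add: power2_eq_square exp_add[symmetric] algebra_simps)
  finally show ?thesis by (simp add: exp_of_nat_mult)
qed

lemma controlled_products_pos:
  assumes l: "controlled_growth N \<kappa> \<delta> l" "0 < N" and y: "controlled_growth N 0 \<delta> y"
  shows "0 < (\<Prod>i<n. l i * y i)"
  using controlled_growth_prod_pos[OF l] controlled_growth_prod_pos[OF y l(2)] by (simp add: prod.distrib)

lemma summable_controlled_products:
  assumes l: "controlled_growth N \<kappa> \<delta> l" "0 < N" and y: "controlled_growth N 0 \<delta> y"
    and neg: "\<kappa> + 2 * \<delta> < 0"
  shows "summable (\<lambda>k. \<Prod>i\<le>k. l i * y i)"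
proof (rule summable_comparison_test')
  show "summable (\<lambda>k. N\<^sup>2 * exp (\<kappa> + 2 * \<delta>) ^ Suc k)"
    using neg unfolding summable_Suc_iff by (intro summable_mult summable_geometric) simp
  show "norm (\<Prod>i\<le>k. l i * y i) \<le> N\<^sup>2 * exp (\<kappa> + 2 * \<delta>) ^ Suc k" for k
    using controlled_products_le[OF assms(1-3), of "Suc k"] controlled_products_pos[OF assms(1-3), of "Suc k"]
    unfolding lessThan_Suc_atMost by (simp add: less_imp_le)
qed

lemma random_sum_tail_le:
  assumes l: "controlled_growth N \<kappa> \<delta> l" "0 < N" and y: "controlled_growth N 0 \<delta> y"
    and neg: "\<kappa> + 2 * \<delta> < 0"
  shows "\<bar>random_sum l y - partial_sum n l y\<bar> \<le> N\<^sup>2 / (1 - exp (\<kappa> + 2 * \<delta>)) * exp (\<kappa> + 2 * \<delta>) ^ n"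
proof -
  define q where "q = exp (\<kappa> + 2 * \<delta>)"
  have q: "0 < q" "q < 1" using neg by (simp_all add: q_def)
  let ?f = "\<lambda>k. \<Prod>i\<le>k. l i * y i"
  have f: "summable ?f" by (rule summable_controlled_products[OF assms])
  have "random_sum l y - partial_sum n l y = (\<Sum>k. ?f (k + n))"
    using suminf_split_initial_segment[OF f, of n] by (simp add: random_sum_def partial_sum_def)
  also have "\<bar>\<dots>\<bar> \<le> (\<Sum>k. N\<^sup>2 * q ^ Suc n * q ^ k)"
  proof -
    have le: "\<bar>?f (k + n)\<bar> \<le> N\<^sup>2 * q ^ Suc n * q ^ k" for k
      using controlled_products_le[OF assms(1-3), of "Suc (k + n)"] controlled_products_pos[OF assms(1-3), of "Suc (k + n)"]
      unfolding lessThan_Suc_atMost q_def[symmetric] by (simp add: power_add mult_ac)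
    have s: "summable (\<lambda>k. N\<^sup>2 * q ^ Suc n * q ^ k)"
      using q by (intro summable_mult summable_geometric) simp
    show ?thesis
      using norm_suminf_le[OF _ s, of "\<lambda>k. ?f (k + n)"] le by simp
  qed
  also have "\<dots> = N\<^sup>2 * q ^ Suc n / (1 - q)"
    using q by (subst suminf_mult) (auto simp: suminf_geometric)
  also have "\<dots> \<le> N\<^sup>2 / (1 - q) * q ^ n"
    using q by (simp add: divide_right_mono mult_left_mono mult_le_one less_imp_le)
  finally show ?thesis by (simp add: q_def)
qed

lemma prod_lessThan_add: "(\<Prod>i<n + m. f i) = (\<Prod>i<n. f i) * (\<Prod>i<m. f (n + i :: nat))"
  by (induction m) (simp_all add: mult.assoc)

lemma random_sum_split:
  assumes "summable (\<lambda>k. \<Prod>i\<le>k. l i * y i)" and nz: "(\<Prod>i<n. l i * y i) \<noteq> 0"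
  shows "random_sum l y = partial_sum n l y
           + (\<Prod>i<n. l i * y i) * (random_sum (\<lambda>i. l (n + i)) (\<lambda>i. y (n + i)) - 1)"
    and "summable (\<lambda>k. \<Prod>i\<le>k. l (n + i) * y (n + i))"
proof -
  let ?f = "\<lambda>k. \<Prod>i\<le>k. l i * y i"
  let ?p = "\<Prod>i<n. l i * y i"
  let ?g = "\<lambda>k. \<Prod>i\<le>k. l (n + i) * y (n + i)"
  have fg: "?f (k + n) = ?p * ?g k" for k
  proof -
    have "?f (k + n) = (\<Prod>i<n + Suc k. l i * y i)" by (simp add: lessThan_Suc_atMost add.commute)
    also have "\<dots> = ?p * (\<Prod>i<Suc k. l (n + i) * y (n + i))" by (rule prod_lessThan_add)
    finally show ?thesis by (simp only: lessThan_Suc_atMost)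
  qed
  have "summable (\<lambda>k. ?f (k + n))" using assms(1) by (rule summable_ignore_initial_segment)
  then show g: "summable ?g" unfolding fg using nz by (simp add: summable_cmult_iff)
  show "random_sum l y = partial_sum n l y + ?p * (random_sum (\<lambda>i. l (n + i)) (\<lambda>i. y (n + i)) - 1)"
    using suminf_split_initial_segment[OF assms(1), of n] suminf_mult[OF g, of ?p]
    by (simp add: random_sum_def partial_sum_def fg)
qed

lemma random_sum_unfold:
  assumes "summable (\<lambda>k. \<Prod>i\<le>k. l i * y i)" "l 0 * y 0 \<noteq> 0"
  shows "random_sum l y = 1 + l 0 * y 0 * random_sum (\<lambda>i. l (Suc i)) (\<lambda>i. y (Suc i))"
  using random_sum_split(1)[of l y 1] assms by (simp add: partial_sum_def algebra_simps)

text \<open>Two steps of the recursion X = 1 + z X' are taken after the common prefix. The first one only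
  shows the constant difference of the signs at n, multiplied by the error at n; the second
  exposes the error at position n + 1, on which the remaining sums do not depend.\<close>

lemma random_sum_diff_common_prefix:
  assumes l: "summable (\<lambda>k. \<Prod>i\<le>k. l i * y i)" "\<And>i. l i \<noteq> 0"
    and l': "summable (\<lambda>k. \<Prod>i\<le>k. l' i * y i)" "\<And>i. l' i \<noteq> 0"
    and y: "\<And>i. y i \<noteq> 0"
    and agree: "\<And>i. i < n \<Longrightarrow> l i = l' i"
  shows "random_sum l y - random_sum l' y =
    (\<Prod>i<n. l i) * (\<Prod>i<Suc n. y i) *
      ((l n - l' n) + y (Suc n) *
        (l n * l (Suc n) * random_sum (\<lambda>i. l (n + 2 + i)) (\<lambda>i. y (n + 2 + i))
         - l' n * l' (Suc n) * random_sum (\<lambda>i. l' (n + 2 + i)) (\<lambda>i. y (n + 2 + i))))"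
proof -
  have expand: "random_sum m y = partial_sum n m y + (\<Prod>i<n. m i) * (\<Prod>i<n. y i) *
      (m n * y n * (1 + m (Suc n) * y (Suc n) * random_sum (\<lambda>i. m (n + 2 + i)) (\<lambda>i. y (n + 2 + i))))"
    if s: "summable (\<lambda>k. \<Prod>i\<le>k. m i * y i)" and nz: "\<And>i. m i \<noteq> 0" for m :: "nat \<Rightarrow> real"
  proof -
    have "(\<Prod>i<j. m i * y i) \<noteq> 0" for j using nz y by (simp add: prod_zero_iff)
    note sp = random_sum_split[OF s this]
    have "random_sum (\<lambda>i. m (n + i)) (\<lambda>i. y (n + i)) = 1 + m n * y n * random_sum (\<lambda>i. m (Suc n + i)) (\<lambda>i. y (Suc n + i))"
      using random_sum_unfold[OF sp(2)[of n]] nz y by simp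
    moreover have "random_sum (\<lambda>i. m (Suc n + i)) (\<lambda>i. y (Suc n + i)) =
        1 + m (Suc n) * y (Suc n) * random_sum (\<lambda>i. m (n + 2 + i)) (\<lambda>i. y (n + 2 + i))"
      using random_sum_unfold[OF sp(2)[of "Suc n"]] nz y by simp
    ultimately show ?thesis
      using sp(1)[of n] by (simp add: prod.distrib)
  qed
  have "partial_sum n l y = partial_sum n l' y"
    unfolding partial_sum_def using agree by (intro arg_cong2[where f="(+)"] sum.cong prod.cong refl) auto
  moreover have "(\<Prod>i<n. l' i) = (\<Prod>i<n. l i)" using agree by (intro prod.cong) auto
  ultimately show ?thesis
    unfolding expand[OF l] expand[OF l'] by (simp add: algebra_simps)
qed

text \<open>If |v| hi < b / 2 and \<rho> \<le> b / 2, the constant d dominates and the event is null. Otherwise |v| is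
  bounded below and the event is an interval of length at most 4 \<rho> hi / b. For \<rho> > b / 2 the bound
  exceeds 1.\<close>

lemma affine_small_ball:
  fixes \<eta> :: "real measure"
  assumes pr: "prob_space \<eta>" and [measurable_cong, simp]: "sets \<eta> = sets borel"
    and hi: "0 < lo" "lo \<le> hi" and bd: "AE t in \<eta>. t \<in> {lo..hi}"
    and C: "0 \<le> C" "\<And>B. B \<in> sets borel \<Longrightarrow> emeasure \<eta> B \<le> ennreal C * emeasure lborel B"
    and b: "0 < b" "b \<le> \<bar>d\<bar>" and \<rho>: "0 < \<rho>"
  shows "emeasure \<eta> {t. \<bar>d + t * v\<bar> \<le> \<rho>} \<le> ennreal ((4 * C * hi + 2) / b * \<rho>)"
proof -
  interpret prob_space \<eta> by fact
  have [simp]: "space \<eta> = UNIV" using sets_eq_imp_space_eq[of \<eta> borel] by simp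
  have meas: "{t. \<bar>d + t * v\<bar> \<le> \<rho>} \<in> sets \<eta>" by simp
  consider "b / 2 < \<rho>" | "\<rho> \<le> b / 2" "\<bar>v\<bar> * hi < b / 2" | "\<rho> \<le> b / 2" "b / 2 \<le> \<bar>v\<bar> * hi" by linarith
  then show ?thesis
  proof cases
    case 1
    have "1 \<le> 2 / b * \<rho>" using 1 b by (simp add: field_simps)
    also have "\<dots> \<le> (4 * C * hi + 2) / b * \<rho>"
      using C(1) hi b \<rho> by (intro mult_right_mono divide_right_mono) auto
    finally have "1 \<le> ennreal ((4 * C * hi + 2) / b * \<rho>)" by simp
    then show ?thesis
      using emeasure_le_1[of "{t. \<bar>d + t * v\<bar> \<le> \<rho>}"] by (rule order_trans[rotated])
  next
    case 2
    have "AE t in \<eta>. t \<notin> {t. \<bar>d + t * v\<bar> \<le> \<rho>}"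
      using bd
    proof eventually_elim
      case (elim t)
      have "\<bar>t * v\<bar> \<le> hi * \<bar>v\<bar>" using elim hi by (auto simp: abs_mult intro!: mult_right_mono)
      then have "\<bar>t * v\<bar> < b / 2" using 2 by (simp add: mult.commute)
      then show ?case using 2 b by auto
    qed
    then have "emeasure \<eta> {t. \<bar>d + t * v\<bar> \<le> \<rho>} = 0"
      using AE_iff_null_sets[OF meas] by auto
    then show ?thesis by simp
  next
    case 3
    then have v: "0 < \<bar>v\<bar>" using b hi by (cases "v = 0") auto
    have "{t. \<bar>d + t * v\<bar> \<le> \<rho>} \<subseteq> {- d / v - \<rho> / \<bar>v\<bar> .. - d / v + \<rho> / \<bar>v\<bar>}"
    proof
      fix t assume "t \<in> {t. \<bar>d + t * v\<bar> \<le> \<rho>}"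
      moreover have "d + t * v = v * (t - - d / v)" using v by (simp add: field_simps)
      ultimately have "\<bar>v\<bar> * \<bar>t - - d / v\<bar> \<le> \<rho>" by (simp add: abs_mult)
      then have "\<bar>t - - d / v\<bar> \<le> \<rho> / \<bar>v\<bar>" using v by (simp add: pos_le_divide_eq mult.commute)
      then show "t \<in> {- d / v - \<rho> / \<bar>v\<bar> .. - d / v + \<rho> / \<bar>v\<bar>}"
        unfolding atLeastAtMost_iff by linarith
    qed
    then have "emeasure \<eta> {t. \<bar>d + t * v\<bar> \<le> \<rho>} \<le> emeasure \<eta> {- d / v - \<rho> / \<bar>v\<bar> .. - d / v + \<rho> / \<bar>v\<bar>}"
      by (intro emeasure_mono) auto
    also have "\<dots> \<le> ennreal C * emeasure lborel {- d / v - \<rho> / \<bar>v\<bar> .. - d / v + \<rho> / \<bar>v\<bar>}"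
      by (intro C(2)) simp
    also have "\<dots> = ennreal (C * (2 * \<rho> / \<bar>v\<bar>))"
      using \<rho> C(1) by (simp add: ennreal_mult[symmetric])
    also have "\<dots> \<le> ennreal ((4 * C * hi + 2) / b * \<rho>)"
    proof (rule ennreal_leI)
      have "2 * \<rho> / \<bar>v\<bar> \<le> 4 * hi / b * \<rho>"
        using 3 v b hi \<rho> by (simp add: field_simps)
      then have "C * (2 * \<rho> / \<bar>v\<bar>) \<le> C * (4 * hi / b * \<rho>)" using C(1) by (rule mult_left_mono)
      also have "\<dots> \<le> (4 * C * hi + 2) / b * \<rho>" using b \<rho> by (simp add: field_simps)
      finally show "C * (2 * \<rho> / \<bar>v\<bar>) \<le> (4 * C * hi + 2) / b * \<rho>" .
    qed
    finally show ?thesis .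
  qed
qed

text \<open>Fubini with respect to the coordinate m, given all others.\<close>

lemma affine_small_ball_PiM:
  fixes \<eta> :: "real measure"
  assumes pr: "prob_space \<eta>" and sets_\<eta>: "sets \<eta> = sets borel"
    and hi: "0 < lo" "lo \<le> hi" and bd: "AE t in \<eta>. t \<in> {lo..hi}"
    and C: "0 \<le> C" "\<And>B. B \<in> sets borel \<Longrightarrow> emeasure \<eta> B \<le> ennreal C * emeasure lborel B"
    and b: "0 < b" "b \<le> \<bar>d\<bar>" and \<rho>: "0 < \<rho>"
    and V[measurable]: "V \<in> borel_measurable (\<Pi>\<^sub>M i\<in>(UNIV::nat set). \<eta>)" and V_upd: "\<And>y t. V (y(m := t)) = V y"
  shows "emeasure (\<Pi>\<^sub>M i\<in>(UNIV::nat set). \<eta>) {y. \<bar>d + y m * V y\<bar> \<le> \<rho>} \<le> ennreal ((4 * C * hi + 2) / b * \<rho>)"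
proof -
  note [measurable_cong] = sets_\<eta>
  interpret prob_space \<eta> by fact
  let ?P = "\<Pi>\<^sub>M i\<in>(UNIV::nat set). \<eta>" and ?Q = "\<Pi>\<^sub>M i\<in>UNIV - {m}. \<eta>"
  have sp[simp]: "space \<eta> = UNIV" using sets_eq_imp_space_eq[OF sets_\<eta>] by simp
  have spP[simp]: "space ?P = UNIV" by (auto simp: space_PiM PiE_iff)
  interpret Q: prob_space ?Q using pr by (intro prob_space_PiM)
  let ?u = "\<lambda>(t, w). w(m := t)"
  have ins: "insert m (UNIV - {m}) = UNIV" by auto
  have P_eq: "distr (\<eta> \<Otimes>\<^sub>M ?Q) ?P ?u = ?P"
    using distr_pair_PiM_eq_PiM[of "UNIV - {m}" "\<lambda>_. \<eta>" m] pr unfolding ins by simp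
  have u[measurable]: "?u \<in> measurable (\<eta> \<Otimes>\<^sub>M ?Q) ?P"
    using measurable_fun_upd[of UNIV "UNIV - {m}" m "snd" "\<eta> \<Otimes>\<^sub>M ?Q" "\<lambda>_. \<eta>" fst] by (auto simp: case_prod_beta')
  have E: "{y. \<bar>d + y m * V y\<bar> \<le> \<rho>} \<in> sets ?P"
  proof -
    have "{y \<in> space ?P. \<bar>d + y m * V y\<bar> \<le> \<rho>} \<in> sets ?P" by measurable
    then show ?thesis by simp
  qed
  interpret pair_sigma_finite \<eta> ?Q ..
  have "emeasure ?P {y. \<bar>d + y m * V y\<bar> \<le> \<rho>} = emeasure (\<eta> \<Otimes>\<^sub>M ?Q) (?u -` {y. \<bar>d + y m * V y\<bar> \<le> \<rho>} \<inter> space (\<eta> \<Otimes>\<^sub>M ?Q))"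
    by (subst (1) P_eq[symmetric], rule emeasure_distr[OF u E])
  also have "\<dots> = (\<integral>\<^sup>+w. emeasure \<eta> ((\<lambda>t. (t, w)) -` (?u -` {y. \<bar>d + y m * V y\<bar> \<le> \<rho>} \<inter> space (\<eta> \<Otimes>\<^sub>M ?Q))) \<partial>?Q)"
    by (intro emeasure_pair_measure_alt2 measurable_sets[OF u E])
  also have "\<dots> \<le> (\<integral>\<^sup>+w. ennreal ((4 * C * hi + 2) / b * \<rho>) \<partial>?Q)"
  proof (intro nn_integral_mono)
    fix w assume "w \<in> space ?Q"
    then have "(\<lambda>t. (t, w)) -` (?u -` {y. \<bar>d + y m * V y\<bar> \<le> \<rho>} \<inter> space (\<eta> \<Otimes>\<^sub>M ?Q)) = {t. \<bar>d + t * V w\<bar> \<le> \<rho>}"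
      by (auto simp: space_pair_measure V_upd)
    then show "emeasure \<eta> ((\<lambda>t. (t, w)) -` (?u -` {y. \<bar>d + y m * V y\<bar> \<le> \<rho>} \<inter> space (\<eta> \<Otimes>\<^sub>M ?Q))) \<le> ennreal ((4 * C * hi + 2) / b * \<rho>)"
      using affine_small_ball[OF pr sets_\<eta> hi bd C b \<rho>, of "V w"] by simp
  qed
  also have "\<dots> = ennreal ((4 * C * hi + 2) / b * \<rho>)" by (simp add: Q.emeasure_space_1)
  finally show ?thesis .
qed

lemma nat_with_bits: "\<exists>j<2 ^ n. \<forall>i<n. bit (j::nat) i \<longleftrightarrow> b i"
proof (intro exI conjI allI impI)
  let ?j = "take_bit n (horner_sum of_bool 2 (map b [0..<n])) :: nat"
  show "?j < 2 ^ n" by simp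
  fix i assume "i < n"
  then show "bit ?j i \<longleftrightarrow> b i" by (simp add: bit_take_bit_iff bit_horner_sum_bit_iff)
qed


section \<open>Signs and errors: laws, growth and transversality\<close>

locale random_signs_and_errors = \<beta>: prob_space \<beta> + \<eta>: prob_space \<eta>
  for \<beta> \<eta> :: "real measure" +
  fixes a lo hi C :: real
  assumes a: "0 < a" "a < 1"
    and sets_\<beta>[measurable_cong]: "sets \<beta> = sets borel"
    and sets_\<eta>[measurable_cong]: "sets \<eta> = sets borel"
    and atoms: "measure \<beta> {1 - a} = 1 / 2" "measure \<beta> {1 + a} = 1 / 2"
    and lo: "0 < lo" "lo < hi"
    and errors_bounded: "AE t in \<eta>. t \<in> {lo..hi}"
    and errors_mean: "(LINT t|\<eta>. ln t) = 0"
    and C: "0 \<le> C" "\<And>B. B \<in> sets borel \<Longrightarrow> emeasure \<eta> B \<le> ennreal C * emeasure lborel B"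
begin

abbreviation sign_law :: "(nat \<Rightarrow> real) measure" where
  "sign_law \<equiv> \<Pi>\<^sub>M i\<in>UNIV. \<beta>"

abbreviation error_law :: "(nat \<Rightarrow> real) measure" where
  "error_law \<equiv> \<Pi>\<^sub>M i\<in>UNIV. \<eta>"

definition exponent :: real where
  "exponent = ln (1 - a\<^sup>2) / 2"

sublocale L: prob_space sign_law by (rule prob_space_PiM) unfold_locales
sublocale P: prob_space error_law by (rule prob_space_PiM) unfold_locales
sublocale LL: pair_sigma_finite sign_law sign_law ..
sublocale PL: pair_sigma_finite error_law sign_law ..

lemma space_laws [simp]: "space \<beta> = UNIV" "space \<eta> = UNIV" "space sign_law = UNIV" "space error_law = UNIV"
  using sets_eq_imp_space_eq[OF sets_\<beta>] sets_eq_imp_space_eq[OF sets_\<eta>] by (auto simp: space_PiM PiE_iff)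

lemma AE_sign: "AE x in \<beta>. x = 1 - a \<or> x = 1 + a"
proof -
  have "\<beta>.prob ({1 - a} \<union> {1 + a}) = 1"
    using a atoms sets_\<beta> by (subst \<beta>.finite_measure_Union) auto
  then have "AE x in \<beta>. x \<in> {1 - a} \<union> {1 + a}"
    by (subst \<beta>.prob_eq_1[symmetric]) (auto simp: sets_\<beta>)
  then show ?thesis by (rule eventually_mono) auto
qed

lemma AE_signs: "AE l in sign_law. \<forall>i. l i = 1 - a \<or> l i = 1 + a"
  by (rule AE_PiM_all_coordinates[OF \<beta>.prob_space_axioms AE_sign])

lemma sign_mean: "(LINT x|\<beta>. g x) = (g (1 - a) + g (1 + a)) / (2 :: real)" if [measurable]: "g \<in> borel_measurable borel"
proof -
  have "(LINT x|\<beta>. g x) = (LINT x|\<beta>. g (1 - a) * indicator {1 - a} x + g (1 + a) * indicator {1 + a} x)"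
    by (intro integral_cong_AE eventually_mono[OF AE_sign]) (use a in \<open>auto split: split_indicator\<close>)
  also have "\<dots> = (LINT x|\<beta>. g (1 - a) * indicator {1 - a} x) + (LINT x|\<beta>. g (1 + a) * indicator {1 + a} x)"
    by (intro Bochner_Integration.integral_add integrable_mult_right integrable_real_indicator)
       (auto simp: sets_\<beta> \<beta>.emeasure_eq_measure)
  finally show ?thesis using atoms by (simp add: sets_\<beta>)
qed

lemma sign_log_mean: "(LINT x|\<beta>. ln x) = exponent"
proof -
  have "(LINT x|\<beta>. ln x) = (ln (1 - a) + ln (1 + a)) / 2" by (rule sign_mean) simp
  also have "ln (1 - a) + ln (1 + a) = ln ((1 - a) * (1 + a))" using a by (simp add: ln_mult)
  also have "(1 - a) * (1 + a) = 1 - a\<^sup>2" by (simp add: power2_eq_square algebra_simps)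
  finally show ?thesis by (simp add: exponent_def)
qed

lemma exponent_neg: "exponent < 0"
proof -
  have "a\<^sup>2 < 1" using a by (simp add: abs_square_less_1)
  then show ?thesis using a unfolding exponent_def by (simp add: ln_less_zero)
qed

definition good_signs :: "nat \<Rightarrow> real \<Rightarrow> (nat \<Rightarrow> real) set" where
  "good_signs N \<delta> = {l. (\<forall>i. l i = 1 - a \<or> l i = 1 + a) \<and> controlled_growth (real N) exponent \<delta> l}"

definition good_errors :: "nat \<Rightarrow> real \<Rightarrow> (nat \<Rightarrow> real) set" where
  "good_errors N \<delta> = {y. controlled_growth (real N) 0 \<delta> y}"

lemma good_sets [measurable]: "good_signs N \<delta> \<in> sets sign_law" "good_errors N \<delta> \<in> sets error_law"
proof -
  have "{l \<in> space sign_law. (\<forall>i. l i = 1 - a \<or> l i = 1 + a) \<and> controlled_growth (real N) exponent \<delta> l} \<in> sets sign_law"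
    unfolding controlled_growth_def by measurable
  then show "good_signs N \<delta> \<in> sets sign_law" by (simp add: good_signs_def)
  have "{y \<in> space error_law. controlled_growth (real N) 0 \<delta> y} \<in> sets error_law"
    unfolding controlled_growth_def by measurable
  then show "good_errors N \<delta> \<in> sets error_law" by (simp add: good_errors_def)
qed

lemma AE_good_signs: "AE l in sign_law. \<exists>N. 0 < N \<and> l \<in> good_signs N \<delta>" if "0 < \<delta>"
proof -
  have "AE x in \<beta>. x \<in> {1 - a..1 + a}"
    using AE_sign by (rule eventually_mono) (use a in auto)
  then have "AE l in sign_law. \<exists>N::nat. 0 < N \<and> controlled_growth (real N) (LINT x|\<beta>. ln x) \<delta> l"
    using a that sets_\<beta> by (intro AE_controlled_growth[of \<beta> "1 - a" "1 + a"]) (auto intro: \<beta>.prob_space_axioms)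
  with AE_signs show ?thesis
    by eventually_elim (auto simp: good_signs_def sign_log_mean)
qed

lemma AE_good_errors: "AE y in error_law. \<exists>N. 0 < N \<and> y \<in> good_errors N \<delta>" if "0 < \<delta>"
  using AE_controlled_growth[OF \<eta>.prob_space_axioms sets_\<eta> lo errors_bounded that]
  by (simp add: errors_mean good_errors_def)

lemma good_mono: "good_signs N \<delta> \<subseteq> good_signs N' \<delta>" "good_errors N \<delta> \<subseteq> good_errors N' \<delta>" if "N \<le> N'" "0 < N"
proof -
  have "controlled_growth (real N') \<kappa> \<delta> x" if c: "controlled_growth (real N) \<kappa> \<delta> x" for \<kappa> x
  proof -
    have p: "0 < (\<Prod>i<n. x i)" for n using controlled_growth_prod_pos[OF c] \<open>0 < N\<close> by simp
    have "real N * (\<Prod>i<n. x i) \<le> real N' * (\<Prod>i<n. x i)" "real N * exp (real n * (\<kappa> + \<delta>)) \<le> real N' * exp (real n * (\<kappa> + \<delta>))" for n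
      using p[of n] \<open>N \<le> N'\<close> by (auto intro!: mult_right_mono)
    then show ?thesis using c unfolding controlled_growth_def by (meson order_trans)
  qed
  then show "good_signs N \<delta> \<subseteq> good_signs N' \<delta>" "good_errors N \<delta> \<subseteq> good_errors N' \<delta>"
    by (auto simp: good_signs_def good_errors_def)
qed

lemma cylinder_prob:
  assumes "\<And>i. l' i = 1 - a \<or> l' i = 1 + a"
  shows "emeasure sign_law {l. \<forall>i<n. l i = l' i} = ennreal (1 / 2 ^ n)"
proof -
  interpret product_prob_space "\<lambda>_. \<beta>" "UNIV :: nat set"
    by (intro product_prob_spaceI) unfold_locales
  have "emeasure sign_law {l \<in> space sign_law. \<forall>i\<in>{..<n}. l i \<in> {l' i}} = (\<Prod>i<n. emeasure \<beta> {l' i})"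
    by (rule emeasure_PiM_Collect) (auto simp: sets_\<beta>)
  also have "\<dots> = (\<Prod>i<n. ennreal (1 / 2))"
    using assms atoms by (intro prod.cong refl) (metis \<beta>.emeasure_eq_measure)
  also have "\<dots> = ennreal (1 / 2 ^ n)"
    unfolding prod_constant card_lessThan by (subst ennreal_power) (simp_all add: power_one_over)
  finally show ?thesis by (simp add: Ball_def)
qed

text \<open>The products before the affine factor are bounded below by controlled growth, hence a difference
  of at most r forces the affine factor to be at most a multiple of r exp (n (2 \<delta> - \<chi>)).\<close>

lemma transversality:
  assumes l: "l \<in> good_signs N \<delta>" and l': "l' \<in> good_signs N \<delta>" and N: "0 < N" and neg: "exponent + 2 * \<delta> < 0"
    and agree: "\<And>i. i < n \<Longrightarrow> l i = l' i" and differ: "l n \<noteq> l' n" and r: "0 < r"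
  shows "emeasure error_law {y \<in> good_errors N \<delta>. \<bar>random_sum l y - random_sum l' y\<bar> \<le> r}
         \<le> ennreal ((4 * C * hi + 2) / (2 * a) * ((real N)\<^sup>2 * exp \<delta> * r * exp (2 * \<delta> - exponent) ^ n))"
proof -
  define V where "V y = l n * l (Suc n) * random_sum (\<lambda>i. l (n + 2 + i)) (\<lambda>i. y (n + 2 + i))
         - l' n * l' (Suc n) * random_sum (\<lambda>i. l' (n + 2 + i)) (\<lambda>i. y (n + 2 + i))" for y :: "nat \<Rightarrow> real"
  define \<rho> where "\<rho> = (real N)\<^sup>2 * exp \<delta> * r * exp (2 * \<delta> - exponent) ^ n"
  have c: "controlled_growth (real N) exponent \<delta> l" "controlled_growth (real N) exponent \<delta> l'"
    and vals: "l n = 1 - a \<or> l n = 1 + a" "l' n = 1 - a \<or> l' n = 1 + a"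
    using l l' by (auto simp: good_signs_def)
  have sub: "{y \<in> good_errors N \<delta>. \<bar>random_sum l y - random_sum l' y\<bar> \<le> r} \<subseteq> {y. \<bar>(l n - l' n) + y (Suc n) * V y\<bar> \<le> \<rho>}"
  proof
    fix y assume y: "y \<in> {y \<in> good_errors N \<delta>. \<bar>random_sum l y - random_sum l' y\<bar> \<le> r}"
    then have cy: "controlled_growth (real N) 0 \<delta> y" by (simp add: good_errors_def)
    define A where "A = (\<Prod>i<n. l i)"
    define B where "B = (\<Prod>i<Suc n. y i)"
    have A: "0 < A" "exp (real n * (exponent - \<delta>)) \<le> real N * A"
      using controlled_growth_prod_pos[OF c(1)] c(1) N by (auto simp: A_def controlled_growth_def)
    have B: "0 < B" "exp (real (Suc n) * (0 - \<delta>)) \<le> real N * B"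
    proof -
      show "0 < B" unfolding B_def by (rule controlled_growth_prod_pos[OF cy]) (use N in simp)
      show "exp (real (Suc n) * (0 - \<delta>)) \<le> real N * B"
        using cy unfolding controlled_growth_def B_def by blast
    qed
    have "random_sum l y - random_sum l' y = A * B * ((l n - l' n) + y (Suc n) * V y)"
      unfolding A_def B_def V_def
      using N neg c cy agree controlled_growth_nonzero[OF c(1)] controlled_growth_nonzero[OF c(2)] controlled_growth_nonzero[OF cy]
      by (intro random_sum_diff_common_prefix summable_controlled_products[of "real N" exponent \<delta>]) auto
    with y A B have le: "A * B * \<bar>(l n - l' n) + y (Suc n) * V y\<bar> \<le> r" by (simp add: abs_mult)
    have one: "1 \<le> (real N)\<^sup>2 * exp \<delta> * exp (2 * \<delta> - exponent) ^ n * (A * B)"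
    proof -
      have "exp (real n * (exponent - \<delta>)) * exp (real (Suc n) * (0 - \<delta>)) \<le> (real N * A) * (real N * B)"
        using A B by (intro mult_mono) auto
      then have h1: "exp \<delta> * exp (2 * \<delta> - exponent) ^ n * (exp (real n * (exponent - \<delta>)) * exp (real (Suc n) * (0 - \<delta>)))
          \<le> exp \<delta> * exp (2 * \<delta> - exponent) ^ n * ((real N * A) * (real N * B))"
        by (intro mult_left_mono) auto
      have h2: "exp \<delta> * exp (2 * \<delta> - exponent) ^ n * (exp (real n * (exponent - \<delta>)) * exp (real (Suc n) * (0 - \<delta>))) = 1"
        unfolding exp_of_nat_mult[symmetric] exp_add[symmetric] by (simp add: algebra_simps)
      have "exp \<delta> * exp (2 * \<delta> - exponent) ^ n * ((real N * A) * (real N * B))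
          = (real N)\<^sup>2 * exp \<delta> * exp (2 * \<delta> - exponent) ^ n * (A * B)"
        by (simp add: power2_eq_square)
      with h1 h2 show ?thesis by linarith
    qed
    have "\<bar>(l n - l' n) + y (Suc n) * V y\<bar> \<le> ((real N)\<^sup>2 * exp \<delta> * exp (2 * \<delta> - exponent) ^ n * (A * B)) * \<bar>(l n - l' n) + y (Suc n) * V y\<bar>"
      using mult_right_mono[OF one, of "\<bar>(l n - l' n) + y (Suc n) * V y\<bar>"] by simp
    also have "\<dots> = ((real N)\<^sup>2 * exp \<delta> * exp (2 * \<delta> - exponent) ^ n) * (A * B * \<bar>(l n - l' n) + y (Suc n) * V y\<bar>)"
      by (simp only: mult.assoc)
    also have "\<dots> \<le> ((real N)\<^sup>2 * exp \<delta> * exp (2 * \<delta> - exponent) ^ n) * r"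
      using le by (intro mult_left_mono) auto
    finally show "y \<in> {y. \<bar>(l n - l' n) + y (Suc n) * V y\<bar> \<le> \<rho>}" by (simp add: \<rho>_def mult_ac)
  qed
  have Vm[measurable]: "V \<in> borel_measurable error_law"
    unfolding V_def
    by (intro borel_measurable_diff borel_measurable_times borel_measurable_const borel_measurable_random_sum) (auto simp: measurable_cong_sets[OF refl sets_\<eta>])
  have "emeasure error_law {y \<in> good_errors N \<delta>. \<bar>random_sum l y - random_sum l' y\<bar> \<le> r}
      \<le> emeasure error_law {y. \<bar>(l n - l' n) + y (Suc n) * V y\<bar> \<le> \<rho>}"
  proof (rule emeasure_mono[OF sub])
    have "{y \<in> space error_law. \<bar>(l n - l' n) + y (Suc n) * V y\<bar> \<le> \<rho>} \<in> sets error_law" by measurable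
    then show "{y. \<bar>(l n - l' n) + y (Suc n) * V y\<bar> \<le> \<rho>} \<in> sets error_law" by simp
  qed
  also have "\<dots> \<le> ennreal ((4 * C * hi + 2) / (2 * a) * \<rho>)"
  proof (rule affine_small_ball_PiM[OF \<eta>.prob_space_axioms sets_\<eta> lo(1) less_imp_le[OF lo(2)] errors_bounded C _ _ _ Vm])
    show "0 < 2 * a" "2 * a \<le> \<bar>l n - l' n\<bar>" using a vals differ by auto
    show "0 < \<rho>" using N r by (simp add: \<rho>_def)
    show "V (y(Suc n := t)) = V y" for y t by (simp add: V_def)
  qed
  finally show ?thesis by (simp add: \<rho>_def)
qed

text \<open>The part of the conditional law that comes from well-behaved signs. It is a finite measure, in
  general not a probability measure. The restriction depends only on the signs, so that
  averaging over errors stays a plain integral.\<close>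

definition restricted_law :: "nat \<Rightarrow> real \<Rightarrow> (nat \<Rightarrow> real) \<Rightarrow> real measure" where
  "restricted_law N \<delta> y = distr (density sign_law (indicator (good_signs N \<delta>))) borel (\<lambda>l. random_sum l y)"

lemma random_sum_signs_measurable [measurable]: "(\<lambda>l. random_sum l y) \<in> borel_measurable sign_law"
  by (intro borel_measurable_random_sum) auto

lemma emeasure_restricted_law:
  assumes [measurable]: "B \<in> sets borel"
  shows "emeasure (restricted_law N \<delta> y) B = emeasure sign_law (good_signs N \<delta> \<inter> {l. random_sum l y \<in> B})"
proof -
  have m: "(\<lambda>l. random_sum l y) -` B \<in> sets sign_law"
    using measurable_sets[OF random_sum_signs_measurable assms, of y] by simp
  have "emeasure (restricted_law N \<delta> y) B = emeasure (density sign_law (indicator (good_signs N \<delta>))) ((\<lambda>l. random_sum l y) -` B)"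
    unfolding restricted_law_def by (subst emeasure_distr) auto
  also have "\<dots> = (\<integral>\<^sup>+l. indicator (good_signs N \<delta>) l * indicator ((\<lambda>l. random_sum l y) -` B) l \<partial>sign_law)"
    by (rule emeasure_density[OF _ m]) measurable
  also have "\<dots> = (\<integral>\<^sup>+l. indicator (good_signs N \<delta> \<inter> (\<lambda>l. random_sum l y) -` B) l \<partial>sign_law)"
    by (simp add: indicator_inter_arith)
  also have "\<dots> = emeasure sign_law (good_signs N \<delta> \<inter> (\<lambda>l. random_sum l y) -` B)"
    by (intro nn_integral_indicator sets.Int good_sets m)
  finally show ?thesis by (simp add: vimage_def)
qed

lemma restricted_law_finite [simp]: "finite_measure (restricted_law N \<delta> y)" "sets (restricted_law N \<delta> y) = sets borel"
proof -
  show "sets (restricted_law N \<delta> y) = sets borel" by (simp add: restricted_law_def)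
  show "finite_measure (restricted_law N \<delta> y)"
    by (rule finite_measureI) (simp add: restricted_law_def[THEN arg_cong[where f=space], simplified] emeasure_restricted_law)
qed

lemma measurable_event_close:
  "(\<lambda>(y, l). indicator {l. \<bar>random_sum l y - random_sum l' y\<bar> \<le> r} l :: ennreal) \<in> borel_measurable (error_law \<Otimes>\<^sub>M sign_law)"
  "(\<lambda>((y, l'), l). indicator {l. \<bar>random_sum l y - random_sum l' y\<bar> \<le> r} l :: ennreal) \<in> borel_measurable ((error_law \<Otimes>\<^sub>M sign_law) \<Otimes>\<^sub>M sign_law)"
proof -
  have [measurable]: "(\<lambda>x. random_sum (snd x) (fst (fst x))) \<in> borel_measurable ((error_law \<Otimes>\<^sub>M sign_law) \<Otimes>\<^sub>M sign_law)"
    "(\<lambda>x. random_sum (snd (fst x)) (fst (fst x))) \<in> borel_measurable ((error_law \<Otimes>\<^sub>M sign_law) \<Otimes>\<^sub>M sign_law)"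
    "(\<lambda>x. random_sum (snd x) (fst x)) \<in> borel_measurable (error_law \<Otimes>\<^sub>M sign_law)"
    "(\<lambda>x. random_sum l' (fst x)) \<in> borel_measurable (error_law \<Otimes>\<^sub>M sign_law)"
    by (rule borel_measurable_random_sum; measurable)+
  show "(\<lambda>(y, l). indicator {l. \<bar>random_sum l y - random_sum l' y\<bar> \<le> r} l :: ennreal) \<in> borel_measurable (error_law \<Otimes>\<^sub>M sign_law)"
    unfolding indicator_def case_prod_beta' mem_Collect_eq by measurable
  show "(\<lambda>((y, l'), l). indicator {l. \<bar>random_sum l y - random_sum l' y\<bar> \<le> r} l :: ennreal) \<in> borel_measurable ((error_law \<Otimes>\<^sub>M sign_law) \<Otimes>\<^sub>M sign_law)"
    unfolding indicator_def case_prod_beta' mem_Collect_eq by measurable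
qed

lemma restricted_energy_eq:
  "(\<integral>\<^sup>+x. emeasure (restricted_law N \<delta> y) (cball x r) \<partial>restricted_law N \<delta> y) =
   (\<integral>\<^sup>+l'. indicator (good_signs N \<delta>) l' *
      (\<integral>\<^sup>+l. indicator (good_signs N \<delta>) l * indicator {l. \<bar>random_sum l y - random_sum l' y\<bar> \<le> r} l \<partial>sign_law) \<partial>sign_law)"
proof -
  have inner: "emeasure (restricted_law N \<delta> y) (cball (random_sum l' y) r) =
     (\<integral>\<^sup>+l. indicator (good_signs N \<delta>) l * indicator {l. \<bar>random_sum l y - random_sum l' y\<bar> \<le> r} l \<partial>sign_law)" for l'
  proof -
    have "emeasure (restricted_law N \<delta> y) (cball (random_sum l' y) r) =
       emeasure sign_law (good_signs N \<delta> \<inter> {l. random_sum l y \<in> cball (random_sum l' y) r})"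
      by (rule emeasure_restricted_law) simp
    also have "\<dots> = (\<integral>\<^sup>+l. indicator (good_signs N \<delta> \<inter> {l. random_sum l y \<in> cball (random_sum l' y) r}) l \<partial>sign_law)"
      using measurable_sets[OF random_sum_signs_measurable, of "cball (random_sum l' y) r" y]
      by (intro nn_integral_indicator[symmetric]) (auto simp: vimage_def)
    also have "\<dots> = (\<integral>\<^sup>+l. indicator (good_signs N \<delta>) l * indicator {l. \<bar>random_sum l y - random_sum l' y\<bar> \<le> r} l \<partial>sign_law)"
      by (intro nn_integral_cong) (auto simp: dist_real_def abs_minus_commute split: split_indicator)
    finally show ?thesis .
  qed
  have m: "(\<lambda>x. emeasure (restricted_law N \<delta> y) (cball x r)) \<in> borel_measurable borel"
    by (rule borel_measurable_emeasure_cball[OF restricted_law_finite])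
  have X: "(\<lambda>l. random_sum l y) \<in> measurable (density sign_law (indicator (good_signs N \<delta>))) borel"
    by simp
  have "(\<integral>\<^sup>+x. emeasure (restricted_law N \<delta> y) (cball x r) \<partial>restricted_law N \<delta> y)
      = (\<integral>\<^sup>+l'. emeasure (restricted_law N \<delta> y) (cball (random_sum l' y) r) \<partial>density sign_law (indicator (good_signs N \<delta>)))"
    unfolding restricted_law_def[of N \<delta> y, THEN arg_cong[where f="\<lambda>M. nn_integral M (\<lambda>x. emeasure (restricted_law N \<delta> y) (cball x r))"]]
    by (rule nn_integral_distr[OF X]) (simp add: m)
  also have "\<dots> = (\<integral>\<^sup>+l'. indicator (good_signs N \<delta>) l' * emeasure (restricted_law N \<delta> y) (cball (random_sum l' y) r) \<partial>sign_law)"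
    by (rule nn_integral_density) (auto intro: measurable_compose[OF random_sum_signs_measurable m])
  finally show ?thesis unfolding inner .
qed

text \<open>Split according to the first position n at which l differs from l'. The cylinder has probability
  2^-n, and since probabilities are at most 1 the linear bound of transversality may be
  replaced by its s-th power; the result is a geometric series with ratio
  exp (s (2 \<delta> - \<chi>)) / 2.\<close>

lemma expected_pair_close_le:
  assumes N: "0 < N" and neg: "exponent + 2 * \<delta> < 0" and s: "0 < s" "s \<le> 1"
    and ratio: "exp (s * (2 * \<delta> - exponent)) < 2" and r: "0 < r" and l': "l' \<in> good_signs N \<delta>"
  defines "K \<equiv> ((4 * C * hi + 2) / (2 * a) * ((real N)\<^sup>2 * exp \<delta>)) powr s / (1 - exp (s * (2 * \<delta> - exponent)) / 2)"
  shows "(\<integral>\<^sup>+l. indicator (good_signs N \<delta>) l *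
            emeasure error_law {y \<in> good_errors N \<delta>. \<bar>random_sum l y - random_sum l' y\<bar> \<le> r} \<partial>sign_law)
         \<le> ennreal (K * r powr s)"
proof -
  define b where "b = (4 * C * hi + 2) / (2 * a) * ((real N)\<^sup>2 * exp \<delta>)"
  define q where "q = exp (2 * \<delta> - exponent)"
  define D where "D n = {l. (\<forall>i<n. l i = l' i) \<and> l n \<noteq> l' n}" for n :: nat
  have b: "0 < b" using C lo a N by (auto simp: b_def intro!: mult_pos_pos divide_pos_pos add_nonneg_pos)
  have q: "0 < q" "q powr s = exp (s * (2 * \<delta> - exponent))" by (simp_all add: q_def powr_def)
  have vals: "l' i = 1 - a \<or> l' i = 1 + a" for i using l' by (simp add: good_signs_def)
  have cyl_meas: "{l. \<forall>i<n. l i = l' i} \<in> sets sign_law" for n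
  proof -
    have "{l \<in> space sign_law. \<forall>i<n. l i = l' i} \<in> sets sign_law" by measurable
    then show ?thesis by simp
  qed
  have D_meas[measurable]: "D n \<in> sets sign_law" for n
  proof -
    have "{l \<in> space sign_law. (\<forall>i<n. l i = l' i) \<and> l n \<noteq> l' n} \<in> sets sign_law" by measurable
    then show ?thesis by (simp add: D_def)
  qed
  have D_le: "emeasure sign_law (D n) \<le> ennreal (1 / 2 ^ n)" for n
    by (rule order_trans[OF emeasure_mono[OF _ cyl_meas] eq_refl[OF cylinder_prob[OF vals]]]) (auto simp: D_def)
  have "AE l in sign_law. l \<noteq> l'"
  proof -
    have "emeasure sign_law {l'} \<le> ennreal (1 / 2 ^ n)" for n
      by (rule order_trans[OF emeasure_mono[OF _ cyl_meas] eq_refl[OF cylinder_prob[OF vals]]]) auto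
    moreover have "(\<lambda>n. ennreal (1 / 2 ^ n)) \<longlonglongrightarrow> ennreal 0"
      by (intro tendsto_ennrealI LIMSEQ_divide_realpow_zero) auto
    ultimately have zero: "emeasure sign_law {l'} \<le> 0"
      using LIMSEQ_le_const[of "\<lambda>n. ennreal (1 / 2 ^ n)" 0 "emeasure sign_law {l'}"] by auto
    have "{l'} = (\<Inter>n. {l. \<forall>i<n. l i = l' i})" by auto
    also have "\<dots> \<in> sets sign_law" using cyl_meas by (intro sets.countable_INT) auto
    finally show ?thesis using zero by (subst AE_iff_measurable[OF _ refl]) auto
  qed
  then have "(\<integral>\<^sup>+l. indicator (good_signs N \<delta>) l *
            emeasure error_law {y \<in> good_errors N \<delta>. \<bar>random_sum l y - random_sum l' y\<bar> \<le> r} \<partial>sign_law)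
      \<le> (\<integral>\<^sup>+l. (\<Sum>n. ennreal ((b * r * q ^ n) powr s) * indicator (D n) l) \<partial>sign_law)"
  proof (intro nn_integral_mono_AE, eventually_elim)
    case (elim l)
    show ?case
    proof (cases "l \<in> good_signs N \<delta>")
      case True
      from elim have "\<exists>n. l n \<noteq> l' n" by auto
      define n where "n = (LEAST n. l n \<noteq> l' n)"
      have n: "l n \<noteq> l' n" "\<And>i. i < n \<Longrightarrow> l i = l' i"
        unfolding n_def using LeastI_ex[OF \<open>\<exists>n. l n \<noteq> l' n\<close>] not_less_Least by blast+
      let ?E = "{y \<in> good_errors N \<delta>. \<bar>random_sum l y - random_sum l' y\<bar> \<le> r}"
      have "emeasure error_law ?E \<le> ennreal (b * r * q ^ n)"
        using transversality[OF True l' N neg n(2) n(1) r] by (simp add: b_def q_def mult_ac)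
      then have p: "P.prob ?E \<le> b * r * q ^ n"
        using b r q by (simp add: P.emeasure_eq_measure)
      have "P.prob ?E \<le> (b * r * q ^ n) powr s"
      proof (cases "b * r * q ^ n \<le> 1")
        case True
        have "b * r * q ^ n = (b * r * q ^ n) powr 1" using b r q by simp
        also have "\<dots> \<le> (b * r * q ^ n) powr s" using True b r q s by (intro powr_mono') auto
        finally show ?thesis using p by simp
      next
        case False
        then have "1 \<le> (b * r * q ^ n) powr s" using s by (intro ge_one_powr_ge_zero) auto
        then show ?thesis using P.prob_le_1[of ?E] by linarith
      qed
      then have "emeasure error_law ?E \<le> ennreal ((b * r * q ^ n) powr s) * indicator (D n) l"
        using n by (simp add: P.emeasure_eq_measure D_def ennreal_leI)
      also have "\<dots> \<le> (\<Sum>n. ennreal ((b * r * q ^ n) powr s) * indicator (D n) l)"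
        by (rule term_le_suminf_ennreal)
      finally show ?thesis using True by simp
    qed simp
  qed
  also have "\<dots> = (\<Sum>n. ennreal ((b * r * q ^ n) powr s) * emeasure sign_law (D n))"
    by (subst nn_integral_suminf) (auto simp: nn_integral_cmult)
  also have "\<dots> \<le> (\<Sum>n. ennreal ((b * r) powr s * (q powr s / 2) ^ n))"
  proof (intro suminf_le summableI)
    fix n
    have "ennreal ((b * r * q ^ n) powr s) * emeasure sign_law (D n) \<le> ennreal ((b * r * q ^ n) powr s) * ennreal (1 / 2 ^ n)"
      by (intro mult_left_mono D_le) simp
    also have "\<dots> = ennreal ((b * r) powr s * (q powr s / 2) ^ n)"
      using b r q(1) by (simp add: ennreal_mult[symmetric] powr_mult powr_power power_divide powr_powr powr_realpow[symmetric] mult.commute)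
    finally show "ennreal ((b * r * q ^ n) powr s) * emeasure sign_law (D n) \<le> ennreal ((b * r) powr s * (q powr s / 2) ^ n)" .
  qed
  also have "\<dots> = ennreal ((b * r) powr s * (1 / (1 - q powr s / 2)))"
    using ratio q by (subst suminf_ennreal2) (auto intro!: summable_mult summable_geometric simp: suminf_mult suminf_geometric)
  also have "\<dots> = ennreal (K * r powr s)"
  proof -
    have "K = b powr s / (1 - q powr s / 2)" unfolding K_def b_def q ..
    then show ?thesis using b r by (simp add: powr_mult)
  qed
  finally show ?thesis .
qed

text \<open>The energy of the restricted law is the probability that two independent sign sequences, both
  well-behaved, have sums within r. Interchange the integrals so that the one over the errors
  is innermost.\<close>

lemma expected_restricted_energy_le:
  assumes N: "0 < N" and neg: "exponent + 2 * \<delta> < 0" and s: "0 < s" "s \<le> 1"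
    and ratio: "exp (s * (2 * \<delta> - exponent)) < 2"
  obtains K where "0 \<le> K" "\<And>r. 0 < r \<Longrightarrow>
    (\<integral>\<^sup>+y. indicator (good_errors N \<delta>) y * (\<integral>\<^sup>+x. emeasure (restricted_law N \<delta> y) (cball x r) \<partial>restricted_law N \<delta> y) \<partial>error_law)
    \<le> ennreal (K * r powr s)"
proof -
  define K where "K = ((4 * C * hi + 2) / (2 * a) * ((real N)\<^sup>2 * exp \<delta>)) powr s / (1 - exp (s * (2 * \<delta> - exponent)) / 2)"
  show thesis
  proof (rule that[of K])
    show "0 \<le> K" using ratio by (auto simp: K_def)
    fix r :: real assume r: "0 < r"
    let ?G = "good_errors N \<delta>" and ?S = "good_signs N \<delta>"
    let ?F = "\<lambda>y l' l. indicator ?S l * indicator {l. \<bar>random_sum l y - random_sum l' y\<bar> \<le> r} l :: ennreal"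
    let ?H = "\<lambda>y l'. \<integral>\<^sup>+l. ?F y l' l \<partial>sign_law"
    note m[measurable] = measurable_event_close[unfolded case_prod_beta']
    have Hm: "(\<lambda>p. ?H (fst p) (snd p)) \<in> borel_measurable (error_law \<Otimes>\<^sub>M sign_law)"
      by (rule L.borel_measurable_nn_integral) (unfold case_prod_beta', measurable)
    have Hm1: "(\<lambda>l'. ?H y l') \<in> borel_measurable sign_law" for y
      using measurable_compose[OF measurable_Pair1' Hm, of y] by simp
    have "(\<integral>\<^sup>+y. indicator ?G y * (\<integral>\<^sup>+x. emeasure (restricted_law N \<delta> y) (cball x r) \<partial>restricted_law N \<delta> y) \<partial>error_law)
      = (\<integral>\<^sup>+y. (\<integral>\<^sup>+l'. indicator ?G y * (indicator ?S l' * ?H y l') \<partial>sign_law) \<partial>error_law)"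
      unfolding restricted_energy_eq using Hm1
      by (intro nn_integral_cong nn_integral_cmult[symmetric] borel_measurable_times_ennreal borel_measurable_indicator good_sets)
    also have "\<dots> = (\<integral>\<^sup>+l'. (\<integral>\<^sup>+y. indicator ?G y * (indicator ?S l' * ?H y l') \<partial>error_law) \<partial>sign_law)"
    proof (rule PL.Fubini'[symmetric])
      show "(\<lambda>(y, l'). indicator ?G y * (indicator ?S l' * ?H y l')) \<in> borel_measurable (error_law \<Otimes>\<^sub>M sign_law)"
        unfolding case_prod_beta' using Hm by (intro borel_measurable_times_ennreal) measurable
    qed
    also have "\<dots> = (\<integral>\<^sup>+l'. indicator ?S l' * (\<integral>\<^sup>+l. indicator ?S l *
        emeasure error_law {y \<in> ?G. \<bar>random_sum l y - random_sum l' y\<bar> \<le> r} \<partial>sign_law) \<partial>sign_law)"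
    proof (rule nn_integral_cong)
      fix l'
      let ?I = "\<lambda>y l. indicator {l. \<bar>random_sum l y - random_sum l' y\<bar> \<le> r} l :: ennreal"
      have Im: "(\<lambda>p. ?I (fst p) (snd p)) \<in> borel_measurable (error_law \<Otimes>\<^sub>M sign_law)" by measurable
      have Im1: "(\<lambda>l. ?I y l) \<in> borel_measurable sign_law" for y
        using measurable_compose[OF measurable_Pair1' Im, of y] by simp
      have Im2: "(\<lambda>y. ?I y l) \<in> borel_measurable error_law" for l
        using measurable_compose[OF measurable_Pair2' Im, of l] by simp
      have Em: "{y \<in> ?G. \<bar>random_sum l y - random_sum l' y\<bar> \<le> r} \<in> sets error_law" for l
      proof -
        have [measurable]: "(\<lambda>y. random_sum l y) \<in> borel_measurable error_law" for l
          by (rule borel_measurable_random_sum; measurable)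
        have "{y \<in> space error_law. y \<in> ?G \<and> \<bar>random_sum l y - random_sum l' y\<bar> \<le> r} \<in> sets error_law" by measurable
        then show ?thesis by simp
      qed
      have "(\<integral>\<^sup>+y. indicator ?G y * (indicator ?S l' * ?H y l') \<partial>error_law)
          = (\<integral>\<^sup>+y. indicator ?S l' * (\<integral>\<^sup>+l. indicator ?G y * ?F y l' l \<partial>sign_law) \<partial>error_law)"
        using Im1 by (subst nn_integral_cmult) (auto simp: mult.left_commute)
      also have "\<dots> = indicator ?S l' * (\<integral>\<^sup>+y. (\<integral>\<^sup>+l. indicator ?G y * ?F y l' l \<partial>sign_law) \<partial>error_law)"
      proof (rule nn_integral_cmult)
        show "(\<lambda>y. \<integral>\<^sup>+l. indicator ?G y * ?F y l' l \<partial>sign_law) \<in> borel_measurable error_law"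
          by (rule L.borel_measurable_nn_integral) (unfold case_prod_beta', measurable)
      qed
      also have "(\<integral>\<^sup>+y. (\<integral>\<^sup>+l. indicator ?G y * ?F y l' l \<partial>sign_law) \<partial>error_law)
          = (\<integral>\<^sup>+l. (\<integral>\<^sup>+y. indicator ?G y * ?F y l' l \<partial>error_law) \<partial>sign_law)"
        by (rule PL.Fubini'[symmetric]) (unfold case_prod_beta', measurable)
      also have "\<dots> = (\<integral>\<^sup>+l. indicator ?S l *
          emeasure error_law {y \<in> ?G. \<bar>random_sum l y - random_sum l' y\<bar> \<le> r} \<partial>sign_law)"
      proof (rule nn_integral_cong)
        fix l
        have "(\<integral>\<^sup>+y. indicator ?G y * ?F y l' l \<partial>error_law)
            = (\<integral>\<^sup>+y. indicator ?S l * indicator {y \<in> ?G. \<bar>random_sum l y - random_sum l' y\<bar> \<le> r} y \<partial>error_law)"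
          by (intro nn_integral_cong) (auto split: split_indicator)
        also have "\<dots> = indicator ?S l * emeasure error_law {y \<in> ?G. \<bar>random_sum l y - random_sum l' y\<bar> \<le> r}"
          by (rule nn_integral_cmult_indicator[OF Em])
        finally show "(\<integral>\<^sup>+y. indicator ?G y * ?F y l' l \<partial>error_law)
            = indicator ?S l * emeasure error_law {y \<in> ?G. \<bar>random_sum l y - random_sum l' y\<bar> \<le> r}" .
      qed
      finally show "(\<integral>\<^sup>+y. indicator ?G y * (indicator ?S l' * ?H y l') \<partial>error_law)
          = indicator ?S l' * (\<integral>\<^sup>+l. indicator ?S l *
            emeasure error_law {y \<in> ?G. \<bar>random_sum l y - random_sum l' y\<bar> \<le> r} \<partial>sign_law)" .
    qed
    also have "\<dots> \<le> (\<integral>\<^sup>+l'. ennreal (K * r powr s) \<partial>sign_law)"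
      using expected_pair_close_le[OF N neg s ratio r, folded K_def]
      by (intro nn_integral_mono) (auto split: split_indicator)
    also have "\<dots> = ennreal (K * r powr s)" by (simp add: L.emeasure_space_1[simplified])
    finally show "(\<integral>\<^sup>+y. indicator ?G y * (\<integral>\<^sup>+x. emeasure (restricted_law N \<delta> y) (cball x r) \<partial>restricted_law N \<delta> y) \<partial>error_law)
      \<le> ennreal (K * r powr s)" .
  qed
qed


definition conditional_law :: "(nat \<Rightarrow> real) \<Rightarrow> real measure" where
  "conditional_law y = distr sign_law borel (\<lambda>l. random_sum l y)"

lemma sets_conditional_law [simp]: "sets (conditional_law y) = sets borel" "space (conditional_law y) = UNIV"
  by (simp_all add: conditional_law_def)

lemma prob_space_conditional_law: "prob_space (conditional_law y)"
  unfolding conditional_law_def by (rule L.prob_space_distr) simp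

lemma conditional_law_null_iff:
  assumes [measurable]: "B \<in> sets borel"
  shows "emeasure (conditional_law y) B = 0 \<longleftrightarrow> (AE l in sign_law. random_sum l y \<notin> B)"
proof -
  have "emeasure (conditional_law y) B = 0 \<longleftrightarrow> (AE x in conditional_law y. x \<notin> B)"
    by (subst AE_iff_measurable[OF _ refl]) auto
  also have "\<dots> \<longleftrightarrow> (AE l in sign_law. random_sum l y \<notin> B)"
    unfolding conditional_law_def by (subst AE_distr_iff) auto
  finally show ?thesis .
qed

text \<open>Almost every sign sequence is well-behaved for some N, and the restrictions increase with N. So a
  set that is null for all restrictions that y admits is null for the whole law.\<close>

lemma conditional_law_null_if_restricted_null:
  assumes \<delta>: "0 < \<delta>" and y: "0 < N0" "y \<in> good_errors N0 \<delta>" and B: "B \<in> sets borel"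
    and null: "\<And>N. 0 < N \<Longrightarrow> y \<in> good_errors N \<delta> \<Longrightarrow> emeasure (restricted_law N \<delta> y) B = 0"
  shows "emeasure (conditional_law y) B = 0"
proof -
  have "AE l in sign_law. N0 \<le> N \<longrightarrow> \<not> (l \<in> good_signs N \<delta> \<and> random_sum l y \<in> B)" for N
  proof (cases "N0 \<le> N")
    case True
    then have "emeasure sign_law (good_signs N \<delta> \<inter> {l. random_sum l y \<in> B}) = 0"
      using null[of N] good_mono(2)[OF True y(1)] y emeasure_restricted_law[OF B] by auto
    moreover have "{l. random_sum l y \<in> B} \<in> sets sign_law"
      using measurable_sets[OF random_sum_signs_measurable B, of y] by (simp add: vimage_def)
    ultimately show ?thesis
      by (subst AE_iff_measurable[of "good_signs N \<delta> \<inter> {l. random_sum l y \<in> B}"]) (auto simp: True)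
  qed simp
  then have "AE l in sign_law. \<forall>N. N0 \<le> N \<longrightarrow> \<not> (l \<in> good_signs N \<delta> \<and> random_sum l y \<in> B)"
    unfolding AE_all_countable by blast
  with AE_good_signs[OF \<delta>] have "AE l in sign_law. random_sum l y \<notin> B"
  proof eventually_elim
    case (elim l)
    then obtain N where N: "0 < N" "l \<in> good_signs N \<delta>" by blast
    have "l \<in> good_signs (max N N0) \<delta>" using good_mono(1)[of N "max N N0"] N by auto
    then show ?case using elim(2) by (meson max.cobounded2)
  qed
  then show ?thesis using conditional_law_null_iff[OF B] by simp
qed

lemma restricted_energy_measurable:
  "(\<lambda>y. \<integral>\<^sup>+x. emeasure (restricted_law N \<delta> y) (cball x r) \<partial>restricted_law N \<delta> y) \<in> borel_measurable error_law"
proof -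
  note m[measurable] = measurable_event_close[unfolded case_prod_beta']
  let ?S = "good_signs N \<delta>"
  let ?H = "\<lambda>y l'. \<integral>\<^sup>+l. indicator ?S l * indicator {l. \<bar>random_sum l y - random_sum l' y\<bar> \<le> r} l \<partial>sign_law"
  have Hm: "(\<lambda>p. ?H (fst p) (snd p)) \<in> borel_measurable (error_law \<Otimes>\<^sub>M sign_law)"
    by (rule L.borel_measurable_nn_integral) (unfold case_prod_beta', measurable)
  show ?thesis
    unfolding restricted_energy_eq
  proof (rule L.borel_measurable_nn_integral)
    show "(\<lambda>(y, l'). indicator ?S l' * ?H y l') \<in> borel_measurable (error_law \<Otimes>\<^sub>M sign_law)"
      unfolding case_prod_beta' using Hm by (intro borel_measurable_times_ennreal) measurable
  qed
qed

text \<open>The energies at scale 2^-m, multiplied by 2^m, have bounded expectation. Fatou's lemma gives a finite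
  limit inferior for almost every y, which is all that the criterion needs.\<close>

lemma restricted_law_absolutely_continuous:
  assumes N: "0 < N" and neg: "exponent + 2 * \<delta> < 0" and ratio: "exp (2 * \<delta> - exponent) < 2"
  shows "AE y in error_law. y \<in> good_errors N \<delta> \<longrightarrow> absolutely_continuous lborel (restricted_law N \<delta> y)"
proof -
  define q where "q m y = (\<integral>\<^sup>+x. emeasure (restricted_law N \<delta> y) (cball x (1 / 2 ^ m)) \<partial>restricted_law N \<delta> y)"
    for m :: nat and y
  have qm[measurable]: "q m \<in> borel_measurable error_law" for m
    unfolding q_def by (rule restricted_energy_measurable)
  obtain K where K: "0 \<le> K" "\<And>r. 0 < r \<Longrightarrow>
    (\<integral>\<^sup>+y. indicator (good_errors N \<delta>) y * (\<integral>\<^sup>+x. emeasure (restricted_law N \<delta> y) (cball x r) \<partial>restricted_law N \<delta> y) \<partial>error_law)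
    \<le> ennreal (K * r powr 1)"
    using expected_restricted_energy_le[OF N neg, of 1] ratio by auto
  let ?f = "\<lambda>m y. ennreal (2 ^ m) * (indicator (good_errors N \<delta>) y * q m y)"
  have "(\<integral>\<^sup>+y. liminf (\<lambda>m. ?f m y) \<partial>error_law) \<le> liminf (\<lambda>m. \<integral>\<^sup>+y. ?f m y \<partial>error_law)"
    by (rule nn_integral_liminf) measurable
  also have "\<dots> \<le> liminf (\<lambda>m. ennreal K)"
  proof (intro Liminf_mono always_eventually allI)
    fix m
    have "(\<integral>\<^sup>+y. ?f m y \<partial>error_law) = ennreal (2 ^ m) * (\<integral>\<^sup>+y. indicator (good_errors N \<delta>) y * q m y \<partial>error_law)"
      by (rule nn_integral_cmult) measurable
    also have "\<dots> \<le> ennreal (2 ^ m) * ennreal (K * (1 / 2 ^ m) powr 1)"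
      unfolding q_def by (intro mult_left_mono K) auto
    also have "\<dots> = ennreal K" using K by (simp add: ennreal_mult[symmetric])
    finally show "(\<integral>\<^sup>+y. ?f m y \<partial>error_law) \<le> ennreal K" .
  qed
  also have "\<dots> < \<infinity>" by (simp add: Liminf_const)
  finally have "AE y in error_law. liminf (\<lambda>m. ?f m y) \<noteq> \<infinity>"
    by (intro nn_integral_PInf_AE) auto
  then show ?thesis
  proof (rule eventually_mono, intro impI)
    fix y assume y: "liminf (\<lambda>m. ?f m y) \<noteq> \<infinity>" "y \<in> good_errors N \<delta>"
    show "absolutely_continuous lborel (restricted_law N \<delta> y)"
      by (rule liminf_energy_imp_absolutely_continuous[OF restricted_law_finite])
         (use y in \<open>simp add: q_def less_top\<close>)
  qed
qed

lemma AE_conditional_law_absolutely_continuous: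
  assumes "- ln 2 < exponent"
  shows "AE y in error_law. absolutely_continuous lborel (conditional_law y)"
proof -
  define \<delta> where "\<delta> = min (- exponent) (ln 2 + exponent) / 4"
  have \<delta>: "0 < \<delta>" "exponent + 2 * \<delta> < 0" "2 * \<delta> - exponent < ln 2"
  proof -
    define m where "m = min (- exponent) (ln 2 + exponent)"
    have "0 < m" "m \<le> - exponent" "m \<le> ln 2 + exponent" using assms exponent_neg by (simp_all add: m_def)
    then show "0 < \<delta>" "exponent + 2 * \<delta> < 0" "2 * \<delta> - exponent < ln 2"
      unfolding \<delta>_def m_def[symmetric] by simp_all
  qed
  have ratio: "exp (2 * \<delta> - exponent) < 2"
    using \<delta>(3) by (metis exp_less_mono exp_ln zero_less_numeral)
  have "AE y in error_law. \<forall>N. 0 < N \<longrightarrow> y \<in> good_errors N \<delta> \<longrightarrow> absolutely_continuous lborel (restricted_law N \<delta> y)"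
    unfolding AE_all_countable using restricted_law_absolutely_continuous[OF _ \<delta>(2) ratio] by auto
  with AE_good_errors[OF \<delta>(1)] show ?thesis
  proof eventually_elim
    case (elim y)
    then obtain N0 where N0: "0 < N0" "y \<in> good_errors N0 \<delta>" by blast
    show ?case
      unfolding absolutely_continuous_def
    proof
      fix B :: "real set" assume B: "B \<in> null_sets lborel"
      then have Bm: "B \<in> sets borel" by (auto dest: null_setsD2)
      have "emeasure (conditional_law y) B = 0"
      proof (rule conditional_law_null_if_restricted_null[OF \<delta>(1) N0 Bm])
        fix N :: nat assume "0 < N" "y \<in> good_errors N \<delta>"
        then have "absolutely_continuous lborel (restricted_law N \<delta> y)" using elim(2) by blast
        then show "emeasure (restricted_law N \<delta> y) B = 0" using B unfolding absolutely_continuous_def by auto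
      qed
      then show "B \<in> null_sets (conditional_law y)" using Bm by (intro null_setsI) simp_all
    qed
  qed
qed

text \<open>The slack between t and s makes the energies at all dyadic scales summable in expectation.
  Allowing all exponents u \<le> t at once makes the exceptional set of y independent of u.\<close>

lemma AE_restricted_law_hausdorff_null:
  assumes N: "0 < N" and neg: "exponent + 2 * \<delta> < 0" and t: "0 < t" "t < s" "s \<le> 1"
    and ratio: "exp (s * (2 * \<delta> - exponent)) < 2"
  shows "AE y in error_law. y \<in> good_errors N \<delta> \<longrightarrow>
    (\<forall>A\<in>sets (borel :: real measure). \<forall>u. 0 \<le> u \<and> u \<le> t \<and> hausdorff_measure u A = 0 \<longrightarrow> emeasure (restricted_law N \<delta> y) A = 0)"
proof -
  define q where "q m y = (\<integral>\<^sup>+x. emeasure (restricted_law N \<delta> y) (cball x (1 / 2 ^ m)) \<partial>restricted_law N \<delta> y)"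
    for m :: nat and y
  have qm[measurable]: "q m \<in> borel_measurable error_law" for m
    unfolding q_def by (rule restricted_energy_measurable)
  obtain K where K: "0 \<le> K" "\<And>r. 0 < r \<Longrightarrow>
    (\<integral>\<^sup>+y. indicator (good_errors N \<delta>) y * (\<integral>\<^sup>+x. emeasure (restricted_law N \<delta> y) (cball x r) \<partial>restricted_law N \<delta> y) \<partial>error_law)
    \<le> ennreal (K * r powr s)"
    using expected_restricted_energy_le[OF N neg _ t(3) ratio] t by auto
  let ?f = "\<lambda>m y. ennreal (2 powr (t * real m)) * (indicator (good_errors N \<delta>) y * q m y)"
  define \<theta> where "\<theta> = 2 powr (t - s)"
  have \<theta>: "0 < \<theta>" "\<theta> < 1" using t by (auto simp: \<theta>_def powr_less_one)
  have "(\<integral>\<^sup>+y. (\<Sum>m. ?f m y) \<partial>error_law) = (\<Sum>m. \<integral>\<^sup>+y. ?f m y \<partial>error_law)"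
    by (rule nn_integral_suminf) measurable
  also have "\<dots> \<le> (\<Sum>m. ennreal (K * \<theta> ^ m))"
  proof (intro suminf_le summableI)
    fix m
    have "(\<integral>\<^sup>+y. ?f m y \<partial>error_law) = ennreal (2 powr (t * real m)) * (\<integral>\<^sup>+y. indicator (good_errors N \<delta>) y * q m y \<partial>error_law)"
      by (rule nn_integral_cmult) measurable
    also have "\<dots> \<le> ennreal (2 powr (t * real m)) * ennreal (K * (1 / 2 ^ m) powr s)"
      unfolding q_def by (intro mult_left_mono K) auto
    also have "\<dots> = ennreal (2 powr (t * real m) * (K * (1 / 2 ^ m) powr s))"
      by (rule ennreal_mult[symmetric]) (use K in auto)
    also have "2 powr (t * real m) * (K * (1 / 2 ^ m) powr s) = K * \<theta> ^ m"
    proof -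
      have "(1 / 2 ^ m) powr s = 2 powr (- (s * real m))"
        by (simp add: powr_divide powr_minus_divide powr_powr powr_realpow[symmetric] mult.commute)
      moreover have "\<theta> ^ m = 2 powr ((t - s) * real m)"
        by (simp add: \<theta>_def powr_powr powr_realpow[symmetric])
      ultimately show ?thesis by (simp add: powr_add[symmetric] algebra_simps)
    qed
    finally show "(\<integral>\<^sup>+y. ?f m y \<partial>error_law) \<le> ennreal (K * \<theta> ^ m)" .
  qed
  also have "\<dots> < \<infinity>"
    using K \<theta> by (subst suminf_ennreal2) (auto intro!: summable_mult summable_geometric)
  finally have "AE y in error_law. (\<Sum>m. ?f m y) \<noteq> \<infinity>"
    by (intro nn_integral_PInf_AE) auto
  then show ?thesis
  proof (rule eventually_mono, intro impI ballI allI)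
    fix y u and A :: "real set" assume y: "(\<Sum>m. ?f m y) \<noteq> \<infinity>" "y \<in> good_errors N \<delta>" and A: "A \<in> sets borel"
      and u: "0 \<le> u \<and> u \<le> t \<and> hausdorff_measure u A = 0"
    show "emeasure (restricted_law N \<delta> y) A = 0"
      by (rule finite_energy_imp_hausdorff_null_is_null[OF restricted_law_finite, of u t])
         (use y A u in \<open>simp_all add: q_def less_top\<close>)
  qed
qed

text \<open>The exponent s is the midpoint between t and the dimension; \<delta> is so small that both the sums converge
  and the geometric ratio stays below 1.\<close>

lemma AE_conditional_law_hausdorff_null:
  assumes dim: "ln 2 \<le> - exponent" and t: "0 < t" "t < ln 2 / (- exponent)"
  shows "AE y in error_law. \<forall>A\<in>sets (borel :: real measure). \<forall>u. 0 \<le> u \<and> u \<le> t \<and> hausdorff_measure u A = 0 \<longrightarrow> emeasure (conditional_law y) A = 0"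
proof -
  define s where "s = (t + ln 2 / (- exponent)) / 2"
  have D1: "ln 2 / (- exponent) \<le> 1" using dim exponent_neg by (intro divide_le_eq_1_pos[THEN iffD2]) auto
  have s: "t < s" "s < ln 2 / (- exponent)" "s \<le> 1" "0 < s"
  proof -
    define D where "D = ln 2 / (- exponent)"
    have "t < D" "D \<le> 1" "s = (t + D) / 2" using t D1 unfolding D_def s_def by blast+
    then show "t < s" "s < ln 2 / (- exponent)" "s \<le> 1" "0 < s"
      using t(1) unfolding D_def[symmetric] by simp_all
  qed
  have gap: "s * (- exponent) < ln 2" by (rule pos_less_divide_eq[THEN iffD1, OF _ s(2)]) (use exponent_neg in simp)
  define \<delta> where "\<delta> = min (- exponent) ((ln 2 - s * (- exponent)) / s) / 4"
  have \<delta>: "0 < \<delta>" "exponent + 2 * \<delta> < 0"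
  proof -
    define m where "m = min (- exponent) ((ln 2 - s * (- exponent)) / s)"
    have "0 < m" "m \<le> - exponent" using gap s exponent_neg by (simp_all add: m_def)
    then show "0 < \<delta>" "exponent + 2 * \<delta> < 0"
      unfolding \<delta>_def m_def[symmetric] by simp_all
  qed
  have "s * \<delta> \<le> (ln 2 - s * (- exponent)) / 4"
  proof -
    have "\<delta> \<le> (ln 2 - s * (- exponent)) / s / 4" unfolding \<delta>_def by (intro divide_right_mono) auto
    then have "s * \<delta> \<le> s * ((ln 2 - s * (- exponent)) / s / 4)" using s by (intro mult_left_mono) auto
    then show ?thesis using s by simp
  qed
  then have "s * (2 * \<delta> - exponent) < ln 2" using gap by (simp add: algebra_simps)
  then have ratio: "exp (s * (2 * \<delta> - exponent)) < 2"
    by (metis exp_less_mono exp_ln zero_less_numeral)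
  have "AE y in error_law. \<forall>N. 0 < N \<longrightarrow> y \<in> good_errors N \<delta> \<longrightarrow>
      (\<forall>A\<in>sets (borel :: real measure). \<forall>u. 0 \<le> u \<and> u \<le> t \<and> hausdorff_measure u A = 0 \<longrightarrow> emeasure (restricted_law N \<delta> y) A = 0)"
    unfolding AE_all_countable using AE_restricted_law_hausdorff_null[OF _ \<delta>(2) t(1) s(1,3) ratio] by auto
  with AE_good_errors[OF \<delta>(1)] show ?thesis
  proof eventually_elim
    case (elim y)
    then obtain N0 where N0: "0 < N0" "y \<in> good_errors N0 \<delta>" by blast
    show ?case
    proof (intro ballI allI impI)
      fix u and A :: "real set" assume A: "A \<in> sets borel" and u: "0 \<le> u \<and> u \<le> t \<and> hausdorff_measure u A = 0"
      show "emeasure (conditional_law y) A = 0"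
        by (rule conditional_law_null_if_restricted_null[OF \<delta>(1) N0 A]) (use elim(2) A u in blast)
    qed
  qed
qed

text \<open>A sequence of exponents increasing to the dimension yields one exceptional set for all smaller
  exponents.\<close>

lemma AE_dim_conditional_law_ge:
  assumes dim: "ln 2 \<le> - exponent"
  shows "AE y in error_law. ennreal (ln 2 / (- exponent)) \<le> hausdorff_dim_measure (conditional_law y)"
proof -
  define D where "D = ln 2 / (- exponent)"
  define t where "t k = D * (1 - 1 / real (k + 2))" for k :: nat
  have D: "0 < D" using exponent_neg by (simp add: D_def divide_pos_neg)
  have t: "0 < t k" "t k < D" for k 
  proof -
    have x: "0 < 1 / real (k + 2)" "1 / real (k + 2) < 1" by simp_all
    show "0 < t k" unfolding t_def using D x by (intro mult_pos_pos) linarith+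
    show "t k < D" unfolding t_def using mult_strict_left_mono[OF _ D, of "1 - 1 / real (k + 2)" 1] x by simp
  qed
  have "AE y in error_law. \<forall>k. \<forall>A\<in>sets (borel :: real measure). \<forall>u. 0 \<le> u \<and> u \<le> t k \<and> hausdorff_measure u A = 0 \<longrightarrow> emeasure (conditional_law y) A = 0"
    unfolding AE_all_countable using AE_conditional_law_hausdorff_null[OF dim t(1)] t(2) by (simp add: D_def)
  then show ?thesis
  proof (rule eventually_mono)
    fix y assume y: "\<forall>k. \<forall>A\<in>sets (borel :: real measure). \<forall>u. 0 \<le> u \<and> u \<le> t k \<and> hausdorff_measure u A = 0 \<longrightarrow> emeasure (conditional_law y) A = 0"
    interpret F: prob_space "conditional_law y" by (rule prob_space_conditional_law)
    have "ennreal D \<le> ennreal u"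
      if A: "UNIV - A \<in> null_sets (conditional_law y)" and u: "0 \<le> u" "hausdorff_measure u A = 0" for A u
    proof (rule ccontr)
      assume "\<not> ennreal D \<le> ennreal u"
      then have "u < D" by (meson ennreal_leI not_le)
      have "t \<longlonglongrightarrow> D * (1 - 0)"
        unfolding t_def
        by (intro tendsto_mult tendsto_diff tendsto_const LIMSEQ_ignore_initial_segment[OF lim_1_over_n])
      then have "\<forall>\<^sub>F k in sequentially. u < t k" using \<open>u < D\<close> by (intro order_tendstoD) auto
      then obtain k where k: "u < t k" using eventually_happens'[OF sequentially_bot] by blast
      have "UNIV - A \<in> sets borel" using A by (auto dest: null_setsD2)
      then have Am: "A \<in> sets borel" by (metis Compl_eq_Diff_UNIV borel_comp double_compl)
      have "emeasure (conditional_law y) A = 0" using y Am u k by (metis less_imp_le)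
      moreover have "emeasure (conditional_law y) UNIV \<le> emeasure (conditional_law y) A + emeasure (conditional_law y) (UNIV - A)"
        using emeasure_subadditive[of A "conditional_law y" "UNIV - A"] Am by simp
      moreover have "emeasure (conditional_law y) (UNIV - A) = 0" using A by auto
      ultimately show False using F.emeasure_space_1 by simp
    qed
    then have "ennreal D \<le> hausdorff_dim_measure (conditional_law y)"
      unfolding hausdorff_dim_measure_def hausdorff_dim_def by (auto intro!: Inf_greatest)
    then show "ennreal (ln 2 / (- exponent)) \<le> hausdorff_dim_measure (conditional_law y)" by (simp add: D_def)
  qed
qed

text \<open>The 2^n words of signs are enumerated by the binary digits of j.\<close>

definition cylinder_center :: "nat \<Rightarrow> (nat \<Rightarrow> real) \<Rightarrow> nat \<Rightarrow> real" where
  "cylinder_center n y j = partial_sum n (\<lambda>i. if bit j i then 1 + a else 1 - a) y"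

lemma partial_sum_is_cylinder_center:
  assumes "\<And>i. l i = 1 - a \<or> l i = 1 + a"
  obtains j where "j < 2 ^ n" "partial_sum n l y = cylinder_center n y j"
proof -
  obtain j :: nat where j: "j < 2 ^ n" "\<And>i. i < n \<Longrightarrow> bit j i \<longleftrightarrow> l i = 1 + a"
    using nat_with_bits[of n "\<lambda>i. l i = 1 + a"] by blast
  have "l i = (if bit j i then 1 + a else 1 - a)" if "i < n" for i
    using j(2)[OF that] assms[of i] by auto
  then have "partial_sum n l y = cylinder_center n y j"
    unfolding partial_sum_def cylinder_center_def
    by (intro arg_cong2[where f="(+)"] sum.cong prod.cong refl) auto
  then show thesis using that j(1) by blast
qed

text \<open>The limsup over k of the \<rho> k-neighbourhoods of all partial sums of length n k. That the approximation is
  good only infinitely often suffices, which matters in the critical case.\<close>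

lemma conditional_law_carried_by_small_set:
  assumes s: "0 < s" and \<rho>: "\<And>k. 0 \<le> \<rho> k" "\<rho> \<longlonglongrightarrow> 0"
    and sum: "summable (\<lambda>k. 2 ^ n k * (2 * \<rho> k) powr s)"
    and io: "AE l in sign_law. \<exists>\<^sub>F k in sequentially. \<bar>random_sum l y - partial_sum (n k) l y\<bar> \<le> \<rho> k"
  obtains A where "A \<in> sets borel" "UNIV - A \<in> null_sets (conditional_law y)" "hausdorff_measure s A = 0"
proof -
  define A where "A = (\<Inter>K. \<Union>k\<in>{K..}. \<Union>j<(2::nat) ^ n k. cball (cylinder_center (n k) y j) (\<rho> k))"
  have Am: "A \<in> sets borel" unfolding A_def by (intro sets.countable_INT sets.countable_UN' sets.countable_UN) auto
  moreover have "hausdorff_measure s A = 0"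
    unfolding A_def by (rule hausdorff_measure_limsup_cballs_null[OF s \<rho>]) (use sum in simp)
  moreover have "UNIV - A \<in> null_sets (conditional_law y)"
  proof (rule null_setsI)
    have "AE l in sign_law. random_sum l y \<notin> UNIV - A"
      using io AE_signs
    proof eventually_elim
      case (elim l)
      have "random_sum l y \<in> A"
        unfolding A_def
      proof
        fix K
        obtain k where k: "K \<le> k" "\<bar>random_sum l y - partial_sum (n k) l y\<bar> \<le> \<rho> k"
          using elim(1) by (auto simp: frequently_sequentially)
        obtain j where j: "j < 2 ^ n k" "partial_sum (n k) l y = cylinder_center (n k) y j"
          using partial_sum_is_cylinder_center elim(2) by blast
        have "random_sum l y \<in> cball (cylinder_center (n k) y j) (\<rho> k)"
          using k(2) j(2) by (simp add: dist_real_def abs_minus_commute)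
        then show "random_sum l y \<in> (\<Union>k\<in>{K..}. \<Union>j<(2::nat) ^ n k. cball (cylinder_center (n k) y j) (\<rho> k))"
          using k(1) j(1) by blast
      qed
      then show ?case by simp
    qed
    then show "emeasure (conditional_law y) (UNIV - A) = 0"
      using conditional_law_null_iff[of "UNIV - A" y] Am by auto
    show "UNIV - A \<in> sets (conditional_law y)" using Am by auto
  qed
  ultimately show thesis using that by blast
qed

text \<open>Lebesgue measure itself satisfies the ball bound with exponent 1.\<close>

lemma mutually_singular_if_hausdorff_1_null:
  assumes A: "A \<in> sets borel" "UNIV - A \<in> null_sets (conditional_law y)" "hausdorff_measure 1 A = 0"
  shows "mutually_singular lborel (conditional_law y)"
proof -
  have "emeasure lborel A = 0"
  proof (rule mass_distribution_null[of lborel 1 2])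
    fix x r :: real assume "0 < r"
    moreover have "cball x r = {x - r .. x + r}" by (auto simp: dist_real_def)
    ultimately show "emeasure lborel (cball x r) \<le> ennreal (2 * r powr 1)" by simp
  qed (use A in auto)
  then show ?thesis
    unfolding mutually_singular_def using A by (intro bexI[of _ A]) auto
qed

text \<open>The tail after n terms is O(exp (n (\<chi> + 2 \<delta>))) with a constant that depends on the sequences; the
  radius exp (n (\<chi> + 3 \<delta>)) absorbs it for large n.\<close>

lemma AE_conditional_law_carried_by_small_set:
  assumes s: "ln 2 / (- exponent) < s"
  shows "AE y in error_law. \<exists>A\<in>sets borel. UNIV - A \<in> null_sets (conditional_law y) \<and> hausdorff_measure s A = 0"
proof -
  have "0 < ln 2 / (- exponent)" using exponent_neg by (intro divide_pos_pos) auto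
  then have s0: "0 < s" using s by linarith
  have gap: "ln 2 < s * (- exponent)"
    by (rule pos_divide_less_eq[THEN iffD1, OF _ s]) (use exponent_neg in simp)
  define \<delta> where "\<delta> = (s * (- exponent) - ln 2) / (4 * s)"
  have \<delta>: "0 < \<delta>" using gap s0 by (simp add: \<delta>_def)
  have s\<delta>: "s * \<delta> = (s * (- exponent) - ln 2) / 4" using s0 by (simp add: \<delta>_def)
  have "s * (exponent + 3 * \<delta>) < - ln 2" using s\<delta> gap by (simp add: algebra_simps)
  moreover have "- ln 2 < (0::real)" by simp
  ultimately have "s * (exponent + 3 * \<delta>) < 0" by linarith
  then have neg3: "exponent + 3 * \<delta> < 0" using s0 by (simp add: mult_less_0_iff)
  then have neg2: "exponent + 2 * \<delta> < 0" using \<delta> by linarith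
  define \<rho> where "\<rho> k = exp (exponent + 3 * \<delta>) ^ k" for k :: nat
  define \<theta> where "\<theta> = exp (s * (exponent + 3 * \<delta>))"
  have "\<theta> < exp (- ln 2)" using \<open>s * (exponent + 3 * \<delta>) < - ln 2\<close> by (simp add: \<theta>_def)
  then have \<theta>: "0 < \<theta>" "2 * \<theta> < 1" by (simp_all add: \<theta>_def exp_minus field_simps)
  have \<rho>0: "0 \<le> \<rho> k" for k by (simp add: \<rho>_def)
  have \<rho>lim: "\<rho> \<longlonglongrightarrow> 0" unfolding \<rho>_def using neg3 by (intro LIMSEQ_power_zero) simp
  have "2 ^ k * (2 * \<rho> k) powr s = 2 powr s * (2 * \<theta>) ^ k" for k
  proof -
    have "\<rho> k powr s = \<theta> ^ k"
      by (simp add: \<rho>_def \<theta>_def powr_def exp_of_nat_mult[symmetric] mult_ac)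
    then show ?thesis by (simp add: powr_mult \<rho>0 power_mult_distrib)
  qed
  then have sum: "summable (\<lambda>k. 2 ^ k * (2 * \<rho> k) powr s)"
    using \<theta> by (simp only:) (intro summable_mult summable_geometric, simp)
  show ?thesis
    using AE_good_errors[OF \<delta>]
  proof (rule eventually_mono)
    fix y assume "\<exists>N>0. y \<in> good_errors N \<delta>"
    then obtain N0 where N0: "0 < N0" "y \<in> good_errors N0 \<delta>" by blast
    have "AE l in sign_law. \<exists>\<^sub>F k in sequentially. \<bar>random_sum l y - partial_sum k l y\<bar> \<le> \<rho> k"
      using AE_good_signs[OF \<delta>]
    proof (rule eventually_mono)
      fix l assume "\<exists>N>0. l \<in> good_signs N \<delta>"
      then obtain N1 where N1: "0 < N1" "l \<in> good_signs N1 \<delta>" by blast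
      define N where "N = max N0 N1"
      have N: "0 < real N" "controlled_growth (real N) exponent \<delta> l" "controlled_growth (real N) 0 \<delta> y"
        using good_mono(1)[of N1 N \<delta>] good_mono(2)[of N0 N \<delta>] N0 N1
        by (auto simp: N_def good_signs_def good_errors_def)
      define c where "c = (real N)\<^sup>2 / (1 - exp (exponent + 2 * \<delta>))"
      have tail: "\<bar>random_sum l y - partial_sum k l y\<bar> \<le> c * exp (exponent + 2 * \<delta>) ^ k" for k
        unfolding c_def by (rule random_sum_tail_le[OF N(2,1,3) neg2])
      have "(\<lambda>k. c * exp (- \<delta>) ^ k) \<longlonglongrightarrow> c * 0"
        using \<delta> by (intro tendsto_mult tendsto_const LIMSEQ_power_zero) simp
      then have "\<forall>\<^sub>F k in sequentially. c * exp (- \<delta>) ^ k < 1" by (intro order_tendstoD) auto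
      then have "\<forall>\<^sub>F k in sequentially. \<bar>random_sum l y - partial_sum k l y\<bar> \<le> \<rho> k"
      proof (rule eventually_mono)
        fix k assume k: "c * exp (- \<delta>) ^ k < 1"
        have "exp (exponent + 2 * \<delta>) = exp (- \<delta>) * exp (exponent + 3 * \<delta>)"
          by (simp add: exp_add[symmetric])
        then have "c * exp (exponent + 2 * \<delta>) ^ k = (c * exp (- \<delta>) ^ k) * \<rho> k"
          by (simp add: \<rho>_def power_mult_distrib)
        also have "\<dots> \<le> 1 * \<rho> k" using k \<rho>0 by (intro mult_right_mono) auto
        finally show "\<bar>random_sum l y - partial_sum k l y\<bar> \<le> \<rho> k" using tail[of k] by simp
      qed
      then show "\<exists>\<^sub>F k in sequentially. \<bar>random_sum l y - partial_sum k l y\<bar> \<le> \<rho> k"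
        by (rule eventually_frequently[OF sequentially_bot])
    qed
    then show "\<exists>A\<in>sets borel. UNIV - A \<in> null_sets (conditional_law y) \<and> hausdorff_measure s A = 0"
      using conditional_law_carried_by_small_set[OF s0 \<rho>0 \<rho>lim sum] by blast
  qed
qed

lemma AE_dim_conditional_law_le:
  "AE y in error_law. hausdorff_dim_measure (conditional_law y) \<le> ennreal (ln 2 / (- exponent))"
proof -
  define D where "D = ln 2 / (- exponent)"
  have D: "0 < D" unfolding D_def using exponent_neg by (intro divide_pos_pos) auto
  have "AE y in error_law. \<forall>k::nat. \<exists>A\<in>sets borel. UNIV - A \<in> null_sets (conditional_law y) \<and> hausdorff_measure (D + 1 / real (Suc k)) A = 0"
    unfolding AE_all_countable by (intro allI AE_conditional_law_carried_by_small_set) (simp add: D_def)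
  then show ?thesis
  proof (rule eventually_mono)
    fix y assume y: "\<forall>k::nat. \<exists>A\<in>sets borel. UNIV - A \<in> null_sets (conditional_law y) \<and> hausdorff_measure (D + 1 / real (Suc k)) A = 0"
    have "hausdorff_dim_measure (conditional_law y) \<le> ennreal D"
    proof (rule ennreal_le_epsilon)
      fix e :: real assume e: "0 < e"
      obtain k where k: "1 / real (Suc k) < e" using nat_approx_posE[OF e] by (metis One_nat_def)
      obtain A where A: "UNIV - A \<in> null_sets (conditional_law y)" "hausdorff_measure (D + 1 / real (Suc k)) A = 0" using y by blast
      have "hausdorff_dim_measure (conditional_law y) \<le> hausdorff_dim A"
        unfolding hausdorff_dim_measure_def using A by (intro Inf_lower) auto
      also have "\<dots> \<le> ennreal (D + 1 / real (Suc k))"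
        unfolding hausdorff_dim_def using A D by (intro Inf_lower CollectI exI[of _ "D + 1 / real (Suc k)"]) auto
      also have "\<dots> \<le> ennreal (D + e)" using k by (intro ennreal_leI) simp
      also have "\<dots> = ennreal D + ennreal e" using D e by simp
      finally show "hausdorff_dim_measure (conditional_law y) \<le> ennreal D + ennreal e" .
    qed
    then show "hausdorff_dim_measure (conditional_law y) \<le> ennreal (ln 2 / (- exponent))" by (simp add: D_def)
  qed
qed

text \<open>In the critical case signs and errors are used jointly, through the single independent sequence of the
  products.\<close>

definition product_law :: "real measure" where
  "product_law = distr (\<eta> \<Otimes>\<^sub>M \<beta>) borel (\<lambda>(t, x). x * t)"

lemma product_measurable [measurable]: "(\<lambda>(t, x). x * t) \<in> borel_measurable (\<eta> \<Otimes>\<^sub>M \<beta>)"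
  unfolding case_prod_beta' by measurable

lemma prob_space_product_law: "prob_space product_law"
proof -
  interpret EB: pair_prob_space \<eta> \<beta> ..
  show ?thesis unfolding product_law_def by (rule EB.prob_space_distr) measurable
qed

lemma sets_product_law [simp, measurable_cong]: "sets product_law = sets borel"
  by (simp add: product_law_def)

lemma measurable_products:
  "(\<lambda>(y, l) i. l i * y i) \<in> measurable (error_law \<Otimes>\<^sub>M sign_law) (\<Pi>\<^sub>M i\<in>(UNIV::nat set). product_law)"
  unfolding case_prod_beta' by (intro measurable_abs_UNIV) measurable

lemma emeasure_product_law:
  assumes B: "B \<in> sets borel"
  shows "emeasure product_law B = (\<integral>\<^sup>+t. emeasure \<beta> {x. x * t \<in> B} \<partial>\<eta>)"
    and "(\<lambda>t. emeasure \<beta> {x. x * t \<in> B}) \<in> borel_measurable \<eta>"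
proof -
  let ?S = "(\<lambda>(t, x). x * t) -` B \<inter> space (\<eta> \<Otimes>\<^sub>M \<beta>)"
  have S: "?S \<in> sets (\<eta> \<Otimes>\<^sub>M \<beta>)" by (rule measurable_sets[OF product_measurable B])
  have V: "Pair t -` ?S = {x. x * t \<in> B}" for t by (auto simp: space_pair_measure)
  have "emeasure product_law B = emeasure (\<eta> \<Otimes>\<^sub>M \<beta>) ?S"
    unfolding product_law_def by (rule emeasure_distr[OF product_measurable B])
  also have "\<dots> = (\<integral>\<^sup>+t. emeasure \<beta> (Pair t -` ?S) \<partial>\<eta>)" by (rule \<beta>.emeasure_pair_measure_alt[OF S])
  finally show "emeasure product_law B = (\<integral>\<^sup>+t. emeasure \<beta> {x. x * t \<in> B} \<partial>\<eta>)" unfolding V .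
  show "(\<lambda>t. emeasure \<beta> {x. x * t \<in> B}) \<in> borel_measurable \<eta>"
    using \<beta>.measurable_emeasure_Pair[OF S] unfolding V .
qed

text \<open>On cylinder sets: for fixed errors the conditions on the signs are independent, and the resulting
  functions of the individual errors are independent as well.\<close>

lemma distr_products:
  "distr (error_law \<Otimes>\<^sub>M sign_law) (\<Pi>\<^sub>M i\<in>(UNIV::nat set). product_law) (\<lambda>(y, l) i. l i * y i)
    = (\<Pi>\<^sub>M i\<in>(UNIV::nat set). product_law)"
proof (rule measure_eqI_PiM_infinite)
  interpret PS: pair_prob_space error_law sign_law ..
  interpret B: product_prob_space "\<lambda>_. \<beta>" "UNIV :: nat set" by (intro product_prob_spaceI) unfold_locales
  interpret Q: product_prob_space "\<lambda>_. product_law" "UNIV :: nat set"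
    by (intro product_prob_spaceI prob_space_product_law)
  let ?f = "\<lambda>(y, l) i. l i * y (i::nat) :: real"
  let ?Q = "\<Pi>\<^sub>M i\<in>(UNIV::nat set). product_law"
  show "finite_measure (distr (error_law \<Otimes>\<^sub>M sign_law) ?Q ?f)"
    by (rule prob_space.finite_measure[OF PS.prob_space_distr[OF measurable_products]])
  fix A :: "nat \<Rightarrow> real set" and J :: "nat set"
  assume J: "finite J" and "\<And>i. i \<in> J \<Longrightarrow> A i \<in> sets product_law"
  then have A: "A i \<in> sets borel" if "i \<in> J" for i using that by simp
  let ?E = "prod_emb UNIV (\<lambda>_. product_law) J (Pi\<^sub>E J A)"
  have E: "?E \<in> sets ?Q" using J A by (intro sets_PiM_I) auto
  have spc[simp]: "space product_law = UNIV" using sets_eq_imp_space_eq[OF sets_product_law] by simp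
  have E_eq: "?E = {z. \<forall>i\<in>J. z i \<in> A i}" by (auto simp: prod_emb_def PiE_iff)
  let ?S = "?f -` ?E \<inter> space (error_law \<Otimes>\<^sub>M sign_law)"
  have S: "?S \<in> sets (error_law \<Otimes>\<^sub>M sign_law)" by (rule measurable_sets[OF measurable_products E])
  have xm: "{x. x * t \<in> A i} \<in> sets \<beta>" if "i \<in> J" for i t
  proof -
    have "(\<lambda>x. x * t) \<in> borel_measurable \<beta>" by measurable
    from measurable_sets[OF this A[OF that]] show ?thesis by (simp add: vimage_def)
  qed
  have "emeasure (distr (error_law \<Otimes>\<^sub>M sign_law) ?Q ?f) ?E = emeasure (error_law \<Otimes>\<^sub>M sign_law) ?S"
    by (rule emeasure_distr[OF measurable_products E])
  also have "\<dots> = (\<integral>\<^sup>+y. emeasure sign_law (Pair y -` ?S) \<partial>error_law)" by (rule L.emeasure_pair_measure_alt[OF S])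
  also have "\<dots> = (\<integral>\<^sup>+y. (\<Prod>i\<in>J. emeasure \<beta> {x. x * y i \<in> A i}) \<partial>error_law)"
  proof (rule nn_integral_cong)
    fix y
    have "Pair y -` ?S = {l \<in> space sign_law. \<forall>i\<in>J. l i \<in> {x. x * y i \<in> A i}}"
      unfolding E_eq by (auto simp: space_pair_measure)
    then show "emeasure sign_law (Pair y -` ?S) = (\<Prod>i\<in>J. emeasure \<beta> {x. x * y i \<in> A i})"
      using B.emeasure_PiM_Collect[of J "\<lambda>i. {x. x * y i \<in> A i}"] J xm by simp
  qed
  also have "\<dots> = (\<Prod>i\<in>J. \<integral>\<^sup>+y. emeasure \<beta> {x. x * y i \<in> A i} \<partial>error_law)"
  proof (rule P.indep_vars_nn_integral[OF J])
    have "P.indep_vars (\<lambda>_. \<eta>) (\<lambda>i \<omega>. \<omega> i) J"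
      by (rule P.indep_vars_subset[OF indep_vars_PiM_coordinates'[OF \<eta>.prob_space_axioms]]) simp
    then show "P.indep_vars (\<lambda>_. borel) (\<lambda>i \<omega>. emeasure \<beta> {x. x * \<omega> i \<in> A i}) J"
      by (rule P.indep_vars_compose2) (rule emeasure_product_law(2)[OF A])
  qed simp
  also have "\<dots> = (\<Prod>i\<in>J. emeasure product_law (A i))"
  proof (intro prod.cong refl)
    fix i assume i: "i \<in> J"
    interpret H: product_prob_space "\<lambda>_. \<eta>" "UNIV :: nat set" by (intro product_prob_spaceI) unfold_locales
    have "(\<integral>\<^sup>+y. emeasure \<beta> {x. x * y i \<in> A i} \<partial>error_law) = (\<integral>\<^sup>+t. emeasure \<beta> {x. x * t \<in> A i} \<partial>distr error_law \<eta> (\<lambda>y. y i))"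
      by (rule nn_integral_distr[symmetric]) (use emeasure_product_law(2)[OF A[OF i]] in auto)
    also have "\<dots> = emeasure product_law (A i)"
      using H.PiM_component[of i] emeasure_product_law(1)[OF A[OF i]] by simp
    finally show "(\<integral>\<^sup>+y. emeasure \<beta> {x. x * y i \<in> A i} \<partial>error_law) = emeasure product_law (A i)" .
  qed
  also have "\<dots> = emeasure ?Q ?E"
    using J A by (intro Q.emeasure_PiM_emb[symmetric]) auto
  finally show "emeasure (distr (error_law \<Otimes>\<^sub>M sign_law) ?Q ?f) ?E = emeasure ?Q ?E" .
qed simp_all

lemma AE_products:
  assumes "AE z in (\<Pi>\<^sub>M i\<in>(UNIV::nat set). product_law). Q z"
  shows "AE y in error_law. AE l in sign_law. Q (\<lambda>i. l i * y i)"
proof -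
  have "AE p in error_law \<Otimes>\<^sub>M sign_law. Q ((\<lambda>(y, l) i. l i * y i) p)"
    by (rule AE_distrD[OF measurable_products]) (unfold distr_products, rule assms)
  from PL.AE_pair[OF this] show ?thesis by simp
qed

lemma no_error_atoms: "emeasure \<eta> {t} = 0"
  using C(2)[of "{t}"] by simp

lemma AE_product_law:
  assumes Q: "AE t in \<eta>. Q ((1 - a) * t) \<and> Q ((1 + a) * t)" and [measurable]: "Measurable.pred borel Q"
  shows "AE z in product_law. Q z"
proof -
  have "AE t in \<eta>. AE x in \<beta>. Q (snd (t, x) * fst (t, x))"
  proof (rule eventually_mono[OF Q])
    fix t assume t: "Q ((1 - a) * t) \<and> Q ((1 + a) * t)"
    show "AE x in \<beta>. Q (snd (t, x) * fst (t, x))"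
      using AE_sign by (rule eventually_mono) (use t in auto)
  qed
  then have "AE p in \<eta> \<Otimes>\<^sub>M \<beta>. Q (snd p * fst p)"
  proof -
    interpret EB: pair_prob_space \<eta> \<beta> ..
    assume *: "AE t in \<eta>. AE x in \<beta>. Q (snd (t, x) * fst (t, x))"
    show ?thesis by (rule EB.AE_pair_measure[OF _ *]) measurable
  qed
  then show ?thesis unfolding product_law_def by (subst AE_distr_iff) (auto simp: case_prod_beta')
qed

lemma AE_product_bounds: "AE z in product_law. (1 - a) * lo \<le> z \<and> z \<le> (1 + a) * hi"
proof (rule AE_product_law)
  show "AE t in \<eta>. ((1 - a) * lo \<le> (1 - a) * t \<and> (1 - a) * t \<le> (1 + a) * hi) \<and>
      ((1 - a) * lo \<le> (1 + a) * t \<and> (1 + a) * t \<le> (1 + a) * hi)"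
    using errors_bounded by (rule eventually_mono) (use a lo in \<open>auto intro!: mult_mono\<close>)
qed measurable

lemma AE_product_ne: "AE z in product_law. z \<noteq> c" if "c \<noteq> 0"
proof (rule AE_product_law)
  have "AE t in \<eta>. t \<noteq> c / (1 - a)" "AE t in \<eta>. t \<noteq> c / (1 + a)"
    using no_error_atoms by (auto simp: AE_iff_measurable[OF _ refl] sets_\<eta>)
  then show "AE t in \<eta>. (1 - a) * t \<noteq> c \<and> (1 + a) * t \<noteq> c"
    by eventually_elim (use a in auto)
qed measurable

text \<open>The second moment is positive because ln (2 z) = 0 would force an error to be one of two values,
  and the errors have no atoms.\<close>

lemma product_walk_moments:
  assumes critical: "exponent = - ln 2"
  shows "integrable product_law (\<lambda>z. (ln (2 * z))\<^sup>2)" "(LINT z|product_law. ln (2 * z)) = 0"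
    "0 < (LINT z|product_law. (ln (2 * z))\<^sup>2)"
proof -
  interpret EB: pair_prob_space \<eta> \<beta> ..
  interpret M: prob_space product_law by (rule prob_space_product_law)
  have lo': "0 < (1 - a) * lo" using a lo by simp
  define K where "K = \<bar>ln (2 * ((1 - a) * lo))\<bar> + \<bar>ln (2 * ((1 + a) * hi))\<bar>"
  have bd: "AE z in product_law. \<bar>ln (2 * z)\<bar> \<le> K"
    using AE_product_bounds
  proof (rule eventually_mono)
    fix z assume z: "(1 - a) * lo \<le> z \<and> z \<le> (1 + a) * hi"
    then have "0 < z" using lo' by linarith
    then have "ln (2 * ((1 - a) * lo)) \<le> ln (2 * z)" "ln (2 * z) \<le> ln (2 * ((1 + a) * hi))"
      using z lo' by (intro ln_mono; simp)+
    then show "\<bar>ln (2 * z)\<bar> \<le> K" unfolding K_def by linarith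
  qed
  have int: "integrable product_law (\<lambda>z. ln (2 * z))"
    by (rule M.integrable_const_bound[OF _]) (use bd in auto)
  show sq: "integrable product_law (\<lambda>z. (ln (2 * z))\<^sup>2)"
  proof (rule M.integrable_const_bound)
    show "AE z in product_law. norm ((ln (2 * z))\<^sup>2) \<le> K\<^sup>2"
      using bd by (rule eventually_mono) (metis abs_ge_zero norm_power power2_abs power_mono real_norm_def)
  qed simp
  have pint: "integrable (\<eta> \<Otimes>\<^sub>M \<beta>) (\<lambda>(t, x). ln (2 * (x * t)))"
    using int unfolding product_law_def by (subst (asm) integrable_distr_eq) (auto simp: case_prod_beta')
  have "(LINT z|product_law. ln (2 * z)) = (LINT p|(\<eta> \<Otimes>\<^sub>M \<beta>). (case p of (t, x) \<Rightarrow> ln (2 * (x * t))))"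
    unfolding product_law_def by (subst integral_distr) (auto simp: case_prod_beta')
  also have "\<dots> = (LINT t|\<eta>. LINT x|\<beta>. ln (2 * (x * t)))"
    using EB.integral_fst'[OF pint] by simp
  also have "\<dots> = (LINT t|\<eta>. ln t)"
  proof (rule integral_cong_AE)
    show "AE t in \<eta>. (LINT x|\<beta>. ln (2 * (x * t))) = ln t"
      using errors_bounded
    proof (rule eventually_mono)
      fix t assume "t \<in> {lo..hi}"
      then have t: "0 < t" using lo by auto
      have "(LINT x|\<beta>. ln (2 * (x * t))) = (ln (2 * ((1 - a) * t)) + ln (2 * ((1 + a) * t))) / 2"
        by (rule sign_mean) simp
      also have "\<dots> = ln 2 + (ln (1 - a) + ln (1 + a)) / 2 + ln t"
        using t a by (simp add: ln_mult)
      also have "(ln (1 - a) + ln (1 + a)) / 2 = exponent"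
        using sign_log_mean sign_mean[of ln] by simp
      finally show "(LINT x|\<beta>. ln (2 * (x * t))) = ln t" using critical by simp
    qed
  qed auto
  finally show "(LINT z|product_law. ln (2 * z)) = 0" using errors_mean by simp
  have "(LINT z|product_law. (ln (2 * z))\<^sup>2) \<noteq> 0"
  proof
    assume "(LINT z|product_law. (ln (2 * z))\<^sup>2) = 0"
    then have "AE z in product_law. (ln (2 * z))\<^sup>2 = 0"
      using integral_nonneg_eq_0_iff_AE[OF sq] by simp
    moreover have "AE z in product_law. z \<noteq> 1 / 2" by (rule AE_product_ne) simp
    ultimately have "AE z in product_law. False"
      using AE_product_bounds
    proof eventually_elim
      case (elim z)
      then have "0 < 2 * z" "ln (2 * z) = 0" using lo' by auto
      then have "2 * z = 1" by (metis exp_ln exp_zero)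
      then show ?case using elim by simp
    qed
    then show False by (simp add: M.AE_False)
  qed
  then show "0 < (LINT z|product_law. (ln (2 * z))\<^sup>2)"
    by (simp add: less_le integral_nonneg_AE)
qed

text \<open>The remainder after n terms is p (R - 1), where p is the product of the first n factors and R the
  random sum of the shifted sequence. The logarithm of 2^n p R is the centred walk plus a function
  of the future, so infinitely often it is at most -k, and then the remainder is at most
  2^-n exp (-k): the 2^n intervals of that radius have total length O(exp (-k)).\<close>

lemma AE_conditional_law_singular_critical:
  assumes critical: "exponent = - ln 2"
  shows "AE y in error_law. mutually_singular lborel (conditional_law y)"
proof -
  let ?R = "\<lambda>z. random_sum z (\<lambda>_. 1)"
  have h: "(\<lambda>z. ln (?R z)) \<in> borel_measurable (\<Pi>\<^sub>M i\<in>(UNIV::nat set). product_law)"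
    by (intro borel_measurable_ln borel_measurable_random_sum) measurable
  obtain n :: "nat \<Rightarrow> nat" where n: "AE z in (\<Pi>\<^sub>M i\<in>UNIV. product_law).
      \<exists>\<^sub>F k in sequentially. (\<Sum>i<n k. ln (2 * z i)) + ln (?R (\<lambda>i. z (n k + i))) \<le> - real k"
    using centered_walk_below_io[OF prob_space_product_law _ product_walk_moments[OF critical] h] by auto
  define \<delta> where "\<delta> = (ln 2 :: real) / 4"
  have \<delta>: "0 < \<delta>" "exponent + 2 * \<delta> < 0" using critical by (simp_all add: \<delta>_def)
  define \<rho> where "\<rho> k = exp (- real k) / 2 ^ n k" for k
  have \<rho>0: "0 \<le> \<rho> k" for k by (simp add: \<rho>_def)
  have geo: "exp (- real k) = exp (- 1) ^ k" for k by (simp add: exp_of_nat_mult[symmetric])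
  have \<rho>lim: "\<rho> \<longlonglongrightarrow> 0"
  proof (rule tendsto_sandwich[OF _ _ tendsto_const])
    show "(\<lambda>k. exp (- 1 :: real) ^ k) \<longlonglongrightarrow> 0" by (rule LIMSEQ_power_zero) simp
    show "\<forall>\<^sub>F k in sequentially. \<rho> k \<le> exp (- 1) ^ k"
      by (intro always_eventually allI) (simp add: \<rho>_def geo[symmetric] divide_le_eq)
  qed (simp add: \<rho>0)
  have "2 ^ n k * (2 * \<rho> k) powr 1 = 2 * exp (- 1) ^ k" for k by (simp add: \<rho>_def geo[symmetric])
  then have sum: "summable (\<lambda>k. 2 ^ n k * (2 * \<rho> k) powr 1)"
    by (simp only:) (intro summable_mult summable_geometric, simp)
  show ?thesis
    using AE_products[OF n] AE_good_errors[OF \<delta>(1)] AE_PiM_all_coordinates[OF \<eta>.prob_space_axioms errors_bounded]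
  proof eventually_elim
    case (elim y)
    then obtain N0 where N0: "0 < N0" "y \<in> good_errors N0 \<delta>" by blast
    have "AE l in sign_law. \<exists>\<^sub>F k in sequentially. \<bar>random_sum l y - partial_sum (n k) l y\<bar> \<le> \<rho> k"
      using elim(1) AE_good_signs[OF \<delta>(1)]
    proof eventually_elim
      case (elim l)
      then obtain N1 where N1: "0 < N1" "l \<in> good_signs N1 \<delta>" by blast
      define N where "N = max N0 N1"
      have N: "0 < real N" "controlled_growth (real N) exponent \<delta> l" "controlled_growth (real N) 0 \<delta> y"
        using good_mono(1)[of N1 N \<delta>] good_mono(2)[of N0 N \<delta>] N0 N1
        by (auto simp: N_def good_signs_def good_errors_def)
      have pos: "0 < l i * y i" for i
      proof -
        have "l i = 1 - a \<or> l i = 1 + a" using N1 by (simp add: good_signs_def)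
        then have "0 < l i" using a by auto
        moreover have "0 < y i" using \<open>\<forall>i. y i \<in> {lo..hi}\<close> lo by (meson atLeastAtMost_iff less_le_trans)
        ultimately show ?thesis by simp
      qed
      have nz: "l i \<noteq> 0" "y i \<noteq> 0" for i using pos[of i] by auto
      have summ: "summable (\<lambda>k. \<Prod>i\<le>k. l i * y i)"
        by (rule summable_controlled_products[OF N(2,1,3) \<delta>(2)])
      show ?case
        using elim(1)
      proof (rule frequently_elim1)
        fix k assume k: "(\<Sum>i<n k. ln (2 * (l i * y i))) + ln (?R (\<lambda>i. l (n k + i) * y (n k + i))) \<le> - real k"
        define R where "R = random_sum (\<lambda>i. l (n k + i)) (\<lambda>i. y (n k + i))"
        define p where "p = (\<Prod>i<n k. l i * y i)"
        have p: "0 < p" unfolding p_def using pos by (intro prod_pos) auto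
        have split: "random_sum l y = partial_sum (n k) l y + p * (R - 1)"
          "summable (\<lambda>j. \<Prod>i\<le>j. l (n k + i) * y (n k + i))"
        proof -
          have nz: "(\<Prod>i<n k. l i * y i) \<noteq> 0" using p unfolding p_def by (rule less_imp_neq[symmetric])
          show "random_sum l y = partial_sum (n k) l y + p * (R - 1)"
            unfolding p_def R_def by (rule random_sum_split(1)[OF summ nz])
          show "summable (\<lambda>j. \<Prod>i\<le>j. l (n k + i) * y (n k + i))"
            by (rule random_sum_split(2)[OF summ nz])
        qed
        have R: "1 \<le> R"
          unfolding R_def random_sum_def using split(2) pos by (simp add: suminf_nonneg prod_nonneg less_imp_le)
        have "?R (\<lambda>i. l (n k + i) * y (n k + i)) = R" by (simp add: R_def random_sum_def)
        moreover have "(\<Sum>i<n k. ln (2 * (l i * y i))) = ln (2 ^ n k * p)"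
        proof -
          have "(\<Sum>i<n k. ln (2 * (l i * y i))) = ln (\<Prod>i<n k. 2 * (l i * y i))"
            by (rule ln_prod[symmetric]) (use nz in auto)
          also have "(\<Prod>i<n k. 2 * (l i * y i)) = 2 ^ n k * p" by (simp add: p_def prod.distrib)
          finally show ?thesis .
        qed
        ultimately have "ln (2 ^ n k * p) + ln R \<le> - real k" using k by simp
        moreover have "ln (2 ^ n k * p * R) = ln (2 ^ n k * p) + ln R"
          using p R by (intro ln_mult_pos) auto
        ultimately have "exp (ln (2 ^ n k * p * R)) \<le> exp (- real k)" by simp
        then have "2 ^ n k * p * R \<le> exp (- real k)" using p R by (subst (asm) exp_ln) auto
        then have "p * R \<le> \<rho> k" by (simp add: \<rho>_def field_simps)
        moreover have "\<bar>random_sum l y - partial_sum (n k) l y\<bar> = p * (R - 1)" using split(1) p R by simp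
        ultimately show "\<bar>random_sum l y - partial_sum (n k) l y\<bar> \<le> \<rho> k" using p by (simp add: algebra_simps)
      qed
    qed
    then obtain A where "A \<in> sets borel" "UNIV - A \<in> null_sets (conditional_law y)" "hausdorff_measure 1 A = 0"
      using conditional_law_carried_by_small_set[OF zero_less_one \<rho>0 \<rho>lim sum] by blast
    then show ?case by (rule mutually_singular_if_hausdorff_1_null)
  qed
qed

lemma AE_conditional_law_singular:
  assumes "exponent \<le> - ln 2"
  shows "AE y in error_law. mutually_singular lborel (conditional_law y)"
proof (cases "exponent = - ln 2")
  case False
  then have "ln 2 < - exponent" using assms by simp
  then have "ln 2 / (- exponent) < 1" using exponent_neg by (intro divide_less_eq_1_pos[THEN iffD2]) auto
  from AE_conditional_law_carried_by_small_set[OF this] show ?thesis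
    by (rule eventually_mono) (use mutually_singular_if_hausdorff_1_null in blast)
qed (rule AE_conditional_law_singular_critical)

end

section \<open>Passing to the canonical laws\<close>

lemma two_atom_law_unique:
  fixes N N' :: "real measure"
  assumes "prob_space N" "sets N = sets borel" "measure N {p} = 1 / 2" "measure N {q} = 1 / 2"
    and "prob_space N'" "sets N' = sets borel" "measure N' {p} = 1 / 2" "measure N' {q} = 1 / 2"
    and "p \<noteq> q"
  shows "N = N'"
proof -
  have prob: "emeasure K B = ennreal (indicator B p / 2 + indicator B q / 2)"
    if K: "prob_space K" "sets K = sets borel" "measure K {p} = 1 / 2" "measure K {q} = 1 / 2" and B: "B \<in> sets borel"
    for K :: "real measure" and B
  proof -
    interpret prob_space K by fact
    note [simp] = K(2)
    have "prob ({p} \<union> {q}) = 1"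
      using K \<open>p \<noteq> q\<close> by (subst finite_measure_Union) auto
    then have AE: "AE x in K. x \<in> {p} \<union> {q}"
      by (subst prob_eq_1[symmetric]) auto
    have "prob B = prob ((B \<inter> {p}) \<union> (B \<inter> {q}))"
      by (rule finite_measure_eq_AE) (use B in \<open>auto intro: eventually_mono[OF AE]\<close>)
    also have "\<dots> = prob (B \<inter> {p}) + prob (B \<inter> {q})"
      using B \<open>p \<noteq> q\<close> by (intro finite_measure_Union) auto
    also have "\<dots> = indicator B p / 2 + indicator B q / 2"
      using K(3,4) by (simp add: indicator_def)
    finally show ?thesis by (simp add: emeasure_eq_measure)
  qed
  show ?thesis
    using assms by (intro measure_eqI) (simp_all add: prob)
qed

theorem proposition1p1:
  fixes M :: "'w measure"
    and a \<epsilon>\<^sub>1 \<epsilon>\<^sub>2 C :: real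
    and Y :: "'w \<Rightarrow> real" and f :: "real \<Rightarrow> ennreal"
    and lam y :: "nat \<Rightarrow> 'w \<Rightarrow> real"
  assumes "prob_space M"
    and "0 < a" and "a < 1"
    and "0 < \<epsilon>\<^sub>1" and "\<epsilon>\<^sub>1 < 1" and "0 < \<epsilon>\<^sub>2"
    and "distributed M lborel Y f"
    and "\<And>x. f x \<le> ennreal C"
    and "AE \<omega> in M. Y \<omega> \<in> {1 - \<epsilon>\<^sub>1 <..< 1 + \<epsilon>\<^sub>2}"
    and "prob_space.expectation M (\<lambda>\<omega>. ln (Y \<omega>)) = 0"
    and "prob_space.indep_vars M (\<lambda>_. borel) lam UNIV"
    and "\<And>i. measure M {\<omega> \<in> space M. lam i \<omega> = 1 - a} = 1 / 2"
    and "\<And>i. measure M {\<omega> \<in> space M. lam i \<omega> = 1 + a} = 1 / 2"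
    and "prob_space.indep_vars M (\<lambda>_. borel) y UNIV"
    and "\<And>i. distr M borel (y i) = distr M borel Y"
    and "prob_space.indep_var M (\<Pi>\<^sub>M i\<in>UNIV. borel) (\<lambda>\<omega> i. lam i \<omega>)
                                (\<Pi>\<^sub>M i\<in>UNIV. borel) (\<lambda>\<omega> i. y i \<omega>)"
  shows "(a < sqrt 3 / 2 \<longrightarrow>
            (AE ys in seq_law M y. absolutely_continuous lborel (cond_law M lam ys))) \<and>
         (a \<ge> sqrt 3 / 2 \<longrightarrow>
            (AE ys in seq_law M y.
               mutually_singular lborel (cond_law M lam ys) \<and>
               hausdorff_dim_measure (cond_law M lam ys) =
                 ennreal (2 * ln 2 / ln (1 / (1 - a\<^sup>2)))))"
proof -
  interpret M: prob_space M by fact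
  note a_pos = \<open>0 < a\<close> and a_less = \<open>a < 1\<close>
  have ind_lam: "M.indep_vars (\<lambda>_. borel) lam UNIV" and ind_y: "M.indep_vars (\<lambda>_. borel) y UNIV" by fact+
  have lam_rv[measurable]: "lam i \<in> borel_measurable M" for i
    using ind_lam by (auto simp: M.indep_vars_def)
  have Y_dist: "distributed M lborel Y f" by fact
  have Y_rv[measurable]: "Y \<in> borel_measurable M"
    using distributed_measurable[OF Y_dist] by simp
  define \<beta> where "\<beta> = distr M borel (lam 0)"
  define \<eta> where "\<eta> = distr M borel Y"
  have sets_laws: "sets \<beta> = sets borel" "sets \<eta> = sets borel" by (simp_all add: \<beta>_def \<eta>_def)
  have atoms: "measure (distr M borel (lam i)) {1 - a} = 1 / 2" "measure (distr M borel (lam i)) {1 + a} = 1 / 2" for i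
  proof -
    have "lam i -` {c} \<inter> space M = {\<omega> \<in> space M. lam i \<omega> = c}" for c by auto
    then have "measure (distr M borel (lam i)) {c} = measure M {\<omega> \<in> space M. lam i \<omega> = c}" for c
      by (subst measure_distr) auto
    then show "measure (distr M borel (lam i)) {1 - a} = 1 / 2" "measure (distr M borel (lam i)) {1 + a} = 1 / 2"
      using \<open>\<And>i. measure M {\<omega> \<in> space M. lam i \<omega> = 1 - a} = 1 / 2\<close>
        \<open>\<And>i. measure M {\<omega> \<in> space M. lam i \<omega> = 1 + a} = 1 / 2\<close> by simp_all
  qed
  have lam_law: "distr M borel (lam i) = \<beta>" for i
    unfolding \<beta>_def
    by (rule two_atom_law_unique[OF M.prob_space_distr[OF lam_rv] _ atoms M.prob_space_distr[OF lam_rv] _ atoms])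
       (use a_pos in simp_all)
  have density: "emeasure \<eta> B \<le> ennreal (max 0 C) * emeasure lborel B" if B: "B \<in> sets borel" for B
  proof -
    have "distr M lborel Y = \<eta>" unfolding \<eta>_def by (intro distr_cong) simp_all
    then have "emeasure \<eta> B = emeasure (density lborel f) B"
      using distributed_distr_eq_density[OF Y_dist] by simp
    also have "\<dots> = (\<integral>\<^sup>+x. f x * indicator B x \<partial>lborel)"
      using distributed_borel_measurable[OF Y_dist] B by (intro emeasure_density) auto
    also have "\<dots> \<le> (\<integral>\<^sup>+x. ennreal C * indicator B x \<partial>lborel)"
      using \<open>\<And>x. f x \<le> ennreal C\<close> by (intro nn_integral_mono mult_right_mono) auto
    also have "\<dots> = ennreal C * emeasure lborel B" using B by (intro nn_integral_cmult_indicator) simp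
    also have "ennreal C = ennreal (max 0 C)" by (simp add: max_def ennreal_neg)
    finally show ?thesis .
  qed
  interpret R: random_signs_and_errors \<beta> \<eta> a "1 - \<epsilon>\<^sub>1" "1 + \<epsilon>\<^sub>2" "max 0 C"
  proof (intro random_signs_and_errors.intro random_signs_and_errors_axioms.intro)
    show "prob_space \<beta>" "prob_space \<eta>" unfolding \<beta>_def \<eta>_def by (intro M.prob_space_distr; simp)+
    show "AE t in \<eta>. t \<in> {1 - \<epsilon>\<^sub>1..1 + \<epsilon>\<^sub>2}"
      unfolding \<eta>_def using \<open>AE \<omega> in M. Y \<omega> \<in> {1 - \<epsilon>\<^sub>1 <..< 1 + \<epsilon>\<^sub>2}\<close>
      by (subst AE_distr_iff) (simp, simp, erule eventually_mono, simp)
    show "(LINT t|\<eta>. ln t) = 0"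
      unfolding \<eta>_def using \<open>M.expectation (\<lambda>\<omega>. ln (Y \<omega>)) = 0\<close> by (subst integral_distr) auto
  qed (use a_pos a_less sets_laws atoms[of 0] density \<open>\<epsilon>\<^sub>1 < 1\<close> \<open>0 < \<epsilon>\<^sub>1\<close> \<open>0 < \<epsilon>\<^sub>2\<close> in \<open>simp_all add: \<beta>_def\<close>)
  have seq_y: "seq_law M y = R.error_law"
    by (rule M.seq_law_iid[OF ind_y]) (use \<open>\<And>i. distr M borel (y i) = distr M borel Y\<close> in \<open>simp add: \<eta>_def\<close>)
  have seq_lam: "seq_law M lam = R.sign_law"
    by (rule M.seq_law_iid[OF ind_lam lam_law])
  have cond: "cond_law M lam ys = R.conditional_law ys" for ys
  proof -
    have "(\<lambda>l. random_sum l ys) \<in> borel_measurable (\<Pi>\<^sub>M i\<in>(UNIV::nat set). borel)"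
      by (rule borel_measurable_random_sum) simp_all
    moreover have "(\<lambda>\<omega> i. lam i \<omega>) \<in> measurable M (\<Pi>\<^sub>M i\<in>(UNIV::nat set). borel)"
      by (intro measurable_abs_UNIV) simp
    ultimately show ?thesis
      unfolding R.conditional_law_def seq_lam[symmetric] seq_law_def cond_law_def
      by (subst distr_distr) (auto simp: comp_def)
  qed
  have pos: "0 < 1 - a\<^sup>2" using a_pos a_less by (simp add: abs_square_less_1)
  have quarter: "ln (1 / 4) = - (2 * ln (2::real))"
  proof -
    have "ln (1 / 4) = - ln (4::real)" by (simp add: ln_div)
    then show ?thesis using ln_realpow[of "2::real" 2] by simp
  qed
  have dim: "2 * ln 2 / ln (1 / (1 - a\<^sup>2)) = ln 2 / (- R.exponent)"
    using pos by (simp add: R.exponent_def ln_div)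
  show ?thesis
  proof (intro conjI impI)
    assume "a < sqrt 3 / 2"
    then have "a\<^sup>2 < (sqrt 3 / 2)\<^sup>2" using a_pos by (intro power_strict_mono) auto
    then have "1 / 4 < 1 - a\<^sup>2" by (simp add: power_divide)
    then have "ln (1 / 4) < ln (1 - a\<^sup>2)" by (intro ln_less_cancel_iff[THEN iffD2]) auto
    then have "- ln 2 < R.exponent" unfolding quarter R.exponent_def by simp
    then show "AE ys in seq_law M y. absolutely_continuous lborel (cond_law M lam ys)"
      unfolding seq_y cond by (rule R.AE_conditional_law_absolutely_continuous)
  next
    assume "sqrt 3 / 2 \<le> a"
    then have "(sqrt 3 / 2)\<^sup>2 \<le> a\<^sup>2" by (intro power_mono) auto
    then have "1 - a\<^sup>2 \<le> 1 / 4" by (simp add: power_divide)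
    then have "ln (1 - a\<^sup>2) \<le> ln (1 / 4)" using pos by (intro ln_mono) auto
    then have le: "R.exponent \<le> - ln 2" unfolding quarter R.exponent_def by simp
    then have "ln 2 \<le> - R.exponent" by simp
    from R.AE_conditional_law_singular[OF le] R.AE_dim_conditional_law_ge[OF this] R.AE_dim_conditional_law_le
    show "AE ys in seq_law M y. mutually_singular lborel (cond_law M lam ys) \<and>
        hausdorff_dim_measure (cond_law M lam ys) = ennreal (2 * ln 2 / ln (1 / (1 - a\<^sup>2)))"
      unfolding seq_y cond dim by eventually_elim (auto intro: antisym)
  qed
qed

end
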